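(* Let $b>0$, $0<\nu<1$, $q\ge1$, let $\flat\ge 2$ be an integer, let $0\le\xi_1<\dots<\xi_\flat\le 1$ be collocation parameters, and let $\mu\in(0,1)$ be chosen so that $\nu/\mu\in\mathbb N$. Let $\varphi$ be the solution of $$\varphi'(x)=a(x)\varphi(x)+\chi(x)+\int_x^b (s-x)^{\nu-1}\mathscr K(x,s)\varphi(s)\,ds,\quad 0\le x\le b,\qquad \varphi(b)=\varphi_b\in\mathbb R,$$ and let $\psi:=\varphi'$. Then the collocation approximations $\psi_h,\varphi_h$ (defined in the context) satisfy the following estimates. (i) Assume that $a,\chi\in C^\flat(\Lambda)$, $\mathscr K\in C^\flat(D_R)$, and $\mathscr K(x,x)\ne0$ for all $x\in\Lambda$. Then there exist $\mathscr M_0\in\mathbb N$ and a constant $C$, independent of $\mathscr M$, such that, for all $\mathscr M>\mathscr M_0$, $$\|\psi-\psi_h\|_{L^\infty(\Lambda)}\le C\begin{cases}\mathscr M^{-\min\{q\mu\flat,\flat\}},&1/\mu\in\mathbb N\ \text{or}\ 1/\mu>\flat,\\ \mathscr M^{-\min\{q,\flat\}},&1/\mu\notin\mathbb N\ \text{and}\ 1/\mu<\flat,\end{cases}$$ and $$\|\varphi-\varphi_h\|_{L^\infty(\Lambda)}\le C\begin{cases}\varpi\bigl(q(\mu\flat+1),\flat;\mathscr M\bigr),&1/\mu\in\mathbb N\ \text{or}\ 1/\mu>\flat,\\ \varpi\bigl(2q,\flat;\mathscr M\bigr),&1/\mu\notin\mathbb N\ \text{and}\ 1/\mu<\flat.\end{cases}$$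 (ii) Assume that $a,\chi\in C^{\flat+1}(\Lambda)$, $\mathscr K\in C^{\flat+1}(D_R)$, and $\mathscr K(x,x)\ne0$ for all $x\in\Lambda$. Assume also that the collocation parameters satisfy $\int_0^1\prod_{l=1}^\flat(\zeta-\xi_l)\,d\zeta=0$. Then there exist $\mathscr M_0\in\mathbb N$ and a constant $C$, independent of $\mathscr M$, such that, for all $\mathscr M>\mathscr M_0$, $$\|\varphi-\varphi_h\|_{L^\infty(\Lambda)}\le C\begin{cases}\varpi\bigl(q(\mu\flat+1),\flat+1;\mathscr M\bigr),&1/\mu\in\mathbb N\ \text{or}\ 1/\mu>\flat,\\ \varpi\bigl(2q,\flat+1;\mathscr M\bigr),&1/\mu\notin\mathbb N\ \text{and}\ 1/\mu<\flat,\end{cases}$$ at the collocation points, $$\max_{x\in\cup_{j=1}^{\mathscr M}X_j}|\psi(x)-\psi_h(x)|\le C\begin{cases}\varpi\bigl(q(\mu\flat+1),\flat+1;\mathscr M\bigr),&1/\mu\in\mathbb N\ \text{or}\ 1/\mu>\flat,\\ \varpi\bigl(2q,\flat+1;\mathscr M\bigr),&1/\mu\notin\mathbb N\ \text{and}\ 1/\mu<\flat,\end{cases}$$ and at the regular endpoint $x=0$, $$|\psi(0)-\psi_h(0)|\le C\begin{cases}\varpi\bigl(q(\mu\flat+1),\flat;\mathscr M\bigr),&1/\mu\in\mathbb N\ \text{or}\ 1/\mu>\flat,\\ \varpi\bigl(2q,\flat;\mathscr M\bigr),&1/\mu\notin\mathbb N\ \text{and}\ 1/\mu<\flat.\end{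cases}$$
   Context: $\mathbb N=\{1,2,\dots\}$, $\Lambda:=[0,b]$, $D_R:=\{(x,s):0\le x\le s\le b\}$, and $\tau(\rho):=b-(b-\rho)^{1/\mu}$ for $\rho\in[b-b^\mu,b]$. Mesh. For $\mathscr M\in\mathbb N$ set $x_j=b\bigl(1-(\frac{\mathscr M-j}{\mathscr M})^q\bigr)$, $j=0,\dots,\mathscr M$; $\varrho_j=(x_{j-1},x_j]$; $\rho_j=b-(b-x_j)^\mu$; $h_{j,\mu}=\rho_j-\rho_{j-1}$. Collocation points: $X_j=\{x_{j,l}:l=1,\dots,\flat\}$ with $x_{j,l}=\tau(\eta_{j,l})$, $\eta_{j,l}=\rho_{j-1}+\xi_l h_{j,\mu}$, $j=1,\dots,\mathscr M$. Fractional backward Lagrange basis on (the closure of) $\varrho_j$: $$L_{j,l}^{\mu}(x)=\prod_{i\ne l,\,1\le i\le\flat}\frac{(b-x)^{\mu}-(b-x_{j,i})^{\mu}}{(b-x_{j,l})^{\mu}-(b-x_{j,i})^{\mu}}.$$ Collocation approximations. $\psi_h$ is, on each $\varrho_j$, of the form $\psi_h(x)=\sum_{k=1}^{\flat}Y_{j,k}L_{j,k}^\mu(x)$, where $Y_{j,k}=\psi_h(x_{j,k})$ (value of the $j$-th piece; $\psi_h(0)$ is the value at $0$ of the piece on the first interval), and $\varphi_h$ is defined by $\varphi_h(b)=\varphi_b$ and $\varphi_h(x)=\varphi_h(x_j)-\int_x^{x_j}\psi_h(s)\,ds$ for $x\in[x_{j-1},x_j]$, $j=\mathscr M,\dots,1$.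 The coefficients $Y_{j,l}$ are determined by the collocation equations $$Y_{j,l}=a(x_{j,l})\varphi_h(x_{j,l})+\chi(x_{j,l})+\int_{x_{j,l}}^{b}(s-x_{j,l})^{\nu-1}\mathscr K(x_{j,l},s)\varphi_h(s)\,ds,\qquad 1\le j\le\mathscr M,\ 1\le l\le\flat.$$ For $r,s>0$: $\varpi(r,s;\mathscr M)=\mathscr M^{-\min\{r,s\}}$ if $r\ne s$, and $\varpi(r,s;\mathscr M)=\mathscr M^{-\min\{r,s\}}\ln\mathscr M$ if $r=s$. *)

theory Defs
  imports "HOL-Analysis.Analysis" "HOL-Probability.Essential_Supremum"
begin

text \<open>
  \<open>C\<^sup>m[0,b]\<close>: the functions \<open>D k\<close> are the successive derivatives, one-sided at the end points.
\<close>

definition Ck_interval :: "nat \<Rightarrow> real \<Rightarrow> (real \<Rightarrow> real) \<Rightarrow> bool" where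
  "Ck_interval m b f \<longleftrightarrow>
     (\<exists>D :: nat \<Rightarrow> real \<Rightarrow> real.
        (\<forall>x\<in>{0..b}. D 0 x = f x) \<and>
        (\<forall>k<m. \<forall>x\<in>{0..b}. (D k has_real_derivative D (Suc k) x) (at x within {0..b})) \<and>
        (\<forall>k\<le>m. continuous_on {0..b} (D k)))"

definition D_R :: "real \<Rightarrow> (real \<times> real) set" where
  "D_R b = {(x, s). 0 \<le> x \<and> x \<le> s \<and> s \<le> b}"

text \<open>
  \<open>C\<^sup>m\<close> on the closed triangle: all partial derivatives of order at most \<open>m\<close> exist in the
  interior and extend continuously to the whole triangle. \<open>D i j\<close> is the (extended) derivative of
  order \<open>i\<close> in the first and \<open>j\<close> in the second variable; indexing by \<open>(i, j)\<close> loses nothing, as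
  continuous mixed partial derivatives do not depend on the order of differentiation.
\<close>

definition Ck_triangle :: "nat \<Rightarrow> real \<Rightarrow> (real \<Rightarrow> real \<Rightarrow> real) \<Rightarrow> bool" where
  "Ck_triangle m b K \<longleftrightarrow>
     (\<exists>D :: nat \<Rightarrow> nat \<Rightarrow> real \<Rightarrow> real \<Rightarrow> real.
        (\<forall>(x, s)\<in>D_R b. D 0 0 x s = K x s) \<and>
        (\<forall>i j. i + j \<le> m \<longrightarrow> continuous_on (D_R b) (\<lambda>(x, s). D i j x s)) \<and>
        (\<forall>i j. i + j < m \<longrightarrow>
           (\<forall>(x, s)\<in>interior (D_R b).
              ((\<lambda>t. D i j t s) has_real_derivative D (Suc i) j x s) (at x) \<and>
              ((\<lambda>t. D i j x t) has_real_derivative D i (Suc j) x s) (at s))))"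

text \<open>
  \<open>\<psi>\<close> is the derivative of \<open>\<phi>\<close> on \<open>[0,b]\<close>, one-sided at the end points.
\<close>

definition vide_solution ::
  "real \<Rightarrow> real \<Rightarrow> (real \<Rightarrow> real) \<Rightarrow> (real \<Rightarrow> real) \<Rightarrow> (real \<Rightarrow> real \<Rightarrow> real) \<Rightarrow> real \<Rightarrow>
   (real \<Rightarrow> real) \<Rightarrow> (real \<Rightarrow> real) \<Rightarrow> bool" where
  "vide_solution b \<nu> a g K \<phi>b \<phi> \<psi> \<longleftrightarrow>
     (\<forall>x\<in>{0..b}. (\<phi> has_real_derivative \<psi> x) (at x within {0..b})) \<and>
     (\<forall>x\<in>{0..b}. \<psi> x = a x * \<phi> x + g x +
        integral {x..b} (\<lambda>s. (s - x) powr (\<nu> - 1) * K x s * \<phi> s)) \<and>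
     \<phi> b = \<phi>b"

definition mesh :: "real \<Rightarrow> real \<Rightarrow> nat \<Rightarrow> nat \<Rightarrow> real" where
  "mesh b q M j = b * (1 - ((real M - real j) / real M) powr q)"

definition rho :: "real \<Rightarrow> real \<Rightarrow> real \<Rightarrow> nat \<Rightarrow> nat \<Rightarrow> real" where
  "rho b \<mu> q M j = b - (b - mesh b q M j) powr \<mu>"

definition tau :: "real \<Rightarrow> real \<Rightarrow> real \<Rightarrow> real" where
  "tau b \<mu> r = b - (b - r) powr (1 / \<mu>)"

definition coll_point ::
  "real \<Rightarrow> real \<Rightarrow> real \<Rightarrow> (nat \<Rightarrow> real) \<Rightarrow> nat \<Rightarrow> nat \<Rightarrow> nat \<Rightarrow> real" where
  "coll_point b \<mu> q \<xi> M j l =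
     tau b \<mu> (rho b \<mu> q M (j - 1) + \<xi> l * (rho b \<mu> q M j - rho b \<mu> q M (j - 1)))"

definition frac_lagrange ::
  "real \<Rightarrow> real \<Rightarrow> real \<Rightarrow> nat \<Rightarrow> (nat \<Rightarrow> real) \<Rightarrow> nat \<Rightarrow> nat \<Rightarrow> nat \<Rightarrow> real \<Rightarrow> real" where
  "frac_lagrange b \<mu> q n \<xi> M j l x =
     (\<Prod>i\<in>{1..n} - {l}.
        ((b - x) powr \<mu> - (b - coll_point b \<mu> q \<xi> M j i) powr \<mu>) /
        ((b - coll_point b \<mu> q \<xi> M j l) powr \<mu> - (b - coll_point b \<mu> q \<xi> M j i) powr \<mu>))"

text \<open>
  The \<open>j\<close>-th piece of \<open>\<psi>\<^sub>h\<close>, regarded as a function on the closed \<open>j\<close>-th mesh interval.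
\<close>

definition psi_piece ::
  "real \<Rightarrow> real \<Rightarrow> real \<Rightarrow> nat \<Rightarrow> (nat \<Rightarrow> real) \<Rightarrow> nat \<Rightarrow> (nat \<Rightarrow> nat \<Rightarrow> real) \<Rightarrow> nat \<Rightarrow> real \<Rightarrow> real" where
  "psi_piece b \<mu> q n \<xi> M Y j x = (\<Sum>k=1..n. Y j k * frac_lagrange b \<mu> q n \<xi> M j k x)"

text \<open>
  \<open>Y\<close> is the coefficient family of the collocation approximations \<open>\<psi>h\<close>, \<open>\<phi>h\<close>. If \<open>\<xi> 1 = 0\<close>, the
  point \<open>coll_point \<dots> j 1\<close> is the left end point of the \<open>j\<close>-th interval, where \<open>\<psi>h\<close> itself takes
  the value of the preceding piece; this is why the value of \<open>\<psi>h\<close> at a collocation point has to be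
  expressed with \<^const>\<open>psi_piece\<close>. Since the points of one interval are distinct, the piece
  \<open>psi_piece \<dots> Y j\<close> takes the value \<open>Y j l\<close> at the \<open>l\<close>-th of them.
\<close>

definition collocation_approx ::
  "real \<Rightarrow> real \<Rightarrow> real \<Rightarrow> real \<Rightarrow> nat \<Rightarrow> (nat \<Rightarrow> real) \<Rightarrow>
   (real \<Rightarrow> real) \<Rightarrow> (real \<Rightarrow> real) \<Rightarrow> (real \<Rightarrow> real \<Rightarrow> real) \<Rightarrow> real \<Rightarrow> nat \<Rightarrow>
   (nat \<Rightarrow> nat \<Rightarrow> real) \<Rightarrow> (real \<Rightarrow> real) \<Rightarrow> (real \<Rightarrow> real) \<Rightarrow> bool" where
  "collocation_approx b \<nu> \<mu> q n \<xi> a g K \<phi>b M Y \<psi>h \<phi>h \<longleftrightarrow>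
     (\<forall>j\<in>{1..M}. \<forall>x\<in>{mesh b q M (j - 1)<..mesh b q M j}. \<psi>h x = psi_piece b \<mu> q n \<xi> M Y j x) \<and>
     \<psi>h 0 = psi_piece b \<mu> q n \<xi> M Y 1 0 \<and>
     \<phi>h b = \<phi>b \<and>
     (\<forall>j\<in>{1..M}. \<forall>x\<in>{mesh b q M (j - 1)..mesh b q M j}.
        \<phi>h x = \<phi>h (mesh b q M j) - integral {x..mesh b q M j} \<psi>h) \<and>
     (\<forall>j\<in>{1..M}. \<forall>l\<in>{1..n}.
        let x = coll_point b \<mu> q \<xi> M j l in
          Y j l = a x * \<phi>h x + g x +
            integral {x..b} (\<lambda>s. (s - x) powr (\<nu> - 1) * K x s * \<phi>h s))"

definition collocation_well_posed ::
  "real \<Rightarrow> real \<Rightarrow> real \<Rightarrow> real \<Rightarrow> nat \<Rightarrow> (nat \<Rightarrow> real) \<Rightarrow>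
   (real \<Rightarrow> real) \<Rightarrow> (real \<Rightarrow> real) \<Rightarrow> (real \<Rightarrow> real \<Rightarrow> real) \<Rightarrow> real \<Rightarrow> nat \<Rightarrow> bool" where
  "collocation_well_posed b \<nu> \<mu> q n \<xi> a g K \<phi>b M \<longleftrightarrow>
     (\<exists>Y \<psi>h \<phi>h. collocation_approx b \<nu> \<mu> q n \<xi> a g K \<phi>b M Y \<psi>h \<phi>h) \<and>
     (\<forall>Y \<psi>h \<phi>h Y' \<psi>h' \<phi>h'.
        collocation_approx b \<nu> \<mu> q n \<xi> a g K \<phi>b M Y \<psi>h \<phi>h \<and>
        collocation_approx b \<nu> \<mu> q n \<xi> a g K \<phi>b M Y' \<psi>h' \<phi>h' \<longrightarrow>
        (\<forall>j\<in>{1..M}. \<forall>l\<in>{1..n}. Y j l = Y' j l))"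

text \<open>
  Extended-real valued, because \<^const>\<open>esssup\<close> needs a complete order; it is \<open>\<infinity>\<close> for
  non-measurable arguments, so an upper bound includes measurability.
\<close>

definition Linf_norm :: "real \<Rightarrow> (real \<Rightarrow> real) \<Rightarrow> ereal" where
  "Linf_norm b f = esssup (lebesgue_on {0..b}) (\<lambda>x. ereal \<bar>f x\<bar>)"

definition varpi :: "real \<Rightarrow> real \<Rightarrow> nat \<Rightarrow> real" where
  "varpi r s M =
     (if r \<noteq> s then real M powr (- min r s) else real M powr (- min r s) * ln (real M))"

end

theory Submission
  imports Defs
begin

text \<open>
  The variable that fits the problem is \<open>w = (b - x)\<^sup>\<mu>\<close>. As \<open>m = \<nu> / \<mu>\<close> is a positive integer, the
  integral term of the equation becomes \<open>w\<^sup>m\<close> times an integral over \<open>[0, 1]\<close> with the fixed weight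
  \<open>\<tau> powr (\<nu> - 1)\<close>, and such an operator does not destroy smoothness in \<open>w\<close>. What singularity there
  is comes from the substitution \<open>x = b - w powr (1 / \<mu>)\<close> alone: the \<open>k\<close>-th derivative of
  \<open>w powr (1 / \<mu>)\<close> is \<open>O(w powr (1 / \<mu> - k))\<close>, and bounded when \<open>1 / \<mu>\<close> is an integer. Put \<open>e = n\<close> if
  \<open>1 / \<mu>\<close> is an integer or exceeds \<open>n\<close>, and \<open>e = 1 / \<mu>\<close> otherwise. Alternating between
  the equation, which makes \<open>\<psi>\<close> as smooth as \<open>\<phi>\<close>, and \<open>\<phi>' = \<psi>\<close>, which gives \<open>\<phi>\<close> one derivative more,
  shows that the \<open>k\<close>-th \<open>w\<close>-derivative of \<open>\<psi>\<close> is \<open>O(w powr (e - k))\<close> for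
  \<open>k = n\<close>, and for \<open>k = n + 1\<close> if the data have one more derivative (\<open>wsmooth_\<psi>\<close>,
  \<open>derivatives_singular\<close>). With this \<open>e\<close> the two cases of every estimate are one: the order of
  \<open>\<psi>\<^sub>h\<close> is \<open>min (q * \<mu> * e) n\<close>, and the first argument of \<^const>\<open>varpi\<close> is \<open>r = q * (\<mu> * e + 1)\<close>.

  In \<open>w\<close> the pieces of \<open>\<psi>\<^sub>h\<close> are polynomials of degree below \<open>n\<close> on a mesh graded with exponent
  \<open>q * \<mu>\<close>. On the \<open>i\<close>-th mesh interval counted from \<open>b\<close>, the error of interpolating \<open>\<psi>\<close> is
  \<open>O((i / M) powr (q * \<mu> * e) / i\<^sup>n)\<close> (\<open>local_interpolation_error\<close>), and the length of the interval is
  \<open>O((i / M) powr q / i)\<close>. So the integral of the error is \<open>O((i / M) powr r / i ^ (n + 1))\<close>; if the node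
  polynomial has mean value zero, then its leading part cancels and a further factor \<open>1 / i\<close> is
  gained (\<open>interp_error_integral_bound\<close>). The sums of these terms over \<open>i\<close> are what
  \<^const>\<open>varpi\<close> describes; its logarithm is that of the harmonic sum (\<open>sum_mesh_weight_le\<close>).

  Stability needs no more than a Gronwall argument. At the collocation points \<open>\<psi> - \<psi>\<^sub>h\<close> is the image of
  \<open>\<phi> - \<phi>\<^sub>h\<close> under a bounded operator, and \<open>\<phi> - \<phi>\<^sub>h\<close> is the integral, backwards from \<open>b\<close>, of the
  interpolation error plus the interpolant of those nodal values. Hence \<open>\<phi> - \<phi>\<^sub>h\<close> is bounded by the
  largest integral of the interpolation error alone (\<open>backward_gronwall\<close>, \<open>collocation_error\<close>), and
  nodal errors inherit this bound. The same inequality without interpolation error gives uniqueness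
  of the coefficients; existence follows because they solve a square linear system.
\<close>

section \<open>Weakly singular integrals\<close>

lemma continuous_on_compact_bound:
  fixes f :: "'a::topological_space \<Rightarrow> real"
  assumes "continuous_on S f" "compact S"
  obtains B where "0 \<le> B" "\<And>x. x \<in> S \<Longrightarrow> \<bar>f x\<bar> \<le> B"
proof -
  obtain B where B: "\<forall>x\<in>S. \<bar>f x\<bar> \<le> B"
    using compact_imp_bounded[OF compact_continuous_image[OF assms]] unfolding bounded_iff by auto
  show thesis by (rule that[of "\<bar>B\<bar>"]) (use B in force)+
qed

lemma has_integral_powr_shift:
  fixes \<nu> x c :: real
  assumes "0 < \<nu>" "x \<le> c"
  shows "((\<lambda>s. (s - x) powr (\<nu> - 1)) has_integral (c - x) powr \<nu> / \<nu>) {x..c}"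
proof -
  have "((\<lambda>s. (s - x) powr (\<nu> - 1)) has_integral ((c - x) powr \<nu> / \<nu> - (x - x) powr \<nu> / \<nu>)) {x..c}"
  proof (rule fundamental_theorem_of_calculus_interior[OF assms(2)])
    show "continuous_on {x..c} (\<lambda>s. (s - x) powr \<nu> / \<nu>)"
      using assms by (intro continuous_intros continuous_on_powr') auto
    fix s assume "s \<in> {x<..<c}"
    then show "((\<lambda>s. (s - x) powr \<nu> / \<nu>) has_vector_derivative (s - x) powr (\<nu> - 1)) (at s)"
      unfolding has_real_derivative_iff_has_vector_derivative[symmetric]
      using assms by (auto intro!: derivative_eq_intros simp: powr_diff field_simps)
  qed
  then show ?thesis by simp
qed

text \<open>
  The weight is absolutely integrable and \<open>G\<close> is bounded and measurable. The interval is open because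
  the derivatives met below exist, and are bounded, on open intervals only.
\<close>

lemma weak_integrable:
  fixes \<nu> x c B :: real and G :: "real \<Rightarrow> real"
  assumes \<nu>: "0 < \<nu>" and xc: "x \<le> c" and G: "continuous_on {x<..<c} G"
    and B: "\<And>s. s \<in> {x<..<c} \<Longrightarrow> \<bar>G s\<bar> \<le> B"
  shows "(\<lambda>s. (s - x) powr (\<nu> - 1) * G s) integrable_on {x..c}"
proof -
  let ?I = "{x<..<c}"
  let ?k = "\<lambda>s. (s - x) powr (\<nu> - 1)"
  have "?k integrable_on {x..c}"
    using has_integral_powr_shift[OF \<nu> xc] by blast
  then have "?k integrable_on ?I" by (simp add: integrable_on_open_interval_real)
  then have "?k absolutely_integrable_on ?I"
    by (rule nonnegative_absolutely_integrable_1) simp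
  moreover have "bounded (G ` ?I)"
    unfolding bounded_iff using B by (auto intro!: exI[of _ B])
  moreover have "G \<in> borel_measurable (lebesgue_on ?I)"
    using G by (intro continuous_imp_measurable_on_sets_lebesgue) auto
  ultimately have "(\<lambda>s. G s * ?k s) absolutely_integrable_on ?I"
    by (intro absolutely_integrable_bounded_measurable_product_real) auto
  then have "(\<lambda>s. G s * ?k s) integrable_on ?I"
    using absolutely_integrable_on_def by blast
  then show ?thesis by (simp add: integrable_on_open_interval_real mult.commute)
qed

lemma weak_integral_bound:
  fixes \<nu> x c B :: real and G :: "real \<Rightarrow> real"
  assumes \<nu>: "0 < \<nu>" and xc: "x \<le> c" and G: "continuous_on {x<..<c} G"
    and B: "\<And>s. s \<in> {x<..<c} \<Longrightarrow> \<bar>G s\<bar> \<le> B"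
  shows "\<bar>integral {x..c} (\<lambda>s. (s - x) powr (\<nu> - 1) * G s)\<bar> \<le> B * ((c - x) powr \<nu> / \<nu>)"
proof -
  let ?I = "{x<..<c}"
  let ?k = "\<lambda>s. (s - x) powr (\<nu> - 1)"
  have 1: "(\<lambda>s. ?k s * G s) integrable_on ?I"
    using weak_integrable[OF assms] by (simp add: integrable_on_open_interval_real)
  have k: "(?k has_integral (c - x) powr \<nu> / \<nu>) ?I"
    using has_integral_powr_shift[OF \<nu> xc] by (simp add: has_integral_Icc_iff_Ioo)
  have 2: "((\<lambda>s. B * ?k s) has_integral B * ((c - x) powr \<nu> / \<nu>)) ?I"
    by (rule has_integral_mult_right[OF k])
  have "norm (integral ?I (\<lambda>s. ?k s * G s)) \<le> integral ?I (\<lambda>s. B * ?k s)"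
  proof (rule integral_norm_bound_integral[OF 1])
    show "(\<lambda>s. B * ?k s) integrable_on ?I" using 2 by blast
    show "norm (?k s * G s) \<le> B * ?k s" if "s \<in> ?I" for s
      using mult_right_mono[OF B[OF that], of "?k s"] by (simp add: abs_mult mult.commute)
  qed
  also have "\<dots> = B * ((c - x) powr \<nu> / \<nu>)" using 2 by (rule integral_unique)
  finally show ?thesis by (simp add: integral_open_interval_real)
qed

text \<open>
  Dominated convergence, with a multiple of the weight as the dominating function.
\<close>

lemma weak_integral_continuous:
  fixes \<nu> B :: real and f :: "'a::metric_space \<Rightarrow> real \<Rightarrow> real"
  assumes \<nu>: "0 < \<nu>"
    and c1: "\<And>w. w \<in> S \<Longrightarrow> continuous_on {0<..<1} (f w)"
    and c2: "\<And>\<sigma>. \<sigma> \<in> {0<..<1} \<Longrightarrow> continuous_on S (\<lambda>w. f w \<sigma>)"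
    and B: "\<And>w \<sigma>. w \<in> S \<Longrightarrow> \<sigma> \<in> {0<..<1} \<Longrightarrow> \<bar>f w \<sigma>\<bar> \<le> B"
  shows "continuous_on S (\<lambda>w. integral {0..1} (\<lambda>\<sigma>. \<sigma> powr (\<nu> - 1) * f w \<sigma>))"
  unfolding continuous_on_sequentially
proof (intro allI ballI impI, elim conjE)
  fix X :: "nat \<Rightarrow> 'a" and a assume a: "a \<in> S" and X: "\<forall>i. X i \<in> S" "X \<longlonglongrightarrow> a"
  let ?k = "\<lambda>\<sigma>::real. \<sigma> powr (\<nu> - 1)"
  have int: "(\<lambda>\<sigma>. ?k \<sigma> * f w \<sigma>) integrable_on {0<..<1}" if "w \<in> S" for w
    using weak_integrable[OF \<nu>, of 0 1 "f w" B] c1[OF that] B[OF that]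
    by (simp add: integrable_on_open_interval_real)
  have "(\<lambda>\<sigma>. B * (\<sigma> - 0) powr (\<nu> - 1)) integrable_on {0..1}"
    using has_integral_powr_shift[OF \<nu>, of 0 1] by (intro integrable_on_mult_right) auto
  then have kB: "(\<lambda>\<sigma>. B * ?k \<sigma>) integrable_on {0<..<1}"
    by (simp add: integrable_on_open_interval_real)
  have "(\<lambda>i. integral {0<..<1} (\<lambda>\<sigma>. ?k \<sigma> * f (X i) \<sigma>)) \<longlonglongrightarrow> integral {0<..<1} (\<lambda>\<sigma>. ?k \<sigma> * f a \<sigma>)"
  proof (rule dominated_convergence(2)[OF _ kB])
    show "(\<lambda>\<sigma>. ?k \<sigma> * f (X i) \<sigma>) integrable_on {0<..<1}" for i using int X by blast
    show "norm (?k \<sigma> * f (X i) \<sigma>) \<le> B * ?k \<sigma>" if "\<sigma> \<in> {0<..<1}" for i \<sigma>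
      using mult_right_mono[OF B[of "X i" \<sigma>], of "?k \<sigma>"] that X by (simp add: abs_mult mult.commute)
    show "(\<lambda>i. ?k \<sigma> * f (X i) \<sigma>) \<longlonglongrightarrow> ?k \<sigma> * f a \<sigma>" if "\<sigma> \<in> {0<..<1}" for \<sigma>
    proof -
      have "((\<lambda>w. f w \<sigma>) \<circ> X) \<longlonglongrightarrow> f a \<sigma>"
        using c2[OF that] a X unfolding continuous_on_sequentially by blast
      then show ?thesis by (intro tendsto_intros) (simp add: o_def)
    qed
  qed
  then show "((\<lambda>w. integral {0..1} (\<lambda>\<sigma>. ?k \<sigma> * f w \<sigma>)) \<circ> X) \<longlonglongrightarrow> integral {0..1} (\<lambda>\<sigma>. ?k \<sigma> * f a \<sigma>)"
    by (simp add: o_def integral_open_interval_real)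
qed

text \<open>
  Differentiation under the integral sign: by the mean value theorem the difference quotients are
  bounded by \<open>B\<close>, so that dominated convergence applies to them.
\<close>

lemma weak_integral_DERIV:
  fixes \<nu> B u v w :: real and f f' :: "real \<Rightarrow> real \<Rightarrow> real"
  assumes \<nu>: "0 < \<nu>" and w: "w \<in> {u<..<v}"
    and c: "\<And>w. w \<in> {u<..<v} \<Longrightarrow> continuous_on {0<..<1} (f w)"
    and fB: "\<And>w. w \<in> {u<..<v} \<Longrightarrow> \<exists>B. \<forall>\<sigma>\<in>{0<..<1}. \<bar>f w \<sigma>\<bar> \<le> B"
    and D: "\<And>w \<sigma>. w \<in> {u<..<v} \<Longrightarrow> \<sigma> \<in> {0<..<1} \<Longrightarrow> ((\<lambda>w. f w \<sigma>) has_real_derivative f' w \<sigma>) (at w)"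
    and B: "\<And>w \<sigma>. w \<in> {u<..<v} \<Longrightarrow> \<sigma> \<in> {0<..<1} \<Longrightarrow> \<bar>f' w \<sigma>\<bar> \<le> B"
  shows "((\<lambda>w. integral {0..1} (\<lambda>\<sigma>. \<sigma> powr (\<nu> - 1) * f w \<sigma>)) has_real_derivative
           integral {0..1} (\<lambda>\<sigma>. \<sigma> powr (\<nu> - 1) * f' w \<sigma>)) (at w)"
proof -
  let ?k = "\<lambda>\<sigma>::real. \<sigma> powr (\<nu> - 1)"
  let ?F = "\<lambda>w. integral {0..1} (\<lambda>\<sigma>. ?k \<sigma> * f w \<sigma>)"
  let ?U = "{u<..<v}"
  have int: "(\<lambda>\<sigma>. ?k \<sigma> * f y \<sigma>) integrable_on {0<..<1}" if y: "y \<in> ?U" for y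
  proof -
    obtain B where B: "\<forall>\<sigma>\<in>{0<..<1}. \<bar>f y \<sigma>\<bar> \<le> B" using fB[OF y] by blast
    then show ?thesis using weak_integrable[OF \<nu>, of 0 1 "f y" B] c[OF y] B
      by (simp add: integrable_on_open_interval_real)
  qed
  have "(\<lambda>\<sigma>. B * (\<sigma> - 0) powr (\<nu> - 1)) integrable_on {0..1}"
    using has_integral_powr_shift[OF \<nu>, of 0 1] by (intro integrable_on_mult_right) auto
  then have kB: "(\<lambda>\<sigma>. B * ?k \<sigma>) integrable_on {0<..<1}"
    by (simp add: integrable_on_open_interval_real)
  have "((\<lambda>y. (?F y - ?F w) / (y - w)) \<longlongrightarrow> integral {0..1} (\<lambda>\<sigma>. ?k \<sigma> * f' w \<sigma>)) (at w within ?U)"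
    unfolding tendsto_at_iff_sequentially
  proof (intro allI impI)
    fix X assume X: "\<forall>i. X i \<in> ?U - {w}" "X \<longlonglongrightarrow> w"
    let ?q = "\<lambda>i \<sigma>. (f (X i) \<sigma> - f w \<sigma>) / (X i - w)"
    have Xi: "X i \<in> ?U" "X i \<noteq> w" for i using X by auto
    have eq: "(?F (X i) - ?F w) / (X i - w) = integral {0<..<1} (\<lambda>\<sigma>. ?k \<sigma> * ?q i \<sigma>)" for i
    proof -
      have "?F (X i) - ?F w = integral {0<..<1} (\<lambda>\<sigma>. ?k \<sigma> * f (X i) \<sigma> - ?k \<sigma> * f w \<sigma>)"
        using integral_diff[OF int[OF Xi(1)[of i]] int[OF w]] by (simp add: integral_open_interval_real)
      then have "(?F (X i) - ?F w) / (X i - w)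
          = integral {0<..<1} (\<lambda>\<sigma>. (?k \<sigma> * f (X i) \<sigma> - ?k \<sigma> * f w \<sigma>) / (X i - w))"
        by simp
      then show ?thesis by (simp add: algebra_simps)
    qed
    have qint: "(\<lambda>\<sigma>. ?k \<sigma> * ?q i \<sigma>) integrable_on {0<..<1}" for i
    proof -
      have "(\<lambda>\<sigma>. (?k \<sigma> * f (X i) \<sigma> - ?k \<sigma> * f w \<sigma>) / (X i - w)) integrable_on {0<..<1}"
        by (intro integrable_on_divide integrable_diff int Xi w)
      then show ?thesis by (simp add: algebra_simps)
    qed
    have "(\<lambda>i. integral {0<..<1} (\<lambda>\<sigma>. ?k \<sigma> * ?q i \<sigma>)) \<longlonglongrightarrow> integral {0<..<1} (\<lambda>\<sigma>. ?k \<sigma> * f' w \<sigma>)"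
    proof (rule dominated_convergence(2)[OF qint kB])
      fix i \<sigma> assume \<sigma>: "\<sigma> \<in> {0<..<1::real}"
      have "norm (f (X i) \<sigma> - f w \<sigma>) \<le> B * norm (X i - w)"
      proof (rule field_differentiable_bound[where S="?U"])
        show "((\<lambda>w. f w \<sigma>) has_field_derivative f' z \<sigma>) (at z within ?U)" if "z \<in> ?U" for z
          using D[OF that \<sigma>] has_field_derivative_at_within by blast
        show "norm (f' z \<sigma>) \<le> B" if "z \<in> ?U" for z using B[OF that \<sigma>] by simp
      qed (use Xi w in auto)
      then have "\<bar>?q i \<sigma>\<bar> \<le> B" using Xi(2)[of i] by (simp add: field_simps)
      then show "norm (?k \<sigma> * ?q i \<sigma>) \<le> B * ?k \<sigma>"
        using mult_right_mono[of "\<bar>?q i \<sigma>\<bar>" B "?k \<sigma>"] by (simp add: abs_mult mult.commute)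
    next
      fix \<sigma> assume \<sigma>: "\<sigma> \<in> {0<..<1::real}"
      have "((\<lambda>y. (f y \<sigma> - f w \<sigma>) / (y - w)) \<longlongrightarrow> f' w \<sigma>) (at w within ?U)"
        using has_field_derivative_at_within[OF D[OF w \<sigma>]] unfolding has_field_derivative_iff .
      then have "(\<lambda>i. ?q i \<sigma>) \<longlonglongrightarrow> f' w \<sigma>"
        unfolding tendsto_at_iff_sequentially using X by (auto simp: o_def)
      then show "(\<lambda>i. ?k \<sigma> * ?q i \<sigma>) \<longlonglongrightarrow> ?k \<sigma> * f' w \<sigma>" by (intro tendsto_intros)
    qed
    then have "(\<lambda>i. (?F (X i) - ?F w) / (X i - w)) \<longlonglongrightarrow> integral {0<..<1} (\<lambda>\<sigma>. ?k \<sigma> * f' w \<sigma>)"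
      by (simp only: eq)
    then show "((\<lambda>y. (?F y - ?F w) / (y - w)) \<circ> X) \<longlonglongrightarrow> integral {0..1} (\<lambda>\<sigma>. ?k \<sigma> * f' w \<sigma>)"
      by (simp add: o_def integral_open_interval_real)
  qed
  then have "(?F has_real_derivative integral {0..1} (\<lambda>\<sigma>. ?k \<sigma> * f' w \<sigma>)) (at w within ?U)"
    unfolding has_field_derivative_iff .
  then show ?thesis by (simp only: at_within_open[OF w open_greaterThanLessThan])
qed

section \<open>Functions with algebraic end-point behaviour\<close>

text \<open>
  A function of \<open>w \<in> (0, W)\<close> that also depends on a parameter \<open>\<sigma> \<in> (0, 1)\<close> belongs to the class below
  if its \<open>j\<close>-th \<open>w\<close>-derivative is jointly continuous and \<open>O(1 + w powr (e - s - j))\<close>, uniformly in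
  \<open>\<sigma>\<close>, for all \<open>j \<le> k\<close>. The shift \<open>s\<close> makes the class of a derivative again one of these classes, so that closure properties
  follow by induction on \<open>k\<close> from the first derivative only. The parameter is the integration
  variable of the kernel integral; functions of \<open>w\<close> alone are constant in it.
\<close>

definition wbounded :: "real \<Rightarrow> real \<Rightarrow> nat \<Rightarrow> (real \<Rightarrow> real \<Rightarrow> real) \<Rightarrow> bool" where
  "wbounded W e s f \<longleftrightarrow>
     continuous_on ({0<..<W} \<times> {0<..<1}) (\<lambda>(w, \<sigma>). f w \<sigma>) \<and>
     (\<exists>C. \<forall>w\<in>{0<..<W}. \<forall>\<sigma>\<in>{0<..<1}. \<bar>f w \<sigma>\<bar> \<le> C * (1 + w powr (e - real s)))"

primrec wsmooth :: "real \<Rightarrow> real \<Rightarrow> nat \<Rightarrow> nat \<Rightarrow> (real \<Rightarrow> real \<Rightarrow> real) \<Rightarrow> bool" where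
  "wsmooth W e 0 s f = wbounded W e s f"
| "wsmooth W e (Suc k) s f = (wbounded W e s f \<and>
     (\<exists>f'. (\<forall>w\<in>{0<..<W}. \<forall>\<sigma>\<in>{0<..<1}. ((\<lambda>u. f u \<sigma>) has_real_derivative f' w \<sigma>) (at w)) \<and>
           wsmooth W e k (Suc s) f'))"

lemma wsmooth_SucI:
  assumes "wbounded W e s f"
    and "\<And>w \<sigma>. w \<in> {0<..<W} \<Longrightarrow> \<sigma> \<in> {0<..<1} \<Longrightarrow> ((\<lambda>u. f u \<sigma>) has_real_derivative f' w \<sigma>) (at w)"
    and "wsmooth W e k (Suc s) f'"
  shows "wsmooth W e (Suc k) s f"
  unfolding wsmooth.simps using assms by blast

lemma wsmooth_SucE:
  assumes "wsmooth W e (Suc k) s f"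
  obtains f' where "wbounded W e s f"
    and "\<And>w \<sigma>. w \<in> {0<..<W} \<Longrightarrow> \<sigma> \<in> {0<..<1} \<Longrightarrow> ((\<lambda>u. f u \<sigma>) has_real_derivative f' w \<sigma>) (at w)"
    and "wsmooth W e k (Suc s) f'"
  using assms unfolding wsmooth.simps by blast

lemma wsmooth_imp_wbounded: "wsmooth W e k s f \<Longrightarrow> wbounded W e s f"
  by (cases k) auto

lemma wboundedI:
  assumes "continuous_on ({0<..<W} \<times> {0<..<1}) (\<lambda>(w, \<sigma>). f w \<sigma>)"
    and "\<And>w \<sigma>. w \<in> {0<..<W} \<Longrightarrow> \<sigma> \<in> {0<..<1} \<Longrightarrow> \<bar>f w \<sigma>\<bar> \<le> C * (1 + w powr (e - real s))"
  shows "wbounded W e s f"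
  using assms unfolding wbounded_def by blast

lemma wboundedE:
  assumes "wbounded W e s f"
  obtains C where "C \<ge> 0"
    and "\<And>w \<sigma>. w \<in> {0<..<W} \<Longrightarrow> \<sigma> \<in> {0<..<1} \<Longrightarrow> \<bar>f w \<sigma>\<bar> \<le> C * (1 + w powr (e - real s))"
proof -
  obtain C where C: "\<forall>w\<in>{0<..<W}. \<forall>\<sigma>\<in>{0<..<1}. \<bar>f w \<sigma>\<bar> \<le> C * (1 + w powr (e - real s))"
    using assms unfolding wbounded_def by blast
  show thesis
  proof (rule that[of "\<bar>C\<bar>"])
    fix w \<sigma> :: real assume "w \<in> {0<..<W}" "\<sigma> \<in> {0<..<1}"
    then have "\<bar>f w \<sigma>\<bar> \<le> C * (1 + w powr (e - real s))" using C by blast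
    also have "\<dots> \<le> \<bar>C\<bar> * (1 + w powr (e - real s))" by (intro mult_right_mono) auto
    finally show "\<bar>f w \<sigma>\<bar> \<le> \<bar>C\<bar> * (1 + w powr (e - real s))" .
  qed simp
qed

lemma wbounded_cont: "wbounded W e s f \<Longrightarrow> continuous_on ({0<..<W} \<times> {0<..<1}) (\<lambda>(w, \<sigma>). f w \<sigma>)"
  by (simp add: wbounded_def)

lemma wbounded_sections:
  assumes "wbounded W e s f"
  shows "w \<in> {0<..<W} \<Longrightarrow> continuous_on {0<..<1} (f w)"
    and "\<sigma> \<in> {0<..<1} \<Longrightarrow> continuous_on {0<..<W} (\<lambda>w. f w \<sigma>)"
proof -
  assume "w \<in> {0<..<W}"
  then have "continuous_on {0<..<1} (\<lambda>\<sigma>. (\<lambda>(w, \<sigma>). f w \<sigma>) (w, \<sigma>))"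
    by (intro continuous_on_compose2[OF wbounded_cont[OF assms]]) (auto intro!: continuous_intros)
  then show "continuous_on {0<..<1} (f w)" by simp
next
  assume "\<sigma> \<in> {0<..<1}"
  then have "continuous_on {0<..<W} (\<lambda>w. (\<lambda>(w, \<sigma>). f w \<sigma>) (w, \<sigma>))"
    by (intro continuous_on_compose2[OF wbounded_cont[OF assms]]) (auto intro!: continuous_intros)
  then show "continuous_on {0<..<W} (\<lambda>w. f w \<sigma>)" by simp
qed

lemma wbounded_if_bounded:
  assumes "continuous_on ({0<..<W} \<times> {0<..<1}) (\<lambda>(w, \<sigma>). f w \<sigma>)"
    and B: "\<And>w \<sigma>. w \<in> {0<..<W} \<Longrightarrow> \<sigma> \<in> {0<..<1} \<Longrightarrow> \<bar>f w \<sigma>\<bar> \<le> B"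
  shows "wbounded W e s f"
proof (rule wboundedI[OF assms(1), where C=B])
  fix w \<sigma> :: real assume w: "w \<in> {0<..<W}" "\<sigma> \<in> {0<..<1}"
  have "0 \<le> B" using B[OF w] by linarith
  then have "B * 1 \<le> B * (1 + w powr (e - real s))" by (intro mult_left_mono) auto
  then show "\<bar>f w \<sigma>\<bar> \<le> B * (1 + w powr (e - real s))" using B[OF w] by linarith
qed

lemma wsmooth_mono: "wsmooth W e (Suc k) s f \<Longrightarrow> wsmooth W e k s f"
proof (induction k arbitrary: s f)
  case (Suc k)
  from Suc.prems obtain f' where *: "wbounded W e s f"
    "\<And>w \<sigma>. w \<in> {0<..<W} \<Longrightarrow> \<sigma> \<in> {0<..<1} \<Longrightarrow> ((\<lambda>u. f u \<sigma>) has_real_derivative f' w \<sigma>) (at w)"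
    "wsmooth W e (Suc k) (Suc s) f'" by (rule wsmooth_SucE) blast
  from wsmooth_SucI[OF *(1,2) Suc.IH[OF *(3)]] show ?case .
qed simp

lemma wbounded_cong:
  assumes "\<And>w \<sigma>. w \<in> {0<..<W} \<Longrightarrow> \<sigma> \<in> {0<..<1} \<Longrightarrow> f w \<sigma> = g w \<sigma>" and "wbounded W e s f"
  shows "wbounded W e s g"
proof -
  have "continuous_on ({0<..<W} \<times> {0<..<1}) (\<lambda>(w, \<sigma>). g w \<sigma>) \<longleftrightarrow>
        continuous_on ({0<..<W} \<times> {0<..<1}) (\<lambda>(w, \<sigma>). f w \<sigma>)"
    using assms(1) by (intro continuous_on_cong) auto
  then show ?thesis using assms unfolding wbounded_def by auto
qed

lemma wsmooth_cong:
  assumes eq: "\<And>w \<sigma>. w \<in> {0<..<W} \<Longrightarrow> \<sigma> \<in> {0<..<1} \<Longrightarrow> f w \<sigma> = g w \<sigma>" and f: "wsmooth W e k s f"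
  shows "wsmooth W e k s g"
proof (cases k)
  case 0
  then show ?thesis using f wbounded_cong[OF eq] by auto
next
  case (Suc m)
  from f[unfolded Suc] obtain f' where *: "wbounded W e s f"
    "\<And>w \<sigma>. w \<in> {0<..<W} \<Longrightarrow> \<sigma> \<in> {0<..<1} \<Longrightarrow> ((\<lambda>u. f u \<sigma>) has_real_derivative f' w \<sigma>) (at w)"
    "wsmooth W e m (Suc s) f'" by (rule wsmooth_SucE) blast
  have "wsmooth W e (Suc m) s g"
  proof (rule wsmooth_SucI[OF _ _ *(3)])
    show "wbounded W e s g" using *(1) wbounded_cong[OF eq] by auto
    fix w \<sigma> :: real assume w: "w \<in> {0<..<W}" "\<sigma> \<in> {0<..<1}"
    show "((\<lambda>u. g u \<sigma>) has_real_derivative f' w \<sigma>) (at w)"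
      using *(2)[OF w] by (rule has_field_derivative_transform_within_open[where S="{0<..<W}"]) (use w eq in auto)
  qed
  then show ?thesis using Suc by simp
qed

lemma wbounded_add:
  assumes "wbounded W e s f" "wbounded W e s g"
  shows "wbounded W e s (\<lambda>w \<sigma>. f w \<sigma> + g w \<sigma>)"
proof -
  obtain C where C: "\<And>w \<sigma>. w \<in> {0<..<W} \<Longrightarrow> \<sigma> \<in> {0<..<1} \<Longrightarrow> \<bar>f w \<sigma>\<bar> \<le> C * (1 + w powr (e - real s))"
    using assms(1) by (rule wboundedE) blast
  obtain C' where C': "\<And>w \<sigma>. w \<in> {0<..<W} \<Longrightarrow> \<sigma> \<in> {0<..<1} \<Longrightarrow> \<bar>g w \<sigma>\<bar> \<le> C' * (1 + w powr (e - real s))"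
    using assms(2) by (rule wboundedE) blast
  show ?thesis
  proof (rule wboundedI[where C="C + C'"])
    show "continuous_on ({0<..<W} \<times> {0<..<1}) (\<lambda>(w, \<sigma>). f w \<sigma> + g w \<sigma>)"
      using continuous_on_add[OF wbounded_cont[OF assms(1)] wbounded_cont[OF assms(2)]]
      by (simp add: case_prod_beta)
    fix w \<sigma> :: real assume w: "w \<in> {0<..<W}" "\<sigma> \<in> {0<..<1}"
    show "\<bar>f w \<sigma> + g w \<sigma>\<bar> \<le> (C + C') * (1 + w powr (e - real s))"
      using C[OF w] C'[OF w] abs_triangle_ineq[of "f w \<sigma>" "g w \<sigma>"] by (simp add: distrib_right)
  qed
qed

lemma wsmooth_add:
  "wsmooth W e k s f \<Longrightarrow> wsmooth W e k s g \<Longrightarrow> wsmooth W e k s (\<lambda>w \<sigma>. f w \<sigma> + g w \<sigma>)"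
proof (induction k arbitrary: s f g)
  case 0
  then show ?case by (simp add: wbounded_add)
next
  case (Suc k)
  from Suc.prems(1) obtain f' where f: "wbounded W e s f"
    "\<And>w \<sigma>. w \<in> {0<..<W} \<Longrightarrow> \<sigma> \<in> {0<..<1} \<Longrightarrow> ((\<lambda>u. f u \<sigma>) has_real_derivative f' w \<sigma>) (at w)"
    "wsmooth W e k (Suc s) f'" by (rule wsmooth_SucE) blast
  from Suc.prems(2) obtain g' where g: "wbounded W e s g"
    "\<And>w \<sigma>. w \<in> {0<..<W} \<Longrightarrow> \<sigma> \<in> {0<..<1} \<Longrightarrow> ((\<lambda>u. g u \<sigma>) has_real_derivative g' w \<sigma>) (at w)"
    "wsmooth W e k (Suc s) g'" by (rule wsmooth_SucE) blast
  show ?case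
    by (rule wsmooth_SucI[OF wbounded_add[OF f(1) g(1)] _ Suc.IH[OF f(3) g(3)]])
      (intro DERIV_add f g)
qed

lemma powr_le_powr_bounded:
  fixes w W a c :: real
  assumes "0 < w" "w \<le> W" "c \<le> a"
  shows "w powr a \<le> W powr (a - c) * w powr c"
proof -
  have "w powr a = w powr (a - c) * w powr c" by (simp add: powr_add[symmetric])
  also have "\<dots> \<le> W powr (a - c) * w powr c"
    using assms by (intro mult_right_mono powr_mono2) auto
  finally show ?thesis .
qed

lemma powr_le_endpoints:
  fixes u v W a :: real
  assumes "0 < v" "v \<le> u" "u \<le> W"
  shows "u powr a \<le> v powr a + W powr a"
proof (cases "a \<ge> 0")
  case True
  then have "u powr a \<le> W powr a" using assms by (intro powr_mono2) auto
  then show ?thesis by (simp add: add_increasing)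
next
  case False
  then have "u powr a \<le> v powr a" using assms by (intro powr_mono2') auto
  then show ?thesis by (simp add: add_increasing2)
qed

text \<open>
  \<open>(1 + w powr (e - s)) (1 + w powr (e - s'))\<close> is dominated by \<open>1 + w powr (e - s - s')\<close> since \<open>w\<close> is
  bounded and each of the exponents \<open>e - s\<close>, \<open>e - s'\<close> and \<open>2 e - s - s'\<close> is at least \<open>e - s - s'\<close>.
\<close>

lemma wbounded_mult:
  assumes e: "0 \<le> e" and "wbounded W e s f" "wbounded W e s' g"
  shows "wbounded W e (s + s') (\<lambda>w \<sigma>. f w \<sigma> * g w \<sigma>)"
proof -
  obtain C where C: "C \<ge> 0" "\<And>w \<sigma>. w \<in> {0<..<W} \<Longrightarrow> \<sigma> \<in> {0<..<1} \<Longrightarrow> \<bar>f w \<sigma>\<bar> \<le> C * (1 + w powr (e - real s))"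
    using assms(2) by (rule wboundedE) blast
  obtain C' where C': "C' \<ge> 0" "\<And>w \<sigma>. w \<in> {0<..<W} \<Longrightarrow> \<sigma> \<in> {0<..<1} \<Longrightarrow> \<bar>g w \<sigma>\<bar> \<le> C' * (1 + w powr (e - real s'))"
    using assms(3) by (rule wboundedE) blast
  define A where "A = 1 + W powr s + W powr s' + W powr e"
  show ?thesis
  proof (rule wboundedI[where C="C * C' * A"])
    show "continuous_on ({0<..<W} \<times> {0<..<1}) (\<lambda>(w, \<sigma>). f w \<sigma> * g w \<sigma>)"
      using continuous_on_mult[OF wbounded_cont[OF assms(2)] wbounded_cont[OF assms(3)]]
      by (simp add: case_prod_beta)
    fix w \<sigma> :: real assume w: "w \<in> {0<..<W}" "\<sigma> \<in> {0<..<1}"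
    let ?x = "w powr (e - real s)" and ?y = "w powr (e - real s')" and ?z = "w powr (e - real (s + s'))"
    have w': "0 < w" "w \<le> W" using w by auto
    have x: "?x \<le> W powr s' * ?z"
      using powr_le_powr_bounded[OF w', of "e - real (s + s')" "e - real s"] by simp
    have y: "?y \<le> W powr s * ?z"
      using powr_le_powr_bounded[OF w', of "e - real (s + s')" "e - real s'"] by simp
    have xy: "?x * ?y \<le> W powr e * ?z"
      using powr_le_powr_bounded[OF w', of "e - real (s + s')" "(e - real s) + (e - real s')"] e
      by (simp add: powr_add[symmetric])
    have "(1 + ?x) * (1 + ?y) = 1 + ?x + ?y + ?x * ?y" by (simp add: algebra_simps)
    also have "\<dots> \<le> 1 + (W powr s' + W powr s + W powr e) * ?z" using x y xy by (simp add: algebra_simps)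
    also have "\<dots> \<le> A + A * ?z"
    proof (rule add_mono)
      show "1 \<le> A" unfolding A_def by simp
      show "(W powr s' + W powr s + W powr e) * ?z \<le> A * ?z"
        unfolding A_def by (rule mult_right_mono) auto
    qed
    finally have *: "(1 + ?x) * (1 + ?y) \<le> A * (1 + ?z)" by (simp add: algebra_simps)
    have "\<bar>f w \<sigma> * g w \<sigma>\<bar> \<le> (C * (1 + ?x)) * (C' * (1 + ?y))"
      unfolding abs_mult by (intro mult_mono C(2) C'(2) w mult_nonneg_nonneg C(1)) auto
    also have "\<dots> = (C * C') * ((1 + ?x) * (1 + ?y))" by simp
    also have "\<dots> \<le> (C * C') * (A * (1 + ?z))"
      using C(1) C'(1) by (intro mult_left_mono[OF *]) auto
    finally show "\<bar>f w \<sigma> * g w \<sigma>\<bar> \<le> C * C' * A * (1 + ?z)" by (simp add: mult.assoc)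
  qed
qed

text \<open>
  By Leibniz: shifts add up, hence \<open>f' g\<close> and \<open>f g'\<close> both have the shift \<open>s + s' + 1\<close>.
\<close>

lemma wsmooth_mult:
  assumes "0 \<le> e"
  shows "wsmooth W e k s f \<Longrightarrow> wsmooth W e k s' g \<Longrightarrow> wsmooth W e k (s + s') (\<lambda>w \<sigma>. f w \<sigma> * g w \<sigma>)"
proof (induction k arbitrary: s s' f g)
  case 0
  then show ?case using assms by (simp add: wbounded_mult)
next
  case (Suc k)
  from Suc.prems(1) obtain f' where f: "wbounded W e s f"
    "\<And>w \<sigma>. w \<in> {0<..<W} \<Longrightarrow> \<sigma> \<in> {0<..<1} \<Longrightarrow> ((\<lambda>u. f u \<sigma>) has_real_derivative f' w \<sigma>) (at w)"
    "wsmooth W e k (Suc s) f'" by (rule wsmooth_SucE) blast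
  from Suc.prems(2) obtain g' where g: "wbounded W e s' g"
    "\<And>w \<sigma>. w \<in> {0<..<W} \<Longrightarrow> \<sigma> \<in> {0<..<1} \<Longrightarrow> ((\<lambda>u. g u \<sigma>) has_real_derivative g' w \<sigma>) (at w)"
    "wsmooth W e k (Suc s') g'" by (rule wsmooth_SucE) blast
  have 1: "wsmooth W e k (Suc (s + s')) (\<lambda>w \<sigma>. f' w \<sigma> * g w \<sigma>)"
    using Suc.IH[OF f(3) wsmooth_mono[OF Suc.prems(2)]] by simp
  have 2: "wsmooth W e k (Suc (s + s')) (\<lambda>w \<sigma>. g' w \<sigma> * f w \<sigma>)"
    using Suc.IH[OF g(3) wsmooth_mono[OF Suc.prems(1)]] by (simp add: add.commute)
  show ?case
    by (rule wsmooth_SucI[OF wbounded_mult[OF assms f(1) g(1)] _ wsmooth_add[OF 1 2]])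
      (intro DERIV_mult f g)
qed

lemma wsmooth_fun_of_\<sigma>:
  assumes "continuous_on {0<..<1} h" "\<And>\<sigma>. \<sigma> \<in> {0<..<1} \<Longrightarrow> \<bar>h \<sigma>\<bar> \<le> C"
  shows "wsmooth W e k s (\<lambda>w \<sigma>. h \<sigma>)"
  using assms
proof (induction k arbitrary: s h C)
  case (0 s h C)
  have "wbounded W e s (\<lambda>w \<sigma>. h \<sigma>)"
  proof (rule wbounded_if_bounded)
    show "continuous_on ({0<..<W} \<times> {0<..<1}) (\<lambda>(w, \<sigma>). h \<sigma>)"
      unfolding case_prod_beta
      by (rule continuous_on_compose2[OF 0(1)]) (auto intro!: continuous_intros)
  qed (rule 0(2))
  then show ?case by simp
next
  case (Suc k)
  have 0: "wbounded W e s (\<lambda>w \<sigma>. h \<sigma>)"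
    using wsmooth_imp_wbounded[OF Suc.IH[OF Suc.prems]] .
  show ?case
    by (rule wsmooth_SucI[OF 0, where f'="\<lambda>w \<sigma>. 0"]) (auto intro!: Suc.IH[where C=0])
qed

lemma wsmooth_const: "wsmooth W e k s (\<lambda>w \<sigma>. c)"
  by (rule wsmooth_fun_of_\<sigma>[where C="\<bar>c\<bar>"]) auto

lemma wsmooth_ident: "wsmooth W e k 0 (\<lambda>w \<sigma>. w)"
proof -
  have 0: "wbounded W e 0 (\<lambda>w \<sigma>. w)"
  proof (rule wbounded_if_bounded[where B=W])
    show "continuous_on ({0<..<W} \<times> {0<..<1}) (\<lambda>(w, \<sigma>). w)"
      unfolding case_prod_beta by (auto intro!: continuous_intros)
  qed auto
  show ?thesis
  proof (cases k)
    case (Suc m)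
    have "wsmooth W e (Suc m) 0 (\<lambda>w \<sigma>. w)"
      by (rule wsmooth_SucI[OF 0, where f'="\<lambda>w \<sigma>. 1"]) (auto intro!: wsmooth_const)
    then show ?thesis using Suc by simp
  qed (use 0 in simp)
qed

lemma wsmooth_power: "0 \<le> e \<Longrightarrow> wsmooth W e k 0 (\<lambda>w \<sigma>. w ^ m)"
proof (induction m)
  case (Suc m)
  then show ?case using wsmooth_mult[of e W k 0 "\<lambda>w \<sigma>. w" 0 "\<lambda>w \<sigma>. w ^ m"] wsmooth_ident by simp
qed (simp add: wsmooth_const)

text \<open>
  The \<open>j\<close>-th derivative of \<open>w powr p\<close>. If \<open>p\<close> is an integer, its coefficient vanishes for \<open>j > p\<close> and
  the derivative is bounded for every \<open>e\<close>; otherwise \<open>w powr (p - j)\<close> is dominated by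
  \<open>w powr (e - j)\<close> because \<open>e \<le> p\<close>. This is the origin of the distinction between integers and other
  values of \<open>1 / \<mu>\<close>.
\<close>

lemma wsmooth_powr_derivs:
  fixes p e W :: real
  assumes p: "0 < p" and ep: "p \<in> \<nat> \<or> e \<le> p" and e: "0 \<le> e"
  shows "wsmooth W e k j (\<lambda>w \<sigma>. (\<Prod>i<j. p - real i) * w powr (p - real j))"
proof (induction k arbitrary: j)
  case 0
  let ?c = "\<lambda>j. \<Prod>i<j. p - real i"
  have b: "\<bar>?c j * w powr (p - real j)\<bar> \<le> (\<bar>?c j\<bar> * (W powr (p - real j) + W powr (p - e))) * (1 + w powr (e - real j))"
    if w: "w \<in> {0<..<W}" for j w
  proof (cases "?c j = 0")
    case False
    have w': "0 < w" "w \<le> W" using w by auto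
    have "w powr (p - real j) \<le> (W powr (p - real j) + W powr (p - e)) * (1 + w powr (e - real j))"
    proof (cases "e \<le> p")
      case True
      have "w powr (p - real j) \<le> W powr (p - e) * w powr (e - real j)"
        using powr_le_powr_bounded[OF w', of "e - real j" "p - real j"] True by simp
      also have "\<dots> \<le> (W powr (p - real j) + W powr (p - e)) * (1 + w powr (e - real j))"
        by (intro mult_mono) auto
      finally show ?thesis .
    next
      case F: False
      then have "p \<in> \<nat>" using ep by auto
      then obtain P where P: "p = real P" by (auto simp: Nats_def)
      have "\<not> P < j" using False P by auto
      then have "w powr (p - real j) \<le> W powr (p - real j)"
        using w' P by (intro powr_mono2) auto
      also have "\<dots> \<le> (W powr (p - real j) + W powr (p - e)) * (1 + w powr (e - real j))"
        using mult_mono[of "W powr (p - real j)" "W powr (p - real j) + W powr (p - e)" 1 "1 + w powr (e - real j)"] by simp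
      finally show ?thesis .
    qed
    then show ?thesis
      using mult_left_mono[of "w powr (p - real j)" _ "\<bar>?c j\<bar>"] by (simp add: abs_mult mult.assoc)
  next
    case True
    then show ?thesis by (simp only: abs_zero mult_zero_left order_refl)
  qed
  have "continuous_on ({0<..<W} \<times> {0<..<1}) (\<lambda>(w, \<sigma>::real). ?c j * w powr (p - real j))" for j
    unfolding case_prod_beta by (auto intro!: continuous_intros)
  then have "wbounded W e j (\<lambda>w \<sigma>. ?c j * w powr (p - real j))" by (rule wboundedI) (rule b)
  then show ?case by simp
next
  case (Suc k)
  show ?case
  proof (rule wsmooth_SucI[OF wsmooth_imp_wbounded[OF Suc.IH] _ Suc.IH])
    fix w \<sigma> :: real assume w: "w \<in> {0<..<W}" "\<sigma> \<in> {0<..<1}"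
    have "((\<lambda>u. u powr (p - real j)) has_real_derivative (p - real j) * w powr (p - real j - 1)) (at w)"
      by (rule has_real_derivative_powr) (use w in auto)
    from DERIV_cmult[OF this, of "\<Prod>i<j. p - real i"]
    show "((\<lambda>u. (\<Prod>i<j. p - real i) * u powr (p - real j)) has_real_derivative
        (\<Prod>i<Suc j. p - real i) * w powr (p - real (Suc j))) (at w)"
      by (simp add: algebra_simps)
  qed
qed

text \<open>
  The derivative \<open>p * w powr (p - 1)\<close> of the substitution has shift 1, which is what the chain rule
  needs: a function of \<open>w powr p\<close> loses one derivative and gains one shift.
\<close>

lemma wsmooth_powr:
  fixes p e W :: real
  assumes "0 < p" "p \<in> \<nat> \<or> e \<le> p" "0 \<le> e"
  shows "wsmooth W e k 0 (\<lambda>w \<sigma>. w powr p)"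
    and "wsmooth W e k (Suc 0) (\<lambda>w \<sigma>. p * w powr (p - 1))"
  using wsmooth_powr_derivs[OF assms, of W k 0] wsmooth_powr_derivs[OF assms, of W k 1] by simp_all

text \<open>
  Differentiating \<open>h (w * (1 - \<sigma>) powr \<mu>)\<close> produces the factor \<open>(1 - \<sigma>) powr \<mu>\<close>; the powers of it that
  have accumulated after \<open>s\<close> derivatives absorb the singularity of \<open>h\<close> at the dilated point, since
  \<open>(1 - \<sigma>) powr (\<mu> * s) * (w * (1 - \<sigma>) powr \<mu>) powr (e - s)\<close> equals
  \<open>w powr (e - s) * (1 - \<sigma>) powr (\<mu> * e)\<close>.
\<close>

lemma wsmooth_dilation:
  fixes \<mu> :: real
  assumes \<mu>: "0 < \<mu>" and e: "0 \<le> e"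
  shows "wsmooth W e k s (\<lambda>w \<sigma>. h w) \<Longrightarrow>
    wsmooth W e k s (\<lambda>w \<sigma>. (1 - \<sigma>) powr (\<mu> * s) * h (w * (1 - \<sigma>) powr \<mu>))"
proof (induction k arbitrary: s h)
  case (0 s h)
  then have h: "wbounded W e s (\<lambda>w \<sigma>. h w)" by simp
  obtain C where C: "C \<ge> 0" "\<And>w \<sigma>. w \<in> {0<..<W} \<Longrightarrow> \<sigma> \<in> {0<..<1::real} \<Longrightarrow> \<bar>h w\<bar> \<le> C * (1 + w powr (e - real s))"
    using h by (rule wboundedE) blast
  have C': "\<bar>h w\<bar> \<le> C * (1 + w powr (e - real s))" if "w \<in> {0<..<W}" for w
    using C(2)[OF that, of "1/2"] by simp
  have hc: "continuous_on {0<..<W} h" using wbounded_sections(2)[OF h, of "1/2"] by simp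
  have in01: "w * (1 - \<sigma>) powr \<mu> \<in> {0<..<W}" if "w \<in> {0<..<W}" "\<sigma> \<in> {0<..<1}" for w \<sigma> :: real
  proof -
    have "(1 - \<sigma>) powr \<mu> \<le> 1" using that \<mu> by (intro powr_le1) auto
    then have "w * (1 - \<sigma>) powr \<mu> \<le> w * 1" using that by (intro mult_left_mono) auto
    moreover have "0 < (1 - \<sigma>) powr \<mu>" using that by simp
    then have "0 < w * (1 - \<sigma>) powr \<mu>" using that by simp
    ultimately show ?thesis using that by simp
  qed
  have "wbounded W e s (\<lambda>w \<sigma>. (1 - \<sigma>) powr (\<mu> * s) * h (w * (1 - \<sigma>) powr \<mu>))"
  proof (rule wboundedI[where C=C])
    show "continuous_on ({0<..<W} \<times> {0<..<1}) (\<lambda>(w, \<sigma>). (1 - \<sigma>) powr (\<mu> * s) * h (w * (1 - \<sigma>) powr \<mu>))"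
      unfolding case_prod_beta
      by (intro continuous_intros continuous_on_compose2[OF hc]) (use in01 in auto)
    fix w \<sigma> :: real assume w: "w \<in> {0<..<W}" "\<sigma> \<in> {0<..<1}"
    let ?r = "1 - \<sigma>"
    have r1: "?r powr (\<mu> * s) \<le> 1" "?r powr (\<mu> * e) \<le> 1" using w \<mu> e by (auto intro!: powr_le1)
    have "?r powr (\<mu> * s) * (w * ?r powr \<mu>) powr (e - real s) = w powr (e - real s) * ?r powr (\<mu> * e)"
      using w by (simp add: powr_mult powr_powr powr_add[symmetric] algebra_simps)
    also have "\<dots> \<le> w powr (e - real s)" using r1 by (intro mult_left_le) auto
    finally have "?r powr (\<mu> * s) * (1 + (w * ?r powr \<mu>) powr (e - real s)) \<le> 1 + w powr (e - real s)"
      using r1 by (simp add: distrib_left)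
    then have *: "C * (?r powr (\<mu> * s) * (1 + (w * ?r powr \<mu>) powr (e - real s))) \<le> C * (1 + w powr (e - real s))"
      using C(1) by (intro mult_left_mono) auto
    have "\<bar>?r powr (\<mu> * s) * h (w * ?r powr \<mu>)\<bar> \<le> ?r powr (\<mu> * s) * (C * (1 + (w * ?r powr \<mu>) powr (e - real s)))"
      unfolding abs_mult using C'[OF in01[OF w]] by (simp add: mult_left_mono)
    then show "\<bar>?r powr (\<mu> * s) * h (w * ?r powr \<mu>)\<bar> \<le> C * (1 + w powr (e - real s))"
      using * by (simp add: mult_ac)
  qed
  then show ?case by simp
next
  case (Suc k)
  from Suc.prems obtain f' where f: "wbounded W e s (\<lambda>w \<sigma>. h w)"
    "\<And>w \<sigma>. w \<in> {0<..<W} \<Longrightarrow> \<sigma> \<in> {0<..<1} \<Longrightarrow> (h has_real_derivative f' w \<sigma>) (at w)"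
    "wsmooth W e k (Suc s) f'" by (rule wsmooth_SucE) blast
  \<comment> \<open>A derivative of a function of \<open>w\<close> alone cannot depend on the parameter; its value at 1/2 stands for it.\<close>
  define h' where "h' w = f' w (1/2)" for w
  have hd: "(h has_real_derivative h' w) (at w)" if "w \<in> {0<..<W}" for w
    using f(2)[OF that, of "1/2"] by (simp add: h'_def)
  have h': "wsmooth W e k (Suc s) (\<lambda>w \<sigma>. h' w)"
    using f(3) by (rule wsmooth_cong[rotated]) (use f(2) hd DERIV_unique in blast)
  have 0: "wbounded W e s (\<lambda>w \<sigma>. (1 - \<sigma>) powr (\<mu> * s) * h (w * (1 - \<sigma>) powr \<mu>))"
    using wsmooth_imp_wbounded[OF Suc.IH[OF wsmooth_mono[OF Suc.prems]]] .
  show ?case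
  proof (rule wsmooth_SucI[OF 0 _ Suc.IH[OF h']])
    fix w \<sigma> :: real assume w: "w \<in> {0<..<W}" "\<sigma> \<in> {0<..<1}"
    have "(1 - \<sigma>) powr \<mu> \<le> 1" using w \<mu> by (intro powr_le1) auto
    then have "w * (1 - \<sigma>) powr \<mu> \<le> w * 1" using w by (intro mult_left_mono) auto
    moreover have "0 < w * (1 - \<sigma>) powr \<mu>" using w by simp
    ultimately have i: "w * (1 - \<sigma>) powr \<mu> \<in> {0<..<W}" using w by simp
    have "((\<lambda>u. h (u * (1 - \<sigma>) powr \<mu>)) has_real_derivative h' (w * (1 - \<sigma>) powr \<mu>) * (1 - \<sigma>) powr \<mu>) (at w)"
    proof (rule DERIV_chain2[where f=h and g="\<lambda>u. u * (1 - \<sigma>) powr \<mu>"])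
      show "(h has_real_derivative h' (w * (1 - \<sigma>) powr \<mu>)) (at (w * (1 - \<sigma>) powr \<mu>))"
        by (rule hd[OF i])
    qed (auto intro!: derivative_eq_intros)
    from DERIV_cmult[OF this, of "(1 - \<sigma>) powr (\<mu> * s)"]
    show "((\<lambda>u. (1 - \<sigma>) powr (\<mu> * real s) * h (u * (1 - \<sigma>) powr \<mu>)) has_real_derivative
        (1 - \<sigma>) powr (\<mu> * real (Suc s)) * h' (w * (1 - \<sigma>) powr \<mu>)) (at w)"
      using w by (simp add: powr_add[symmetric] algebra_simps)
        (simp add: powr_add algebra_simps)
  qed
qed

text \<open>
  The bounds on the derivatives are uniform in the parameter and, away from \<open>w = 0\<close>, in \<open>w\<close>, so
  that one may differentiate under the integral sign on \<open>(w / 2, W)\<close>.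
\<close>

lemma wsmooth_weak_integral:
  fixes \<nu> :: real
  assumes \<nu>: "0 < \<nu>"
  shows "wsmooth W e k s f \<Longrightarrow>
    wsmooth W e k s (\<lambda>w \<sigma>. integral {0..1} (\<lambda>\<tau>. \<tau> powr (\<nu> - 1) * f w \<tau>))"
proof (induction k arbitrary: s f)
  case (0 s f)
  then have f: "wbounded W e s f" by simp
  obtain C where C: "C \<ge> 0" "\<And>w \<sigma>. w \<in> {0<..<W} \<Longrightarrow> \<sigma> \<in> {0<..<1::real} \<Longrightarrow> \<bar>f w \<sigma>\<bar> \<le> C * (1 + w powr (e - real s))"
    using f by (rule wboundedE) blast
  let ?J = "\<lambda>w. integral {0..1} (\<lambda>\<tau>. \<tau> powr (\<nu> - 1) * f w \<tau>)"
  note c1 = wbounded_sections(1)[OF f] and c2 = wbounded_sections(2)[OF f]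
  have "continuous_on {0<..<W} ?J"
  proof (rule continuous_at_imp_continuous_on, rule ballI)
    fix w assume w: "w \<in> {0<..<W}"
    let ?S = "{w/2<..<W}"
    have "continuous_on ?S ?J"
    proof (rule weak_integral_continuous[OF \<nu>])
      show "continuous_on {0<..<1} (f u)" if "u \<in> ?S" for u using that w by (intro c1) auto
      show "continuous_on ?S (\<lambda>u. f u \<sigma>)" if "\<sigma> \<in> {0<..<1}" for \<sigma>
        using c2[OF that] by (rule continuous_on_subset) (use w in auto)
      fix u \<sigma> :: real assume u: "u \<in> ?S" "\<sigma> \<in> {0<..<1}"
      have "u powr (e - real s) \<le> (w/2) powr (e - real s) + W powr (e - real s)"
        using u w by (intro powr_le_endpoints) auto
      then have "C * (1 + u powr (e - real s)) \<le> C * (1 + ((w/2) powr (e - real s) + W powr (e - real s)))"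
        using C(1) by (intro mult_left_mono) auto
      then show "\<bar>f u \<sigma>\<bar> \<le> C * (1 + ((w/2) powr (e - real s) + W powr (e - real s)))"
        using C(2)[of u \<sigma>] u w by auto
    qed
    then show "isCont ?J w" using w by (intro continuous_on_interior[of ?S]) (auto simp: interior_open)
  qed
  then have "continuous_on ({0<..<W} \<times> {0<..<1::real}) (\<lambda>z. ?J (fst z))"
    by (rule continuous_on_compose2) (auto intro!: continuous_intros)
  then have "wbounded W e s (\<lambda>w \<sigma>. ?J w)"
  proof (intro wboundedI[where C="C / \<nu>"])
    fix w \<sigma> :: real assume w: "w \<in> {0<..<W}" "\<sigma> \<in> {0<..<1}"
    have "\<bar>integral {0..1} (\<lambda>\<tau>. (\<tau> - 0) powr (\<nu> - 1) * f w \<tau>)\<bar> \<le> (C * (1 + w powr (e - real s))) * ((1 - 0) powr \<nu> / \<nu>)"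
      by (rule weak_integral_bound[OF \<nu> _ c1[OF w(1)] C(2)[OF w(1)]]) auto
    then show "\<bar>?J w\<bar> \<le> C / \<nu> * (1 + w powr (e - real s))" by (simp add: mult_ac)
  qed (simp add: case_prod_beta)
  then show ?case by simp
next
  case (Suc k)
  from Suc.prems obtain f' where f: "wbounded W e s f"
    "\<And>w \<sigma>. w \<in> {0<..<W} \<Longrightarrow> \<sigma> \<in> {0<..<1} \<Longrightarrow> ((\<lambda>u. f u \<sigma>) has_real_derivative f' w \<sigma>) (at w)"
    "wsmooth W e k (Suc s) f'" by (rule wsmooth_SucE) blast
  obtain C where C: "C \<ge> 0" "\<And>w \<sigma>. w \<in> {0<..<W} \<Longrightarrow> \<sigma> \<in> {0<..<1::real} \<Longrightarrow> \<bar>f w \<sigma>\<bar> \<le> C * (1 + w powr (e - real s))"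
    using f(1) by (rule wboundedE) blast
  obtain C' where C': "C' \<ge> 0" "\<And>w \<sigma>. w \<in> {0<..<W} \<Longrightarrow> \<sigma> \<in> {0<..<1::real} \<Longrightarrow> \<bar>f' w \<sigma>\<bar> \<le> C' * (1 + w powr (e - real (Suc s)))"
    using wsmooth_imp_wbounded[OF f(3)] by (rule wboundedE) blast
  note c1 = wbounded_sections(1)[OF f(1)]
  show ?case
  proof (rule wsmooth_SucI[OF wsmooth_imp_wbounded[OF Suc.IH[OF wsmooth_mono[OF Suc.prems]]] _ Suc.IH[OF f(3)]])
    fix w \<sigma> :: real assume w: "w \<in> {0<..<W}" "\<sigma> \<in> {0<..<1}"
    let ?E = "e - real (Suc s)"
    show "((\<lambda>u. integral {0..1} (\<lambda>\<tau>. \<tau> powr (\<nu> - 1) * f u \<tau>)) has_real_derivative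
            integral {0..1} (\<lambda>\<tau>. \<tau> powr (\<nu> - 1) * f' w \<tau>)) (at w)"
    proof (rule weak_integral_DERIV[OF \<nu>, where u="w/2" and v=W and B="C' * (1 + ((w/2) powr ?E + W powr ?E))"])
      fix u assume u: "u \<in> {w/2<..<W}"
      then have u': "u \<in> {0<..<W}" using w by auto
      show "continuous_on {0<..<1} (f u)" by (rule c1[OF u'])
      show "\<exists>B. \<forall>\<sigma>\<in>{0<..<1}. \<bar>f u \<sigma>\<bar> \<le> B" using C(2)[OF u'] by blast
      fix \<tau> :: real assume \<tau>: "\<tau> \<in> {0<..<1}"
      show "((\<lambda>w. f w \<tau>) has_real_derivative f' u \<tau>) (at u)" by (rule f(2)[OF u' \<tau>])
      have "u powr ?E \<le> (w/2) powr ?E + W powr ?E"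
        using u w by (intro powr_le_endpoints) auto
      then have "C' * (1 + u powr ?E) \<le> C' * (1 + ((w/2) powr ?E + W powr ?E))"
        using C'(1) by (intro mult_left_mono) auto
      then show "\<bar>f' u \<tau>\<bar> \<le> C' * (1 + ((w/2) powr ?E + W powr ?E))"
        using C'(2)[OF u' \<tau>] by linarith
    qed (use w in auto)
  qed
qed

lemma wsmooth_derivatives:
  assumes "wsmooth W e k s (\<lambda>w \<sigma>. h w)"
  shows "\<exists>D. D 0 = h \<and> (\<forall>i<k. \<forall>w\<in>{0<..<W}. (D i has_real_derivative D (Suc i) w) (at w)) \<and>
           (\<forall>i\<le>k. \<exists>C\<ge>0. \<forall>w\<in>{0<..<W}. \<bar>D i w\<bar> \<le> C * (1 + w powr (e - real (s + i))))"
  using assms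
proof (induction k arbitrary: s h)
  case (0 s h)
  then have h: "wbounded W e s (\<lambda>w \<sigma>. h w)" by simp
  obtain C where C: "C \<ge> 0" "\<And>w \<sigma>. w \<in> {0<..<W} \<Longrightarrow> \<sigma> \<in> {0<..<1::real} \<Longrightarrow> \<bar>h w\<bar> \<le> C * (1 + w powr (e - real s))"
    using h by (rule wboundedE) blast
  then show ?case by (intro exI[of _ "\<lambda>_. h"]) (auto intro!: exI[of _ C] C(2)[of _ "1/2"])
next
  case (Suc k)
  from Suc.prems obtain f' where f: "wbounded W e s (\<lambda>w \<sigma>. h w)"
    "\<And>w \<sigma>. w \<in> {0<..<W} \<Longrightarrow> \<sigma> \<in> {0<..<1} \<Longrightarrow> (h has_real_derivative f' w \<sigma>) (at w)"
    "wsmooth W e k (Suc s) f'" by (rule wsmooth_SucE) blast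
  define h' where "h' w = f' w (1/2)" for w
  have hd: "(h has_real_derivative h' w) (at w)" if "w \<in> {0<..<W}" for w
    using f(2)[OF that, of "1/2"] by (simp add: h'_def)
  have h': "wsmooth W e k (Suc s) (\<lambda>w \<sigma>. h' w)"
    using f(3) by (rule wsmooth_cong[rotated]) (use f(2) hd DERIV_unique in blast)
  obtain D where D: "D 0 = h'" "\<forall>i<k. \<forall>w\<in>{0<..<W}. (D i has_real_derivative D (Suc i) w) (at w)"
    "\<forall>i\<le>k. \<exists>C\<ge>0. \<forall>w\<in>{0<..<W}. \<bar>D i w\<bar> \<le> C * (1 + w powr (e - real (Suc s + i)))"
    using Suc.IH[OF h'] by blast
  obtain C where C: "C \<ge> 0" "\<And>w \<sigma>. w \<in> {0<..<W} \<Longrightarrow> \<sigma> \<in> {0<..<1::real} \<Longrightarrow> \<bar>h w\<bar> \<le> C * (1 + w powr (e - real s))"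
    using f(1) by (rule wboundedE) blast
  define E where "E = case_nat h D"
  have "(E i has_real_derivative E (Suc i) w) (at w)" if "i < Suc k" "w \<in> {0<..<W}" for i w
    using that D(1,2) hd by (cases i) (auto simp: E_def)
  moreover have "\<exists>C\<ge>0. \<forall>w\<in>{0<..<W}. \<bar>E i w\<bar> \<le> C * (1 + w powr (e - real (s + i)))" if "i \<le> Suc k" for i
  proof (cases i)
    case 0
    then show ?thesis using C(1) by (auto simp: E_def intro!: exI[of _ C] C(2)[of _ "1/2"])
  next
    case (Suc i')
    then show ?thesis using D(3)[rule_format, of i'] that by (auto simp: E_def)
  qed
  ultimately show ?case by (intro exI[of _ E]) (auto simp: E_def)
qed

section \<open>Regularity of the solution\<close>

text \<open>
  Existence of both partial derivatives with one of them continuous gives differentiability, hence the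
  chain rule.
\<close>

lemma DERIV_along_curve:
  fixes f f1 f2 :: "real \<Rightarrow> real \<Rightarrow> real"
  assumes XY: "open X" "open Y" "convex Y" "u w \<in> X" "v w \<in> Y"
    and 1: "\<And>x y. x \<in> X \<Longrightarrow> y \<in> Y \<Longrightarrow> ((\<lambda>t. f t y) has_real_derivative f1 x y) (at x)"
    and 2: "\<And>x y. x \<in> X \<Longrightarrow> y \<in> Y \<Longrightarrow> ((\<lambda>t. f x t) has_real_derivative f2 x y) (at y)"
    and c: "continuous_on (X \<times> Y) (\<lambda>(x, y). f2 x y)"
    and u: "(u has_real_derivative u') (at w)" and v: "(v has_real_derivative v') (at w)"
  shows "((\<lambda>t. f (u t) (v t)) has_real_derivative f1 (u w) (v w) * u' + f2 (u w) (v w) * v') (at w)"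
proof -
  let ?x = "u w" and ?y = "v w"
  have oXY: "open (X \<times> Y)" using XY by (simp add: open_Times)
  have "((\<lambda>(x, y). f x y) has_derivative (\<lambda>(tx, ty). f1 ?x ?y * tx + blinfun_mult_right (f2 ?x ?y) ty))
          (at (?x, ?y) within X \<times> Y)"
  proof (rule has_derivative_partialsI[where fy = "\<lambda>x y. blinfun_mult_right (f2 x y)"])
    show "((\<lambda>x. f x ?y) has_derivative (*) (f1 ?x ?y)) (at ?x within X)"
      using 1[OF XY(4,5)] unfolding has_field_derivative_def by (rule has_derivative_at_withinI)
    show "((\<lambda>y. f x y) has_derivative blinfun_apply (blinfun_mult_right (f2 x y))) (at y within Y)"
      if "x \<in> X" "y \<in> Y" for x y
      using 2[OF that] unfolding has_field_derivative_def
      by (simp add: has_derivative_at_withinI)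
    have "continuous_on (X \<times> Y) (\<lambda>z. blinfun_mult_right ((\<lambda>(x, y). f2 x y) z))"
      using c by (rule bounded_linear.continuous_on[OF bounded_linear_blinfun_mult_right])
    then have "continuous_on (X \<times> Y) (\<lambda>(x, y). blinfun_mult_right (f2 x y))"
      by (simp add: case_prod_beta)
    then show "continuous (at (?x, ?y) within X \<times> Y) (\<lambda>(x, y). blinfun_mult_right (f2 x y))"
      using XY by (simp add: continuous_on_eq_continuous_within)
  qed (use XY in auto)
  then have F: "((\<lambda>(x, y). f x y) has_derivative (\<lambda>(tx, ty). f1 ?x ?y * tx + f2 ?x ?y * ty)) (at (?x, ?y))"
    using XY at_within_open[OF _ oXY, of "(?x, ?y)"] by simp
  have "((\<lambda>t. (u t, v t)) has_derivative (\<lambda>h. (u' * h, v' * h))) (at w)"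
    using u v unfolding has_field_derivative_def by (intro has_derivative_Pair)
  from has_derivative_compose[OF this F]
  have "((\<lambda>t. f (u t) (v t)) has_derivative (\<lambda>h. f1 ?x ?y * (u' * h) + f2 ?x ?y * (v' * h))) (at w)"
    by simp
  then show ?thesis unfolding has_field_derivative_def
    by (rule has_derivative_eq_rhs) (simp add: fun_eq_iff algebra_simps)
qed

lemma compact_D_R: "compact (D_R b)"
proof -
  have "D_R b = ({0..b} \<times> {0..b}) \<inter> {z. fst z \<le> snd z}" unfolding D_R_def by auto
  moreover have "closed {z::real \<times> real. fst z \<le> snd z}"
    by (intro closed_Collect_le continuous_intros)
  ultimately show ?thesis by (simp add: compact_Int_closed compact_Times)
qed

text \<open>
  An open rectangle around \<open>(x, s)\<close>, with a corner on the diagonal, fits into the triangle.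
\<close>

lemma interior_D_R:
  assumes "0 < x" "x < s" "s < b" shows "(x, s) \<in> interior (D_R b)"
proof -
  let ?c = "(x + s) / 2"
  have "open ({0<..<?c} \<times> {?c<..<b})" by (intro open_Times) auto
  moreover have "{0<..<?c} \<times> {?c<..<b} \<subseteq> D_R b" using assms by (auto simp: D_R_def)
  moreover have "(x, s) \<in> {0<..<?c} \<times> {?c<..<b}" using assms by auto
  ultimately show ?thesis by (meson interiorI)
qed

lemma Ck_interval_continuous: "Ck_interval m b f \<Longrightarrow> continuous_on {0..b} f"
  unfolding Ck_interval_def by (metis (no_types, lifting) continuous_on_cong le0)

lemma Ck_triangle_continuous:
  assumes "Ck_triangle m b K" shows "continuous_on (D_R b) (\<lambda>(x, s). K x s)"
proof -
  obtain D :: "nat \<Rightarrow> nat \<Rightarrow> real \<Rightarrow> real \<Rightarrow> real" where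
    D: "\<forall>(x, s)\<in>D_R b. D 0 0 x s = K x s" "continuous_on (D_R b) (\<lambda>(x, s). D 0 0 x s)"
    using assms unfolding Ck_triangle_def by force
  then show ?thesis
    by (auto intro: continuous_on_eq)
qed

text \<open>
  The substitution \<open>s = b - (b - x) (1 - \<tau>)\<close>. With \<open>b - x = w powr (1 / \<mu>)\<close> the argument becomes
  \<open>b - (w * (1 - \<tau>) powr \<mu>) powr (1 / \<mu>)\<close>, a dilation in the variable \<open>w\<close>.
\<close>

lemma weak_integral_scale:
  fixes \<nu> x b :: real
  assumes \<nu>: "0 < \<nu>" and xb: "x \<le> b" and G: "continuous_on {x..b} G"
  shows "integral {x..b} (\<lambda>s. (s - x) powr (\<nu> - 1) * G s)
    = (b - x) powr \<nu> * integral {0..1} (\<lambda>\<tau>. \<tau> powr (\<nu> - 1) * G (b - (b - x) * (1 - \<tau>)))"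
proof (cases "x = b")
  case False
  define t where "t = b - x"
  have t: "t > 0" using False xb by (simp add: t_def)
  obtain B where B: "\<And>s. s \<in> {x..b} \<Longrightarrow> \<bar>G s\<bar> \<le> B"
    using continuous_on_compact_bound[OF G] by auto
  let ?f = "\<lambda>s. (s - x) powr (\<nu> - 1) * G s"
  have "?f integrable_on {x..b}"
    by (rule weak_integrable[OF \<nu> xb, of _ B]) (use G B in \<open>auto intro: continuous_on_subset\<close>)
  then have "(?f has_integral integral {x..b} ?f) (cbox x b)" by (simp add: integrable_integral)
  from has_integral_affinity'[OF this t, of x]
  have "((\<lambda>\<tau>. ?f (t * \<tau> + x)) has_integral (integral {x..b} ?f / t)) {0..1}"
    using t by (simp add: t_def[symmetric] divide_inverse mult.commute)
  then have "integral {0..1} (\<lambda>\<tau>. ?f (t * \<tau> + x)) = integral {x..b} ?f / t" by (rule integral_unique)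
  moreover have "integral {0..1} (\<lambda>\<tau>. ?f (t * \<tau> + x))
      = integral {0..1} (\<lambda>\<tau>. t powr (\<nu> - 1) * (\<tau> powr (\<nu> - 1) * G (b - t * (1 - \<tau>))))"
  proof (rule integral_cong)
    fix \<tau> :: real assume "\<tau> \<in> {0..1}"
    have 1: "t * \<tau> + x - x = t * \<tau>" by simp
    have 2: "G (t * \<tau> + x) = G (b - t * (1 - \<tau>))" by (simp add: t_def algebra_simps)
    show "?f (t * \<tau> + x) = t powr (\<nu> - 1) * (\<tau> powr (\<nu> - 1) * G (b - t * (1 - \<tau>)))"
      unfolding 1 2 by (simp add: powr_mult mult.assoc)
  qed
  moreover have "\<dots> = t powr (\<nu> - 1) * integral {0..1} (\<lambda>\<tau>. \<tau> powr (\<nu> - 1) * G (b - t * (1 - \<tau>)))"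
    by (rule integral_mult_right)
  ultimately have "integral {x..b} ?f = t * t powr (\<nu> - 1) * integral {0..1} (\<lambda>\<tau>. \<tau> powr (\<nu> - 1) * G (b - t * (1 - \<tau>)))"
    using t by (simp add: field_simps)
  also have "t * t powr (\<nu> - 1) = t powr \<nu>" using t by (simp add: powr_diff)
  finally show ?thesis by (simp add: t_def)
qed simp

text \<open>
  The exponent \<open>e\<close> of the weights is left open, as only its relation to \<open>1 / \<mu>\<close> enters here. Derivatives
  are considered on the open interval \<open>(0, W)\<close> of the variable \<open>w\<close>, because those of \<open>K\<close> exist in the
  interior of the triangle only.
\<close>

locale vide_data =
  fixes b \<nu> \<mu> e :: real and N :: nat and a g :: "real \<Rightarrow> real" and K :: "real \<Rightarrow> real \<Rightarrow> real"
    and \<phi>b :: real and \<phi> \<psi> :: "real \<Rightarrow> real"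
  assumes b: "b > 0" and \<nu>: "0 < \<nu>" "\<nu> < 1" and \<mu>: "0 < \<mu>" "\<mu> < 1" and \<nu>\<mu>: "\<nu> / \<mu> \<in> \<nat>"
    and e: "0 \<le> e" "1 / \<mu> \<in> \<nat> \<or> e \<le> 1 / \<mu>"
    and a: "Ck_interval N b a" and g: "Ck_interval N b g" and K: "Ck_triangle N b K"
    and sol: "vide_solution b \<nu> a g K \<phi>b \<phi> \<psi>"
begin

abbreviation "p \<equiv> 1 / \<mu>"
abbreviation "W \<equiv> b powr \<mu>"

lemma p: "p > 0" "p > 1" "\<mu> * p = 1" using \<mu> by auto

lemma powr_p_in: "w \<in> {0<..<W} \<Longrightarrow> w powr p \<in> {0<..<b}"
proof -
  assume w: "w \<in> {0<..<W}"
  then have "w powr p < W powr p" using p by (intro powr_less_mono2) auto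
  then show ?thesis using w b p by (simp add: powr_powr)
qed

lemma powr_p_DERIV:
  "w > 0 \<Longrightarrow> ((\<lambda>w. b - w powr p) has_real_derivative - (p * w powr (p - 1))) (at w)"
  by (auto intro!: derivative_eq_intros has_real_derivative_powr)

lemma powr_p_dilation: "0 < w \<Longrightarrow> \<sigma> < 1 \<Longrightarrow> (w * (1 - \<sigma>) powr \<mu>) powr p = w powr p * (1 - \<sigma>)"
  using p by (simp add: powr_mult powr_powr)

text \<open>
  The derivative is \<open>- p * w powr (p - 1)\<close>, of shift 1, times a function of the same form with one
  derivative less.
\<close>

lemma wsmooth_compose_interval:
  assumes "\<forall>k<m. \<forall>x\<in>{0..b}. (D k has_real_derivative D (Suc k) x) (at x within {0..b})"
    and "\<forall>k\<le>m. continuous_on {0..b} (D k)"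
  shows "i + k \<le> m \<Longrightarrow> wsmooth W e k 0 (\<lambda>w \<sigma>. D i (b - w powr p))"
proof (induction k arbitrary: i)
  case (0 i)
  then have c: "continuous_on {0..b} (D i)" using assms by auto
  obtain B where B: "\<And>s. s \<in> {0..b} \<Longrightarrow> \<bar>D i s\<bar> \<le> B"
    using continuous_on_compact_bound[OF c] by auto
  have "wbounded W e 0 (\<lambda>w \<sigma>. D i (b - w powr p))"
  proof (rule wbounded_if_bounded[where B=B])
    show "continuous_on ({0<..<W} \<times> {0<..<1}) (\<lambda>(w, \<sigma>::real). D i (b - w powr p))"
      unfolding case_prod_beta
      by (intro continuous_on_compose2[OF c] continuous_intros) (use powr_p_in in \<open>force+\<close>)
    fix w :: real assume "w \<in> {0<..<W}"
    from powr_p_in[OF this] show "\<bar>D i (b - w powr p)\<bar> \<le> B" by (intro B) auto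
  qed
  then show ?case by simp
next
  case (Suc k)
  have 1: "wsmooth W e k 0 (\<lambda>w \<sigma>. - 1 * D (Suc i) (b - w powr p))"
    using wsmooth_mult[OF e(1) wsmooth_const Suc.IH[of "Suc i"], of 0 "- 1"] Suc.prems by simp
  have 2: "wsmooth W e k (Suc 0) (\<lambda>w \<sigma>. (p * w powr (p - 1)) * (- 1 * D (Suc i) (b - w powr p)))"
    using wsmooth_mult[OF e(1) wsmooth_powr(2)[OF p(1) e(2,1)] 1] by simp
  show ?case
  proof (rule wsmooth_SucI[OF wsmooth_imp_wbounded[OF Suc.IH] _ 2])
    fix w \<sigma> :: real assume w: "w \<in> {0<..<W}"
    have i: "b - w powr p \<in> {0<..<b}" using powr_p_in[OF w] by auto
    have "(D i has_real_derivative D (Suc i) (b - w powr p)) (at (b - w powr p) within {0..b})"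
      using assms(1) Suc.prems i by auto
    then have "(D i has_real_derivative D (Suc i) (b - w powr p)) (at (b - w powr p))"
      using i at_within_interior[of "b - w powr p" "{0..b}"] by simp
    from DERIV_chain2[OF this powr_p_DERIV]
    show "((\<lambda>w. D i (b - w powr p)) has_real_derivative (p * w powr (p - 1)) * (- 1 * D (Suc i) (b - w powr p))) (at w)"
      using w by (simp add: mult.commute)
  qed (use Suc.prems in simp)
qed

lemma triangle_path:
  assumes "w \<in> {0<..<W}" "\<sigma> \<in> {0<..<1}"
  shows "0 < b - w powr p" "b - w powr p < b - w powr p * (1 - \<sigma>)" "b - w powr p * (1 - \<sigma>) < b"
  using powr_p_in[OF assms(1)] assms by (auto simp: algebra_simps)

text \<open>
  Along \<open>w \<mapsto> (b - w powr p, b - w powr p * (1 - \<sigma>))\<close> the chain rule gives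
  \<open>- p * w powr (p - 1) * (D\<^sub>1 + (1 - \<sigma>) * D\<^sub>2)\<close> with the two partial derivatives \<open>D\<^sub>1\<close> and \<open>D\<^sub>2\<close>, and the
  induction hypothesis applies to both.
\<close>

lemma wsmooth_compose_triangle:
  assumes c: "\<forall>i j. i + j \<le> m \<longrightarrow> continuous_on (D_R b) (\<lambda>(x, s). D i j x s)"
    and d: "\<forall>i j. i + j < m \<longrightarrow>
           (\<forall>(x, s)\<in>interior (D_R b).
              ((\<lambda>t. D i j t s) has_real_derivative D (Suc i) j x s) (at x) \<and>
              ((\<lambda>t. D i j x t) has_real_derivative D i (Suc j) x s) (at s))"
  shows "i + j + k \<le> m \<Longrightarrow> wsmooth W e k 0 (\<lambda>w \<sigma>. D i j (b - w powr p) (b - w powr p * (1 - \<sigma>)))"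
proof (induction k arbitrary: i j)
  case (0 i j)
  then have c': "continuous_on (D_R b) (\<lambda>(x, s). D i j x s)" using c by auto
  obtain B where B: "\<And>z. z \<in> D_R b \<Longrightarrow> \<bar>case z of (x, s) \<Rightarrow> D i j x s\<bar> \<le> B"
    using continuous_on_compact_bound[OF c' compact_D_R] by blast
  have in_D: "(b - w powr p, b - w powr p * (1 - \<sigma>)) \<in> D_R b" if "w \<in> {0<..<W}" "\<sigma> \<in> {0<..<1}" for w \<sigma>
    using triangle_path[OF that] by (auto simp: D_R_def)
  have "wbounded W e 0 (\<lambda>w \<sigma>. D i j (b - w powr p) (b - w powr p * (1 - \<sigma>)))"
  proof (rule wbounded_if_bounded[where B=B])
    have "continuous_on ({0<..<W} \<times> {0<..<1}) (\<lambda>z. (\<lambda>(x, s). D i j x s) (b - fst z powr p, b - fst z powr p * (1 - snd z)))"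
      by (intro continuous_on_compose2[OF c'] continuous_intros) (use in_D in auto)
    then show "continuous_on ({0<..<W} \<times> {0<..<1}) (\<lambda>(w, \<sigma>). D i j (b - w powr p) (b - w powr p * (1 - \<sigma>)))"
      by (simp add: case_prod_beta)
    fix w \<sigma> :: real assume w: "w \<in> {0<..<W}" "\<sigma> \<in> {0<..<1}"
    show "\<bar>D i j (b - w powr p) (b - w powr p * (1 - \<sigma>))\<bar> \<le> B" using B[OF in_D[OF w]] by simp
  qed
  then show ?case by simp
next
  case (Suc k)
  let ?x = "\<lambda>w. b - w powr p" and ?s = "\<lambda>w \<sigma>. b - w powr p * (1 - \<sigma>)"
  have r: "wsmooth W e k 0 (\<lambda>w \<sigma>. - (1 - \<sigma>))"
    by (rule wsmooth_fun_of_\<sigma>[where C=1]) (auto intro!: continuous_intros)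
  have 1: "wsmooth W e k 0 (\<lambda>w \<sigma>. - 1 * D (Suc i) j (?x w) (?s w \<sigma>))"
    using wsmooth_mult[OF e(1) wsmooth_const Suc.IH[of "Suc i" j], of 0 "- 1"] Suc.prems by simp
  have 2: "wsmooth W e k 0 (\<lambda>w \<sigma>. - (1 - \<sigma>) * D i (Suc j) (?x w) (?s w \<sigma>))"
    using wsmooth_mult[OF e(1) r Suc.IH[of i "Suc j"]] Suc.prems by simp
  have 3: "wsmooth W e k (Suc 0) (\<lambda>w \<sigma>. (p * w powr (p - 1)) *
      (- 1 * D (Suc i) j (?x w) (?s w \<sigma>) + - (1 - \<sigma>) * D i (Suc j) (?x w) (?s w \<sigma>)))"
    using wsmooth_mult[OF e(1) wsmooth_powr(2)[OF p(1) e(2,1)] wsmooth_add[OF 1 2]] by simp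
  show ?case
  proof (rule wsmooth_SucI[OF wsmooth_imp_wbounded[OF Suc.IH] _ 3])
    fix w \<sigma> :: real assume w: "w \<in> {0<..<W}" "\<sigma> \<in> {0<..<1}"
    define c' where "c' = (?x w + ?s w \<sigma>) / 2"
    let ?X = "{0<..<c'}" and ?Y = "{c'<..<b}"
    note tp = triangle_path[OF w]
    have "x \<in> {0<..<(x + s) / 2} \<and> s \<in> {(x + s) / 2<..<b}" if "0 < x" "x < s" "s < b" for x s
      using that by auto
    from this[OF tp] have xy: "?x w \<in> ?X" "?s w \<sigma> \<in> ?Y" unfolding c'_def by blast+
    have XY: "(x, y) \<in> interior (D_R b)" if "x \<in> ?X" "y \<in> ?Y" for x y
      using that by (intro interior_D_R) auto
    have "((\<lambda>t. D i j (?x t) (?s t \<sigma>)) has_real_derivative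
       D (Suc i) j (?x w) (?s w \<sigma>) * (- (p * w powr (p - 1))) +
       D i (Suc j) (?x w) (?s w \<sigma>) * (- (p * w powr (p - 1) * (1 - \<sigma>)))) (at w)"
    proof (rule DERIV_along_curve[where f="D i j" and ?f1.0="D (Suc i) j" and ?f2.0="D i (Suc j)"
          and u="?x" and v="\<lambda>t. ?s t \<sigma>" and X="?X" and Y="?Y"])
      show "?x w \<in> ?X" "?s w \<sigma> \<in> ?Y" by (fact xy)+
      show "((\<lambda>t. D i j t y) has_real_derivative D (Suc i) j x y) (at x)"
        "((\<lambda>t. D i j x t) has_real_derivative D i (Suc j) x y) (at y)" if "x \<in> ?X" "y \<in> ?Y" for x y
        using d Suc.prems XY[OF that] by force+
      have "continuous_on (D_R b) (\<lambda>(x, s). D i (Suc j) x s)" using c Suc.prems by auto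
      then show "continuous_on (?X \<times> ?Y) (\<lambda>(x, y). D i (Suc j) x y)"
        by (rule continuous_on_subset) (use XY interior_subset in blast)
      show "(?x has_real_derivative - (p * w powr (p - 1))) (at w)"
        using w by (intro powr_p_DERIV) auto
      show "((\<lambda>t. ?s t \<sigma>) has_real_derivative - (p * w powr (p - 1) * (1 - \<sigma>))) (at w)"
        using w by (auto intro!: derivative_eq_intros has_real_derivative_powr)
    qed auto
    then show "((\<lambda>t. D i j (?x t) (?s t \<sigma>)) has_real_derivative (p * w powr (p - 1)) *
      (- 1 * D (Suc i) j (?x w) (?s w \<sigma>) + - (1 - \<sigma>) * D i (Suc j) (?x w) (?s w \<sigma>))) (at w)"
      by (rule DERIV_cong) (simp add: algebra_simps add_divide_distrib diff_divide_distrib)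
  qed (use Suc.prems in simp)
qed

lemma \<phi>_DERIV: "x \<in> {0..b} \<Longrightarrow> (\<phi> has_real_derivative \<psi> x) (at x within {0..b})"
  using sol by (auto simp: vide_solution_def)

lemma \<phi>_continuous: "continuous_on {0..b} \<phi>"
  using \<phi>_DERIV by (meson DERIV_continuous_on)

lemma K_continuous: "continuous_on (D_R b) (\<lambda>(x, s). K x s)"
  using K by (rule Ck_triangle_continuous)

lemma K_section_continuous:
  assumes "x \<in> {0..b}" shows "continuous_on {x..b} (K x)"
proof -
  have "continuous_on {x..b} (\<lambda>s. (\<lambda>(x, s). K x s) (x, s))"
    by (rule continuous_on_compose2[OF K_continuous]) (use assms in \<open>auto intro!: continuous_intros simp: D_R_def\<close>)
  then show ?thesis by simp
qed

lemma \<psi>_scaled: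
  assumes x: "x \<in> {0..b}"
  shows "\<psi> x = a x * \<phi> x + g x + (b - x) powr \<nu> * integral {0..1}
     (\<lambda>\<tau>. \<tau> powr (\<nu> - 1) * (K x (b - (b - x) * (1 - \<tau>)) * \<phi> (b - (b - x) * (1 - \<tau>))))"
proof -
  have c: "continuous_on {x..b} (\<lambda>s. K x s * \<phi> s)"
    by (intro continuous_on_mult K_section_continuous x continuous_on_subset[OF \<phi>_continuous]) (use x in auto)
  have "\<psi> x = a x * \<phi> x + g x + integral {x..b} (\<lambda>s. (s - x) powr (\<nu> - 1) * (K x s * \<phi> s))"
    using sol x by (simp add: vide_solution_def mult.assoc)
  then show ?thesis using weak_integral_scale[OF \<nu>(1) _ c] x by simp
qed

text \<open>
  The scaled form of the equation has its kernel integral over a fixed interval, hence depends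
  continuously on \<open>x\<close> up to both end points.
\<close>

lemma \<psi>_continuous: "continuous_on {0..b} \<psi>"
proof -
  let ?s = "\<lambda>x \<tau>. b - (b - x) * (1 - \<tau>)"
  let ?f = "\<lambda>x \<tau>. K x (?s x \<tau>) * \<phi> (?s x \<tau>)"
  have s: "?s x \<tau> \<in> {x..b}" if "x \<in> {0..b}" "\<tau> \<in> {0<..<1}" for x \<tau> :: real
  proof -
    have "(b - x) * (1 - \<tau>) \<le> (b - x) * 1" "0 \<le> (b - x) * (1 - \<tau>)"
      using that by (intro mult_left_mono mult_nonneg_nonneg; auto)+
    then show ?thesis by auto
  qed
  obtain B1 where B1: "\<And>z. z \<in> D_R b \<Longrightarrow> \<bar>case z of (x, s) \<Rightarrow> K x s\<bar> \<le> B1"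
    using continuous_on_compact_bound[OF K_continuous compact_D_R] by blast
  obtain B2 where B2: "\<And>s. s \<in> {0..b} \<Longrightarrow> \<bar>\<phi> s\<bar> \<le> B2"
    using continuous_on_compact_bound[OF \<phi>_continuous] by auto
  have "continuous_on {0..b} (\<lambda>x. integral {0..1} (\<lambda>\<tau>. \<tau> powr (\<nu> - 1) * ?f x \<tau>))"
  proof (rule weak_integral_continuous[OF \<nu>(1), where B="B1 * B2"])
    fix x assume x: "x \<in> {0..b}"
    show "continuous_on {0<..<1} (?f x)"
    proof (intro continuous_on_mult)
      show "continuous_on {0<..<1} (\<lambda>\<tau>. K x (?s x \<tau>))"
        by (rule continuous_on_compose2[OF K_section_continuous[OF x]]) (use s[OF x] in \<open>auto intro!: continuous_intros\<close>)
      show "continuous_on {0<..<1} (\<lambda>\<tau>. \<phi> (?s x \<tau>))"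
        by (rule continuous_on_compose2[OF \<phi>_continuous]) (use s[OF x] x in \<open>force intro!: continuous_intros\<close>)+
    qed
  next
    fix \<tau> :: real assume \<tau>: "\<tau> \<in> {0<..<1}"
    show "continuous_on {0..b} (\<lambda>x. ?f x \<tau>)"
    proof (intro continuous_on_mult)
      have "continuous_on {0..b} (\<lambda>x. (\<lambda>(x, s). K x s) (x, ?s x \<tau>))"
        by (rule continuous_on_compose2[OF K_continuous]) (use s[OF _ \<tau>] in \<open>auto intro!: continuous_intros simp: D_R_def\<close>)
      then show "continuous_on {0..b} (\<lambda>x. K x (?s x \<tau>))" by simp
      show "continuous_on {0..b} (\<lambda>x. \<phi> (?s x \<tau>))"
        by (rule continuous_on_compose2[OF \<phi>_continuous]) (use s[OF _ \<tau>] in \<open>force intro!: continuous_intros\<close>)+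
    qed
  next
    fix x \<tau> :: real assume x: "x \<in> {0..b}" and \<tau>: "\<tau> \<in> {0<..<1}"
    have "(x, ?s x \<tau>) \<in> D_R b" "?s x \<tau> \<in> {0..b}" using s[OF x \<tau>] x by (auto simp: D_R_def)
    then have "\<bar>K x (?s x \<tau>)\<bar> \<le> B1" "\<bar>\<phi> (?s x \<tau>)\<bar> \<le> B2" using B1[of "(x, ?s x \<tau>)"] B2[of "?s x \<tau>"] by auto
    then show "\<bar>?f x \<tau>\<bar> \<le> B1 * B2"
      unfolding abs_mult by (rule mult_mono') auto
  qed
  then have "continuous_on {0..b} (\<lambda>x. a x * \<phi> x + g x + (b - x) powr \<nu> * integral {0..1} (\<lambda>\<tau>. \<tau> powr (\<nu> - 1) * ?f x \<tau>))"
    using \<nu> by (intro continuous_on_add continuous_on_mult continuous_on_powr' continuous_intros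
      Ck_interval_continuous[OF a] Ck_interval_continuous[OF g] \<phi>_continuous) auto
  then show ?thesis by (rule continuous_on_eq) (simp add: \<psi>_scaled)
qed

text \<open>
  One half of the bootstrap. The factor \<open>(b - x) powr \<nu>\<close> of the scaled equation is the integer power
  \<open>w ^ m\<close> with \<open>m = \<nu> / \<mu>\<close>, so that every ingredient belongs to the class with shift 0.
\<close>

lemma wsmooth_\<psi>_from_\<phi>:
  assumes k: "k \<le> N" and v: "wsmooth W e k 0 (\<lambda>w \<sigma>. \<phi> (b - w powr p))"
  shows "wsmooth W e k 0 (\<lambda>w \<sigma>. \<psi> (b - w powr p))"
proof -
  have interval: "wsmooth W e k 0 (\<lambda>w \<sigma>. h (b - w powr p))" if h: "Ck_interval N b h" for h
  proof -
    obtain D where D: "\<forall>x\<in>{0..b}. D 0 x = h x"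
      "\<forall>k<N. \<forall>x\<in>{0..b}. (D k has_real_derivative D (Suc k) x) (at x within {0..b})"
      "\<forall>k\<le>N. continuous_on {0..b} (D k)"
      using h unfolding Ck_interval_def by blast
    have "wsmooth W e k 0 (\<lambda>w \<sigma>. D 0 (b - w powr p))"
      by (rule wsmooth_compose_interval[OF D(2,3)]) (use k in simp)
    then show ?thesis by (rule wsmooth_cong[rotated]) (use D(1) powr_p_in in force)
  qed
  have kern: "wsmooth W e k 0 (\<lambda>w \<sigma>. K (b - w powr p) (b - w powr p * (1 - \<sigma>)))"
  proof -
    obtain D where D: "\<forall>(x, s)\<in>D_R b. D 0 0 x s = K x s"
      "\<forall>i j. i + j \<le> N \<longrightarrow> continuous_on (D_R b) (\<lambda>(x, s). D i j x s)"
      "\<forall>i j. i + j < N \<longrightarrow>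
           (\<forall>(x, s)\<in>interior (D_R b).
              ((\<lambda>t. D i j t s) has_real_derivative D (Suc i) j x s) (at x) \<and>
              ((\<lambda>t. D i j x t) has_real_derivative D i (Suc j) x s) (at s))"
      using K unfolding Ck_triangle_def by blast
    have "wsmooth W e k 0 (\<lambda>w \<sigma>. D 0 0 (b - w powr p) (b - w powr p * (1 - \<sigma>)))"
      by (rule wsmooth_compose_triangle[OF D(2,3)]) (use k in simp)
    then show ?thesis
    proof (rule wsmooth_cong[rotated])
      fix w \<sigma> :: real assume "w \<in> {0<..<W}" "\<sigma> \<in> {0<..<1}"
      from triangle_path[OF this] have "(b - w powr p, b - w powr p * (1 - \<sigma>)) \<in> D_R b" by (auto simp: D_R_def)
      then show "D 0 0 (b - w powr p) (b - w powr p * (1 - \<sigma>)) = K (b - w powr p) (b - w powr p * (1 - \<sigma>))"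
        using D(1) by auto
    qed
  qed
  obtain m where m: "\<nu> / \<mu> = real m" using \<nu>\<mu> by (auto simp: Nats_def)
  have v': "wsmooth W e k 0 (\<lambda>w \<sigma>. \<phi> (b - w powr p * (1 - \<sigma>)))"
    using wsmooth_dilation[OF \<mu>(1) e(1) v] by (rule wsmooth_cong[rotated]) (simp add: powr_p_dilation)
  have J: "wsmooth W e k 0 (\<lambda>w \<sigma>. integral {0..1} (\<lambda>\<tau>. \<tau> powr (\<nu> - 1) *
      (K (b - w powr p) (b - w powr p * (1 - \<tau>)) * \<phi> (b - w powr p * (1 - \<tau>)))))"
    using wsmooth_weak_integral[OF \<nu>(1) wsmooth_mult[OF e(1) kern v']] by simp
  have "wsmooth W e k 0 (\<lambda>w \<sigma>. w ^ m * integral {0..1} (\<lambda>\<tau>. \<tau> powr (\<nu> - 1) *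
      (K (b - w powr p) (b - w powr p * (1 - \<tau>)) * \<phi> (b - w powr p * (1 - \<tau>)))))"
    using wsmooth_mult[OF e(1) wsmooth_power[OF e(1)] J] by simp
  moreover have "wsmooth W e k 0 (\<lambda>w \<sigma>. a (b - w powr p) * \<phi> (b - w powr p))"
    using wsmooth_mult[OF e(1) interval[OF a] v] by simp
  ultimately have "wsmooth W e k 0 (\<lambda>w \<sigma>. a (b - w powr p) * \<phi> (b - w powr p) + g (b - w powr p) + w ^ m * integral {0..1} (\<lambda>\<tau>. \<tau> powr (\<nu> - 1) *
      (K (b - w powr p) (b - w powr p * (1 - \<tau>)) * \<phi> (b - w powr p * (1 - \<tau>)))))"
    using interval[OF g] by (intro wsmooth_add)
  then show ?thesis
  proof (rule wsmooth_cong[rotated])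
    fix w \<sigma> :: real assume w: "w \<in> {0<..<W}"
    have "b - w powr p \<in> {0..b}" using powr_p_in[OF w] by auto
    moreover have "(w powr p) powr \<nu> = w ^ m"
      using w m by (simp add: powr_powr powr_realpow[symmetric])
    ultimately show "a (b - w powr p) * \<phi> (b - w powr p) + g (b - w powr p) + w ^ m * integral {0..1} (\<lambda>\<tau>. \<tau> powr (\<nu> - 1) *
      (K (b - w powr p) (b - w powr p * (1 - \<tau>)) * \<phi> (b - w powr p * (1 - \<tau>)))) = \<psi> (b - w powr p)"
      by (subst \<psi>_scaled) simp_all
  qed
qed

lemma wbounded_\<phi>: "wbounded W e 0 (\<lambda>w \<sigma>. \<phi> (b - w powr p))"
proof -
  obtain B where B: "\<And>s. s \<in> {0..b} \<Longrightarrow> \<bar>\<phi> s\<bar> \<le> B"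
    using continuous_on_compact_bound[OF \<phi>_continuous] by auto
  show ?thesis
  proof (rule wbounded_if_bounded[where B=B])
    show "continuous_on ({0<..<W} \<times> {0<..<1}) (\<lambda>(w, \<sigma>::real). \<phi> (b - w powr p))"
      unfolding case_prod_beta
      by (intro continuous_on_compose2[OF \<phi>_continuous] continuous_intros) (use powr_p_in in \<open>force+\<close>)
    fix w :: real assume "w \<in> {0<..<W}"
    from powr_p_in[OF this] show "\<bar>\<phi> (b - w powr p)\<bar> \<le> B" by (intro B) auto
  qed
qed

text \<open>
  The other half: the \<open>w\<close>-derivative of \<open>\<phi> (b - w powr p)\<close> is \<open>- p * w powr (p - 1) * \<psi> (b - w powr p)\<close>.
\<close>

lemma wsmooth_\<phi>_Suc:
  assumes "wsmooth W e k 0 (\<lambda>w \<sigma>. \<psi> (b - w powr p))"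
  shows "wsmooth W e (Suc k) 0 (\<lambda>w \<sigma>. \<phi> (b - w powr p))"
proof -
  have 1: "wsmooth W e k 0 (\<lambda>w \<sigma>. - 1 * \<psi> (b - w powr p))"
    using wsmooth_mult[OF e(1) wsmooth_const assms, of 0 "- 1"] by simp
  have 2: "wsmooth W e k (Suc 0) (\<lambda>w \<sigma>. (p * w powr (p - 1)) * (- 1 * \<psi> (b - w powr p)))"
    using wsmooth_mult[OF e(1) wsmooth_powr(2)[OF p(1) e(2,1)] 1] by simp
  show ?thesis
  proof (rule wsmooth_SucI[OF wbounded_\<phi> _ 2])
    fix w \<sigma> :: real assume w: "w \<in> {0<..<W}"
    have i: "b - w powr p \<in> {0<..<b}" using powr_p_in[OF w] by auto
    then have "(\<phi> has_real_derivative \<psi> (b - w powr p)) (at (b - w powr p))"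
      using \<phi>_DERIV[of "b - w powr p"] at_within_interior[of "b - w powr p" "{0..b}"] by simp
    from DERIV_chain2[OF this powr_p_DERIV]
    show "((\<lambda>w. \<phi> (b - w powr p)) has_real_derivative (p * w powr (p - 1)) * (- 1 * \<psi> (b - w powr p))) (at w)"
      using w by (simp add: mult.commute)
  qed
qed

lemma wsmooth_\<psi>: "wsmooth W e N 0 (\<lambda>w \<sigma>. \<psi> (b - w powr p))"
proof -
  have "k \<le> N \<Longrightarrow> wsmooth W e k 0 (\<lambda>w \<sigma>. \<psi> (b - w powr p))" for k
  proof (induction k)
    case 0
    then show ?case by (intro wsmooth_\<psi>_from_\<phi>) (simp_all add: wbounded_\<phi>)
  next
    case (Suc k)
    then have "wsmooth W e (Suc k) 0 (\<lambda>w \<sigma>. \<phi> (b - w powr p))" by (intro wsmooth_\<phi>_Suc) simp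
    then show ?case by (rule wsmooth_\<psi>_from_\<phi>[OF Suc.prems])
  qed
  then show ?thesis by blast
qed

lemma \<psi>_derivatives:
  obtains D where "D 0 = (\<lambda>w. \<psi> (b - w powr p))"
    and "\<And>i w. i < N \<Longrightarrow> w \<in> {0<..<W} \<Longrightarrow> (D i has_real_derivative D (Suc i) w) (at w)"
    and "\<And>i. i \<le> N \<Longrightarrow> \<exists>C\<ge>0. \<forall>w\<in>{0<..<W}. \<bar>D i w\<bar> \<le> C * (1 + w powr (e - real i))"
  using wsmooth_derivatives[OF wsmooth_\<psi>] by auto

end

section \<open>Interpolation on the unit interval\<close>

text \<open>
  As a function of the centre \<open>s\<close>, the Taylor polynomial evaluated at a fixed point \<open>z\<close> has a
  telescoping derivative.
\<close>

lemma DERIV_taylor_sum: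
  fixes D :: "nat \<Rightarrow> real \<Rightarrow> real"
  assumes "\<And>k. k \<le> m \<Longrightarrow> (D k has_real_derivative D (Suc k) s) (at s)"
  shows "((\<lambda>s. \<Sum>k<Suc m. D k s / fact k * (z - s) ^ k) has_real_derivative
          D (Suc m) s / fact m * (z - s) ^ m) (at s)"
  using assms
proof (induction m)
  case 0
  then show ?case by simp
next
  case (Suc m)
  have 1: "((\<lambda>s. \<Sum>k<Suc m. D k s / fact k * (z - s) ^ k) has_real_derivative
          D (Suc m) s / fact m * (z - s) ^ m) (at s)"
    by (rule Suc.IH) (simp add: Suc.prems)
  have "(D (Suc m) has_real_derivative D (Suc (Suc m)) s) (at s)" using Suc.prems by simp
  then have 2: "((\<lambda>s. D (Suc m) s / fact (Suc m) * (z - s) ^ Suc m) has_real_derivative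
      D (Suc (Suc m)) s / fact (Suc m) * (z - s) ^ Suc m
      + D (Suc m) s / fact (Suc m) * (real (Suc m) * (z - s) ^ m * (- 1))) (at s)"
  proof -
    assume d: "(D (Suc m) has_real_derivative D (Suc (Suc m)) s) (at s)"
    have "((\<lambda>s. (z - s) ^ Suc m) has_real_derivative real (Suc m) * (z - s) ^ m * (- 1)) (at s)"
    proof -
      have "((\<lambda>s. z - s) has_real_derivative - 1) (at s)" by (auto intro!: derivative_eq_intros)
      from DERIV_power_Suc[OF this, of m] show ?thesis by (rule DERIV_cong) simp
    qed
    from DERIV_mult[OF DERIV_cdivide[OF d, of "fact (Suc m)"] this]
    show ?thesis by (rule DERIV_cong) (simp add: mult.commute)
  qed
  have 3: "D (Suc m) s / fact (Suc m) * (real (Suc m) * (z - s) ^ m * (- 1))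
     = - (D (Suc m) s / fact m * (z - s) ^ m)"
    by (simp add: field_simps del: of_nat_Suc)
  from DERIV_add[OF 1 2] show ?case unfolding 3 by simp
qed

lemma abs_diff_le_by_derivative:
  fixes f g :: "real \<Rightarrow> real"
  assumes "u \<le> v" and f: "\<And>s. s \<in> {u..v} \<Longrightarrow> (f has_real_derivative f' s) (at s)"
    and g: "\<And>s. s \<in> {u..v} \<Longrightarrow> (g has_real_derivative g' s) (at s)"
    and le: "\<And>s. s \<in> {u..v} \<Longrightarrow> \<bar>f' s\<bar> \<le> g' s"
  shows "\<bar>f v - f u\<bar> \<le> g v - g u"
proof -
  have "(\<lambda>s. g s - f s) u \<le> (\<lambda>s. g s - f s) v"
  proof (rule DERIV_nonneg_imp_nondecreasing[OF assms(1)])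
    fix s assume "u \<le> s" "s \<le> v"
    then have s: "s \<in> {u..v}" by simp
    show "\<exists>y. ((\<lambda>s. g s - f s) has_real_derivative y) (at s) \<and> 0 \<le> y"
      using DERIV_diff[OF g[OF s] f[OF s]] le[OF s] by (intro exI[of _ "g' s - f' s"]) auto
  qed
  moreover have "(\<lambda>s. g s + f s) u \<le> (\<lambda>s. g s + f s) v"
  proof (rule DERIV_nonneg_imp_nondecreasing[OF assms(1)])
    fix s assume "u \<le> s" "s \<le> v"
    then have s: "s \<in> {u..v}" by simp
    show "\<exists>y. ((\<lambda>s. g s + f s) has_real_derivative y) (at s) \<and> 0 \<le> y"
      using DERIV_add[OF g[OF s] f[OF s]] le[OF s] by (intro exI[of _ "g' s + f' s"]) auto
  qed
  ultimately show ?thesis by (simp add: abs_le_iff)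
qed

text \<open>
  The \<open>m\<close>-th derivative may blow up at 1, possibly not integrably; still the Taylor polynomial centred at
  1/2 approximates up to the end point. The derivative of the Taylor sum with respect to its centre
  \<open>s\<close> carries the factor \<open>(z - s) ^ (m - 1)\<close>, and \<open>\<bar>z - s\<bar> \<le> 1 - s\<close> for all \<open>s\<close> between 1/2 and \<open>z\<close>, so
  it is at most \<open>B * (1 - s) powr (e - 1)\<close>, which is integrable.
\<close>

lemma taylor_remainder_singular:
  fixes D :: "nat \<Rightarrow> real \<Rightarrow> real" and e B :: real
  assumes m: "m > 0" and e: "0 < e"
    and D: "\<And>k s. k < m \<Longrightarrow> s \<in> {0<..<1} \<Longrightarrow> (D k has_real_derivative D (Suc k) s) (at s)"
    and B: "\<And>s. s \<in> {0<..<1} \<Longrightarrow> \<bar>D m s\<bar> \<le> B * (1 - s) powr (e - real m)"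
    and z: "z \<in> {0<..<1}"
  shows "\<bar>D 0 z - (\<Sum>k<m. D k (1/2) / fact k * (z - 1/2) ^ k)\<bar> \<le> B / e"
proof -
  obtain m' where m': "m = Suc m'" using m by (cases m) auto
  define P where "P s = (\<Sum>k<m. D k s / fact k * (z - s) ^ k)" for s
  define P' where "P' s = D m s / fact m' * (z - s) ^ m'" for s
  define G where "G s = - (B / e) * (1 - s) powr e" for s
  define G' where "G' s = B * (1 - s) powr (e - 1)" for s
  have P: "(P has_real_derivative P' s) (at s)" if "s \<in> {0<..<1}" for s
    unfolding P_def[abs_def] P'_def m' by (rule DERIV_taylor_sum) (use D m' that in auto)
  have G: "(G has_real_derivative G' s) (at s)" if "s \<in> {0<..<1}" for s
    unfolding G_def[abs_def] G'_def using that e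
    by (auto intro!: derivative_eq_intros simp: powr_diff field_simps)
  have le: "\<bar>P' s\<bar> \<le> G' s" if s: "s \<in> {0<..<1}" and zs: "\<bar>z - s\<bar> \<le> 1 - s" for s
  proof -
    have s1: "1 - s > 0" using s by simp
    have "0 \<le> B * (1 - s) powr (e - real m)" using B[OF s] by linarith
    moreover have "0 < (1 - s) powr (e - real m)" using s1 by simp
    ultimately have B0: "B \<ge> 0" by (simp add: zero_le_mult_iff)
    have "\<bar>P' s\<bar> = \<bar>D m s\<bar> / fact m' * \<bar>z - s\<bar> ^ m'"
      unfolding P'_def by (simp add: abs_mult power_abs)
    also have "\<dots> \<le> \<bar>D m s\<bar> / 1 * \<bar>z - s\<bar> ^ m'"
      by (intro mult_right_mono divide_left_mono) auto
    also have "\<dots> \<le> (B * (1 - s) powr (e - real m)) * (1 - s) ^ m'"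
      using B[OF s] zs by (intro mult_mono power_mono) auto
    also have "\<dots> = B * ((1 - s) powr (e - real m) * (1 - s) powr (real m'))"
      using s1 by (simp add: powr_realpow)
    also have "\<dots> = G' s" unfolding G'_def powr_add[symmetric] by (simp add: m')
    finally show ?thesis .
  qed
  have B0: "0 \<le> B"
  proof -
    have "0 \<le> B * (1 - 1/2) powr (e - real m)" using B[of "1/2"] by force
    moreover have "0 < (1 - 1/2::real) powr (e - real m)" by simp
    ultimately show ?thesis by (simp add: zero_le_mult_iff)
  qed
  have Gd: "G v - G u \<le> B / e" if "u \<in> {0<..<1}" "v \<in> {0<..<1}" for u v
  proof -
    have "(1 - u) powr e \<le> 1" using that e by (auto intro!: powr_le1)
    then have "(1 - u) powr e - (1 - v) powr e \<le> 1" using powr_ge_zero[of "1 - v" e] by linarith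
    then have "(B / e) * ((1 - u) powr e - (1 - v) powr e) \<le> (B / e) * 1"
      using B0 e by (intro mult_left_mono) auto
    then show ?thesis by (simp add: G_def algebra_simps)
  qed
  have "\<bar>P z - P (1/2)\<bar> \<le> B / e"
  proof (cases "1/2 \<le> z")
    case True
    have "\<bar>P z - P (1/2)\<bar> \<le> G z - G (1/2)"
    proof (rule abs_diff_le_by_derivative[OF True])
      fix s assume s: "s \<in> {1/2..z}"
      then have s': "s \<in> {0<..<1}" using z by auto
      show "(P has_real_derivative P' s) (at s)" "(G has_real_derivative G' s) (at s)"
        using P[OF s'] G[OF s'] .
      show "\<bar>P' s\<bar> \<le> G' s" using s z by (intro le[OF s']) auto
    qed
    then show ?thesis using Gd[of "1/2" z] z by auto
  next
    case False
    then have "z \<le> 1/2" by simp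
    then have "\<bar>P (1/2) - P z\<bar> \<le> G (1/2) - G z"
    proof (rule abs_diff_le_by_derivative)
      fix s assume s: "s \<in> {z..1/2}"
      then have s': "s \<in> {0<..<1}" using z by auto
      show "(P has_real_derivative P' s) (at s)" "(G has_real_derivative G' s) (at s)"
        using P[OF s'] G[OF s'] .
      show "\<bar>P' s\<bar> \<le> G' s" using s z by (intro le[OF s']) auto
    qed
    then show ?thesis using Gd[of z "1/2"] z by auto
  qed
  moreover have "P z = D 0 z"
  proof -
    have "P z = (\<Sum>k<m. if k = 0 then D 0 z else 0)"
      unfolding P_def by (intro sum.cong) auto
    then show ?thesis using m by simp
  qed
  ultimately show ?thesis by (simp add: P_def)
qed

definition lagrange_basis :: "nat \<Rightarrow> (nat \<Rightarrow> real) \<Rightarrow> nat \<Rightarrow> real \<Rightarrow> real" where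
  "lagrange_basis n \<xi> l z = (\<Prod>i\<in>{1..n} - {l}. (z - \<xi> i) / (\<xi> l - \<xi> i))"

definition interpolant :: "nat \<Rightarrow> (nat \<Rightarrow> real) \<Rightarrow> (nat \<Rightarrow> real) \<Rightarrow> real \<Rightarrow> real" where
  "interpolant n \<xi> y z = (\<Sum>l=1..n. y l * lagrange_basis n \<xi> l z)"

text \<open>
  A bound for the Lebesgue constant on the unit interval: all numerators of the Lagrange basis are at
  most 1 there.
\<close>

definition lebesgue_bound :: "nat \<Rightarrow> (nat \<Rightarrow> real) \<Rightarrow> real" where
  "lebesgue_bound n \<xi> = (\<Sum>l=1..n. \<Prod>i\<in>{1..n} - {l}. 1 / \<bar>\<xi> l - \<xi> i\<bar>)"

definition node_poly :: "nat \<Rightarrow> (nat \<Rightarrow> real) \<Rightarrow> real \<Rightarrow> real" where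
  "node_poly n \<xi> z = (\<Prod>l=1..n. z - \<xi> l)"

locale nodes =
  fixes n :: nat and \<xi> :: "nat \<Rightarrow> real"
  assumes n: "n \<ge> 2" and \<xi>: "0 \<le> \<xi> 1" "strict_mono_on {1..n} \<xi>" "\<xi> n \<le> 1"
begin

lemma node_in: "l \<in> {1..n} \<Longrightarrow> \<xi> l \<in> {0..1}"
proof -
  assume l: "l \<in> {1..n}"
  have "mono_on {1..n} \<xi>" using \<xi>(2) by (rule strict_mono_on_imp_mono_on)
  then have "\<xi> 1 \<le> \<xi> l" "\<xi> l \<le> \<xi> n" using l n by (auto simp: mono_on_def)
  then show ?thesis using \<xi> by auto
qed

lemma node_inj: "inj_on \<xi> {1..n}"
  using \<xi>(2) by (rule strict_mono_on_imp_inj_on)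

lemma node_neq: "l \<in> {1..n} \<Longrightarrow> i \<in> {1..n} - {l} \<Longrightarrow> \<xi> l - \<xi> i \<noteq> 0"
  using inj_on_eq_iff[OF node_inj, of l i] by simp

lemma lagrange_basis_node:
  assumes "l \<in> {1..n}" "k \<in> {1..n}"
  shows "lagrange_basis n \<xi> l (\<xi> k) = (if k = l then 1 else 0)"
proof (cases "k = l")
  case True
  have "(\<xi> l - \<xi> i) / (\<xi> l - \<xi> i) = 1" if "i \<in> {1..n} - {l}" for i
    using node_neq[OF assms(1) that] by simp
  then have "lagrange_basis n \<xi> l (\<xi> l) = 1"
    unfolding lagrange_basis_def by (rule prod.neutral[rule_format])
  then show ?thesis using True by simp
next
  case False
  have "lagrange_basis n \<xi> l (\<xi> k) = 0"
    unfolding lagrange_basis_def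
  proof (rule prod_zero)
    show "\<exists>i\<in>{1..n} - {l}. (\<xi> k - \<xi> i) / (\<xi> l - \<xi> i) = 0"
      using False assms by (intro bexI[of _ k]) auto
  qed simp
  then show ?thesis using False by simp
qed

lemma interpolant_node: "k \<in> {1..n} \<Longrightarrow> interpolant n \<xi> y (\<xi> k) = y k"
proof -
  assume k: "k \<in> {1..n}"
  have "interpolant n \<xi> y (\<xi> k) = (\<Sum>l=1..n. if k = l then y l else 0)"
    unfolding interpolant_def by (intro sum.cong) (simp_all add: lagrange_basis_node[OF _ k])
  then show ?thesis using k by simp
qed

lemma lebesgue_bound_nonneg: "0 \<le> lebesgue_bound n \<xi>"
  unfolding lebesgue_bound_def by (intro sum_nonneg prod_nonneg) auto

lemma interpolant_bound:
  assumes z: "z \<in> {0..1}" and y: "\<And>l. l \<in> {1..n} \<Longrightarrow> \<bar>y l\<bar> \<le> C"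
  shows "\<bar>interpolant n \<xi> y z\<bar> \<le> C * lebesgue_bound n \<xi>"
proof -
  have L: "\<bar>lagrange_basis n \<xi> l z\<bar> \<le> (\<Prod>i\<in>{1..n} - {l}. 1 / \<bar>\<xi> l - \<xi> i\<bar>)" if l: "l \<in> {1..n}" for l
    unfolding lagrange_basis_def abs_prod
  proof (rule prod_mono)
    fix i assume i: "i \<in> {1..n} - {l}"
    have "\<bar>z - \<xi> i\<bar> \<le> 1" using z node_in[of i] i by auto
    then show "0 \<le> \<bar>(z - \<xi> i) / (\<xi> l - \<xi> i)\<bar> \<and> \<bar>(z - \<xi> i) / (\<xi> l - \<xi> i)\<bar> \<le> 1 / \<bar>\<xi> l - \<xi> i\<bar>"
      by (auto simp: abs_divide intro!: divide_right_mono)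
  qed
  have "\<bar>interpolant n \<xi> y z\<bar> \<le> (\<Sum>l=1..n. \<bar>y l\<bar> * \<bar>lagrange_basis n \<xi> l z\<bar>)"
    unfolding interpolant_def abs_mult[symmetric] by (rule sum_abs)
  also have "\<dots> \<le> (\<Sum>l=1..n. C * (\<Prod>i\<in>{1..n} - {l}. 1 / \<bar>\<xi> l - \<xi> i\<bar>))"
  proof (intro sum_mono mult_mono L y)
    show "0 \<le> C" using y[of 1] n by force
  qed auto
  finally show ?thesis by (simp add: lebesgue_bound_def sum_distrib_left)
qed

lemma interpolant_diff: "interpolant n \<xi> (\<lambda>l. y l - y' l) z = interpolant n \<xi> y z - interpolant n \<xi> y' z"
  unfolding interpolant_def by (simp add: left_diff_distrib sum_subtractf)

lemma interpolant_add: "interpolant n \<xi> (\<lambda>l. y l + y' l) z = interpolant n \<xi> y z + interpolant n \<xi> y' z"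
  unfolding interpolant_def by (simp add: distrib_right sum.distrib)

lemma interpolant_continuous: "continuous_on S (interpolant n \<xi> y)"
  unfolding interpolant_def[abs_def] lagrange_basis_def
  by (intro continuous_intros ballI) (rule node_neq)

lemma node_poly_bound: "z \<in> {0..1} \<Longrightarrow> \<bar>node_poly n \<xi> z\<bar> \<le> 1"
  unfolding node_poly_def abs_prod
proof (rule prod_le_1)
  fix l assume "z \<in> {0..1}" "l \<in> {1..n}"
  then show "0 \<le> \<bar>z - \<xi> l\<bar> \<and> \<bar>z - \<xi> l\<bar> \<le> 1" using node_in[of l] by auto
qed

text \<open>
  After subtraction of the right-hand side, \<open>P\<close> has degree below \<open>n\<close> and the same nodal values, so it
  is reproduced by interpolation.
\<close>

lemma poly_interpolation_error:
  fixes P :: "real poly"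
  assumes "degree P \<le> n"
  shows "poly P z - interpolant n \<xi> (\<lambda>l. poly P (\<xi> l)) z = coeff P n * node_poly n \<xi> z"
proof -
  define L where "L = (\<Sum>l=1..n. smult (poly P (\<xi> l)) (\<Prod>i\<in>{1..n} - {l}. smult (1 / (\<xi> l - \<xi> i)) [:- \<xi> i, 1:]))"
  have L: "poly L x = interpolant n \<xi> (\<lambda>l. poly P (\<xi> l)) x" for x
    unfolding L_def interpolant_def lagrange_basis_def by (simp add: poly_sum poly_prod diff_divide_distrib)
  define V where "V = (\<Prod>l=1..n. [:- \<xi> l, 1:])"
  have V: "poly V x = node_poly n \<xi> x" for x
    unfolding V_def node_poly_def by (simp add: poly_prod)
  have degV: "degree V = n" unfolding V_def by (subst degree_prod_eq_sum_degree) auto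
  have leadV: "coeff V n = 1"
    using degV lead_coeff_prod[of "\<lambda>l. [:- \<xi> l, 1:]" "{1..n}"] by (simp add: V_def)
  have degL: "degree L < n"
    unfolding L_def
  proof (rule degree_sum_less)
    fix l assume l: "l \<in> {1..n}"
    have "degree (\<Prod>i\<in>{1..n} - {l}. smult (1 / (\<xi> l - \<xi> i)) [:- \<xi> i, 1:])
        \<le> sum (degree \<circ> (\<lambda>i. smult (1 / (\<xi> l - \<xi> i)) [:- \<xi> i, 1:])) ({1..n} - {l})"
      by (rule degree_prod_sum_le) auto
    also have "\<dots> \<le> (\<Sum>i\<in>{1..n} - {l}. 1)"
      by (intro sum_mono) (auto intro: order_trans[OF degree_smult_le])
    also have "\<dots> = n - 1" using l by simp
    finally show "degree (smult (poly P (\<xi> l)) (\<Prod>i\<in>{1..n} - {l}. smult (1 / (\<xi> l - \<xi> i)) [:- \<xi> i, 1:])) < n"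
      using n by (intro le_less_trans[OF degree_smult_le]) linarith
  qed (use n in simp)
  define Q where "Q = P - smult (coeff P n) V"
  have degQ: "degree Q < n"
  proof -
    have "degree Q \<le> n" unfolding Q_def
      using assms degV by (intro degree_diff_le order_trans[OF degree_smult_le]) auto
    moreover have "coeff Q n = 0" by (simp add: Q_def leadV)
    moreover have "degree Q \<noteq> n"
    proof
      assume deg: "degree Q = n"
      then have "lead_coeff Q = 0" using \<open>coeff Q n = 0\<close> by simp
      then have "degree Q = 0" by simp
      then show False using deg n by simp
    qed
    ultimately show ?thesis by simp
  qed
  have "Q = L"
  proof (rule poly_eqI_degree[where A="\<xi> ` {1..n}"])
    show "poly Q x = poly L x" if x: "x \<in> \<xi> ` {1..n}" for x
    proof -
      obtain k where k: "k \<in> {1..n}" "x = \<xi> k" using x by blast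
      have "node_poly n \<xi> x = 0" unfolding node_poly_def using k by auto
      then show ?thesis unfolding L using k by (simp add: Q_def V interpolant_node)
    qed
    show "card (\<xi> ` {1..n}) > degree Q" "card (\<xi> ` {1..n}) > degree L"
      using degQ degL card_image[OF node_inj] by auto
  qed
  then have "poly Q z = poly L z" by simp
  then show ?thesis unfolding L by (simp add: Q_def V algebra_simps)
qed

text \<open>
  Interpolation reproduces the Taylor polynomial at 1/2, apart from its term of degree \<open>n\<close>, which is
  present for \<open>m = n + 1\<close> and contributes a multiple of the node polynomial; the Taylor remainder is
  amplified at most by the Lebesgue constant. The case \<open>m = n + 1\<close> isolates the part of the error
  that a quadrature condition on the nodes can annihilate.
\<close>

lemma interpolation_error:
  fixes D :: "nat \<Rightarrow> real \<Rightarrow> real" and e B :: real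
  assumes m: "0 < m" "m \<le> Suc n" and e: "0 < e"
    and c: "continuous_on {0..1} (D 0)"
    and D: "\<And>k s. k < m \<Longrightarrow> s \<in> {0<..<1} \<Longrightarrow> (D k has_real_derivative D (Suc k) s) (at s)"
    and B: "\<And>s. s \<in> {0<..<1} \<Longrightarrow> \<bar>D m s\<bar> \<le> B * (1 - s) powr (e - real m)"
    and z: "z \<in> {0..1}"
  shows "\<bar>D 0 z - interpolant n \<xi> (\<lambda>l. D 0 (\<xi> l)) z
      - (if m = Suc n then D n (1/2) / fact n else 0) * node_poly n \<xi> z\<bar> \<le> (1 + lebesgue_bound n \<xi>) * (B / e)"
proof -
  define T :: "real poly" where "T = (\<Sum>k<m. smult (D k (1/2) / fact k) ([:- 1/2, 1:] ^ k))"
  have T: "poly T x = (\<Sum>k<m. D k (1/2) / fact k * (x - 1/2) ^ k)" for x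
    unfolding T_def by (simp add: poly_sum)
  have deg: "degree ([:- 1/2, 1::real:] ^ k) = k" for k by (simp add: degree_power_eq)
  have degT: "degree T \<le> n" unfolding T_def
  proof (rule degree_sum_le)
    fix k assume "k \<in> {..<m}"
    then show "degree (smult (D k (1/2) / fact k) ([:- 1/2, 1:] ^ k)) \<le> n"
      using m(2) deg[of k] order_trans[OF degree_smult_le, of "[:- 1/2, 1:] ^ k" n] by simp
  qed simp
  have cT: "coeff T n = (if m = Suc n then D n (1/2) / fact n else 0)"
  proof -
    have "coeff T n = (\<Sum>k<m. if k = n then D n (1/2) / fact n else 0)"
      unfolding T_def coeff_sum
    proof (rule sum.cong)
      fix k assume k: "k \<in> {..<m}"
      show "coeff (smult (D k (1/2) / fact k) ([:- 1/2, 1:] ^ k)) n = (if k = n then D n (1/2) / fact n else 0)"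
      proof (cases "k = n")
        case True
        have "coeff ([:- 1/2, 1::real:] ^ n) n = 1" using lead_coeff_power[of "[:- 1/2, 1::real:]" n] deg[of n] by simp
        then show ?thesis using True by simp
      next
        case False
        then have "k < n" using k m(2) by simp
        then have "coeff ([:- 1/2, 1::real:] ^ k) n = 0" using deg[of k] by (intro coeff_eq_0) simp
        then show ?thesis using False by simp
      qed
    qed simp
    then show ?thesis using m(2) by auto
  qed
  have R: "\<bar>D 0 x - poly T x\<bar> \<le> B / e" if x: "x \<in> {0..1}" for x
  proof -
    have "norm ((\<lambda>x. D 0 x - poly T x) x) \<le> B / e"
    proof (rule continuous_on_closure_norm_le[where s="{0<..<1}" and f="\<lambda>x. D 0 x - poly T x"])
      show "continuous_on (closure {0<..<1}) (\<lambda>x. D 0 x - poly T x)"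
        using c by (auto intro!: continuous_intros)
      show "\<forall>y\<in>{0<..<1}. norm (D 0 y - poly T y) \<le> B / e"
        using taylor_remainder_singular[OF m(1) e D B] unfolding T by simp
    qed (use x in auto)
    then show ?thesis by simp
  qed
  have "D 0 z - interpolant n \<xi> (\<lambda>l. D 0 (\<xi> l)) z - coeff T n * node_poly n \<xi> z
     = (D 0 z - poly T z) - interpolant n \<xi> (\<lambda>l. D 0 (\<xi> l) - poly T (\<xi> l)) z"
    using poly_interpolation_error[OF degT, of z] by (simp add: interpolant_diff)
  moreover have "\<bar>interpolant n \<xi> (\<lambda>l. D 0 (\<xi> l) - poly T (\<xi> l)) z\<bar> \<le> B / e * lebesgue_bound n \<xi>"
    by (rule interpolant_bound[OF z]) (use R node_in in blast)
  ultimately have "\<bar>D 0 z - interpolant n \<xi> (\<lambda>l. D 0 (\<xi> l)) z - coeff T n * node_poly n \<xi> z\<bar>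
     \<le> B / e + B / e * lebesgue_bound n \<xi>" using R[OF z] by linarith
  then show ?thesis unfolding cT by (simp add: algebra_simps)
qed

end

section \<open>Finite linear systems\<close>

text \<open>
  Gaussian elimination: an equation with a nonzero coefficient is solved for the corresponding
  unknown, and both are removed.
\<close>

lemma underdetermined_system:
  fixes A :: "'i \<Rightarrow> 'j \<Rightarrow> real"
  assumes "finite I" "finite J" "card I < card J"
  shows "\<exists>y. (\<exists>j\<in>J. y j \<noteq> 0) \<and> (\<forall>i\<in>I. (\<Sum>j\<in>J. A i j * y j) = 0)"
  using assms
proof (induction I arbitrary: A J rule: finite_induct)
  case empty
  then obtain j where "j \<in> J" by fastforce
  then show ?case by (intro exI[of _ "\<lambda>_. 1"]) auto
next
  case (insert i0 I)
  show ?case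
  proof (cases "\<forall>j\<in>J. A i0 j = 0")
    case True
    obtain y where "\<exists>j\<in>J. y j \<noteq> 0" "\<forall>i\<in>I. (\<Sum>j\<in>J. A i j * y j) = 0"
      using insert.IH[of J A] insert.prems insert.hyps by auto
    then show ?thesis using True by (intro exI[of _ y]) auto
  next
    case False
    then obtain j0 where j0: "j0 \<in> J" "A i0 j0 \<noteq> 0" by blast
    let ?J = "J - {j0}"
    let ?B = "\<lambda>i j. A i j - A i j0 * A i0 j / A i0 j0"
    have "card I < card ?J" using insert.prems insert.hyps j0 by simp
    then obtain y where y: "\<exists>j\<in>?J. y j \<noteq> 0" "\<forall>i\<in>I. (\<Sum>j\<in>?J. ?B i j * y j) = 0"
      using insert.IH[of ?J ?B] insert.prems by auto
    define s where "s = - (\<Sum>j\<in>?J. A i0 j * y j) / A i0 j0"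
    define y' where "y' = y(j0 := s)"
    have sum: "(\<Sum>j\<in>J. A i j * y' j) = A i j0 * s + (\<Sum>j\<in>?J. A i j * y j)" for i
    proof -
      have "(\<Sum>j\<in>J. A i j * y' j) = A i j0 * y' j0 + (\<Sum>j\<in>?J. A i j * y' j)"
        using insert.prems j0 by (simp add: sum.remove)
      moreover have "(\<Sum>j\<in>?J. A i j * y' j) = (\<Sum>j\<in>?J. A i j * y j)"
        by (rule sum.cong) (auto simp: y'_def)
      ultimately show ?thesis by (simp add: y'_def)
    qed
    have "(\<Sum>j\<in>J. A i0 j * y' j) = 0" unfolding sum s_def using j0 by simp
    moreover have "(\<Sum>j\<in>J. A i j * y' j) = 0" if "i \<in> I" for i
    proof -
      have "0 = (\<Sum>j\<in>?J. ?B i j * y j)" using y(2) that by simp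
      also have "\<dots> = (\<Sum>j\<in>?J. A i j * y j - A i j0 / A i0 j0 * (A i0 j * y j))"
        by (intro sum.cong) (auto simp: algebra_simps)
      also have "\<dots> = (\<Sum>j\<in>?J. A i j * y j) - A i j0 / A i0 j0 * (\<Sum>j\<in>?J. A i0 j * y j)"
        by (simp add: sum_subtractf sum_distrib_left)
      finally show ?thesis unfolding sum s_def by (simp add: field_simps)
    qed
    moreover have "\<exists>j\<in>J. y' j \<noteq> 0" using y(1) by (auto simp: y'_def)
    ultimately show ?thesis by (intro exI[of _ y']) auto
  qed
qed

text \<open>
  With an additional unknown in front of the right-hand side \<open>c\<close> the system has more unknowns than
  equations. In a nontrivial solution that unknown does not vanish by injectivity, so one can divide
  by it.
\<close>

lemma linear_injective_imp_surjective_on: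
  fixes T :: "('i \<Rightarrow> real) \<Rightarrow> 'i \<Rightarrow> real" and c :: "'i \<Rightarrow> real"
  assumes I: "finite I"
    and add: "\<And>y y' j. j \<in> I \<Longrightarrow> T (\<lambda>i. y i + y' i) j = T y j + T y' j"
    and scale: "\<And>r y j. j \<in> I \<Longrightarrow> T (\<lambda>i. r * y i) j = r * T y j"
    and inj: "\<And>y. \<forall>j\<in>I. T y j = 0 \<Longrightarrow> \<forall>i\<in>I. y i = 0"
  shows "\<exists>y. \<forall>j\<in>I. T y j = c j"
proof -
  define A where "A j i = T (\<lambda>k. if k = i then 1 else 0) j" for j i
  have T_sum: "T (\<lambda>k. if k \<in> S then y k else 0) j = (\<Sum>i\<in>S. A j i * y i)"
    if S: "finite S" and j: "j \<in> I" for S y j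
    using S
  proof (induction S rule: finite_induct)
    case empty
    have "T (\<lambda>k. 0 * 0) j = 0 * T (\<lambda>k. 0) j" by (rule scale[OF j])
    then show ?case by simp
  next
    case (insert x S)
    have "(\<lambda>k. if k \<in> insert x S then y k else 0)
        = (\<lambda>k. y x * (if k = x then 1 else 0) + (if k \<in> S then y k else 0))"
      using insert.hyps by auto
    then have "T (\<lambda>k. if k \<in> insert x S then y k else 0) j
        = T (\<lambda>k. y x * (if k = x then 1 else 0)) j + T (\<lambda>k. if k \<in> S then y k else 0) j"
      using add[OF j] by simp
    also have "T (\<lambda>k. y x * (if k = x then 1 else 0)) j = y x * A j x"
      unfolding A_def by (rule scale[OF j])
    finally show ?case using insert by simp
  qed
  let ?J = "insert None (Some ` I)"
  let ?A = "\<lambda>j i. case i of None \<Rightarrow> - c j | Some i \<Rightarrow> A j i"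
  have "card I < card ?J" using I by (simp add: card_image)
  then obtain y where y: "\<exists>i\<in>?J. y i \<noteq> 0" "\<forall>j\<in>I. (\<Sum>i\<in>?J. ?A j i * y i) = 0"
    using underdetermined_system[of I ?J ?A] I by auto
  have eq: "(\<Sum>i\<in>I. A j i * y (Some i)) = c j * y None" if "j \<in> I" for j
  proof -
    have "(\<Sum>i\<in>Some ` I. ?A j i * y i) = (\<Sum>i\<in>I. A j i * y (Some i))"
      by (simp add: sum.reindex)
    moreover have "None \<notin> Some ` I" by auto
    ultimately show ?thesis using y(2)[rule_format, OF that] I by simp
  qed
  have "y None \<noteq> 0"
  proof
    assume 0: "y None = 0"
    define y' where "y' k = (if k \<in> I then y (Some k) else 0)" for k
    have "T y' j = 0" if "j \<in> I" for j
      unfolding y'_def[abs_def] T_sum[OF I that] using eq[OF that] 0 by simp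
    then have "\<forall>i\<in>I. y' i = 0" using inj by blast
    then show False using y(1) 0 by (auto simp: y'_def)
  qed
  then have "T (\<lambda>k. if k \<in> I then y (Some k) / y None else 0) j = c j" if "j \<in> I" for j
    unfolding T_sum[OF I that] using eq[OF that]
    by (simp add: sum_divide_distrib[symmetric])
  then show ?thesis by blast
qed

section \<open>Stability of piecewise integration\<close>

lemma piecewise_antiderivative_continuous:
  fixes X :: "nat \<Rightarrow> real" and s :: "nat \<Rightarrow> real \<Rightarrow> real"
  assumes X: "\<And>j. j \<in> {1..M} \<Longrightarrow> X (j - 1) \<le> X j"
    and s: "\<And>j. j \<in> {1..M} \<Longrightarrow> continuous_on {X (j - 1)..X j} (s j)"
    and f: "\<And>j x. j \<in> {1..M} \<Longrightarrow> x \<in> {X (j - 1)..X j} \<Longrightarrow> f x = f (X j) - integral {x..X j} (s j)"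
  shows "continuous_on {X 0..X M} f"
proof -
  have "m \<le> M \<Longrightarrow> X 0 \<le> X m \<and> continuous_on {X 0..X m} f" for m
  proof (induction m)
    case (Suc m)
    then have j: "Suc m \<in> {1..M}" by simp
    have le: "X m \<le> X (Suc m)" using X[OF j] by simp
    have "s (Suc m) integrable_on {X m..X (Suc m)}"
      using s[OF j] by (intro integrable_continuous_real) simp
    then have "continuous_on {X m..X (Suc m)} (\<lambda>x. f (X (Suc m)) - integral {x..X (Suc m)} (s (Suc m)))"
      by (intro continuous_intros indefinite_integral_continuous_1')
    then have "continuous_on {X m..X (Suc m)} f"
    proof (rule continuous_on_eq)
      fix x assume "x \<in> {X m..X (Suc m)}"
      then show "f (X (Suc m)) - integral {x..X (Suc m)} (s (Suc m)) = f x"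
        using f[OF j, of x] by (simp only: diff_Suc_1)
    qed
    then have "continuous_on ({X 0..X m} \<union> {X m..X (Suc m)}) f"
      using Suc by (intro continuous_on_closed_Un) auto
    moreover have "{X 0..X m} \<union> {X m..X (Suc m)} = {X 0..X (Suc m)}"
      using Suc le by (intro ivl_disj_un_two_touch) auto
    ultimately show ?case using Suc le by auto
  qed simp
  then show ?thesis by blast
qed

lemma exp_ge_inverse_one_minus:
  fixes y :: real assumes "0 \<le> y" "y \<le> 1/2" shows "1 \<le> exp (2 * y) * (1 - y)"
proof -
  have "1 \<le> (1 + 2 * y) * (1 - y)" using assms mult_nonneg_nonneg[of y "1 - 2 * y"] by (simp add: algebra_simps)
  also have "\<dots> \<le> exp (2 * y) * (1 - y)" using assms by (intro mult_right_mono exp_ge_add_one_self) auto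
  finally show ?thesis .
qed

text \<open>
  The function \<open>e\<close> vanishes at the right end point and is integrated backwards from \<open>r + s\<close>, where \<open>s\<close>
  is controlled by the values of \<open>e\<close> to the right of the left end of the current interval. Only
  integrals of \<open>r\<close> enter the bound, never its size; this is what makes superconvergence visible. The
  induction over the intervals, from right to left, carries besides the bound for \<open>e\<close> a bound for the
  contribution of \<open>s\<close> alone.
\<close>

lemma backward_gronwall:
  fixes X :: "nat \<Rightarrow> real" and e :: "real \<Rightarrow> real" and r s :: "nat \<Rightarrow> real \<Rightarrow> real" and B R :: real
  assumes X: "\<And>j. j \<in> {1..M} \<Longrightarrow> X (j - 1) \<le> X j"
    and ce: "continuous_on {X 0..X M} e" and eM: "e (X M) = 0"
    and rep: "\<And>j x. j \<in> {1..M} \<Longrightarrow> x \<in> {X (j - 1)..X j} \<Longrightarrow>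
       e x = e (X j) - integral {x..X j} (r j) - integral {x..X j} (s j)"
    and s: "\<And>j. j \<in> {1..M} \<Longrightarrow> continuous_on {X (j - 1)..X j} (s j)"
    and sB: "\<And>j x E. j \<in> {1..M} \<Longrightarrow> x \<in> {X (j - 1)..X j} \<Longrightarrow>
       \<forall>y\<in>{X (j - 1)..X M}. \<bar>e y\<bar> \<le> E \<Longrightarrow> \<bar>s j x\<bar> \<le> B * E"
    and R: "0 \<le> R" "\<And>j x. j \<in> {1..M} \<Longrightarrow> x \<in> {X (j - 1)..X j} \<Longrightarrow>
       \<bar>integral {x..X j} (r j) + (\<Sum>k\<in>{j<..M}. integral {X (k - 1)..X k} (r k))\<bar> \<le> R"
    and B: "0 \<le> B" "\<And>j. j \<in> {1..M} \<Longrightarrow> B * (X j - X (j - 1)) \<le> 1/2"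
    and x: "x \<in> {X 0..X M}"
  shows "\<bar>e x\<bar> \<le> R * exp (2 * B * (X M - X 0))"
proof -
  define \<eta> where "\<eta> j = exp (2 * B * (X M - X j))" for j
  define S where "S j = (\<Sum>k\<in>{j<..M}. integral {X (k - 1)..X k} (r k))" for j
  have XM: "m \<le> M \<Longrightarrow> X 0 \<le> X m" for m
  proof (induction m)
    case (Suc m)
    then show ?case using X[of "Suc m"] by simp
  qed simp
  have "X 0 \<le> X 0 \<and> X 0 \<le> X M \<and> (\<forall>x\<in>{X 0..X M}. \<bar>e x\<bar> \<le> R * \<eta> 0) \<and> \<bar>e (X 0) + S 0\<bar> \<le> R * (\<eta> 0 - 1)"
  proof (rule inc_induct[of 0 M "\<lambda>j. X 0 \<le> X j \<and> X j \<le> X M \<and> (\<forall>x\<in>{X j..X M}. \<bar>e x\<bar> \<le> R * \<eta> j) \<and> \<bar>e (X j) + S j\<bar> \<le> R * (\<eta> j - 1)"])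
    show "X 0 \<le> X M \<and> X M \<le> X M \<and> (\<forall>x\<in>{X M..X M}. \<bar>e x\<bar> \<le> R * \<eta> M) \<and> \<bar>e (X M) + S M\<bar> \<le> R * (\<eta> M - 1)"
      using eM R(1) XM by (auto simp: \<eta>_def S_def)
  next
    fix j assume jM: "j < M"
    assume IH: "X 0 \<le> X (Suc j) \<and> X (Suc j) \<le> X M \<and> (\<forall>x\<in>{X (Suc j)..X M}. \<bar>e x\<bar> \<le> R * \<eta> (Suc j)) \<and>
      \<bar>e (X (Suc j)) + S (Suc j)\<bar> \<le> R * (\<eta> (Suc j) - 1)"
    let ?I = "{X j..X (Suc j)}"
    have J: "Suc j \<in> {1..M}" using jM by simp
    have Xj: "X j \<le> X (Suc j)" using X[OF J] by simp
    have X0j: "X 0 \<le> X j" using XM[of j] jM by simp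
    define d where "d = B * (X (Suc j) - X j)"
    have d: "0 \<le> d" "d \<le> 1/2" using B(1) B(2)[OF J] Xj by (auto simp: d_def)
    have S: "S j = integral ?I (r (Suc j)) + S (Suc j)"
    proof -
      have "{j<..M} = insert (Suc j) {Suc j<..M}" using jM by auto
      then show ?thesis by (simp add: S_def)
    qed
    have "\<exists>x\<in>{X j..X M}. \<forall>y\<in>{X j..X M}. \<bar>e y\<bar> \<le> \<bar>e x\<bar>"
      using Xj IH X0j by (intro continuous_attains_sup continuous_on_rabs continuous_on_subset[OF ce]) auto
    then obtain z where z: "z \<in> {X j..X M}" "\<And>y. y \<in> {X j..X M} \<Longrightarrow> \<bar>e y\<bar> \<le> \<bar>e z\<bar>" by blast
    define E where "E = \<bar>e z\<bar>"
    have E0: "0 \<le> E" by (simp add: E_def)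
    have sE: "\<bar>s (Suc j) y\<bar> \<le> B * E" if "y \<in> ?I" for y
      using sB[OF J, of y E] that z(2) by (simp add: E_def)
    have int_s: "\<bar>integral {y..X (Suc j)} (s (Suc j))\<bar> \<le> d * E" if y: "y \<in> ?I" for y
    proof -
      have "norm (integral {y..X (Suc j)} (s (Suc j))) \<le> B * E * (X (Suc j) - y)"
      proof (rule integral_bound)
        show "continuous_on {y..X (Suc j)} (s (Suc j))"
          using s[OF J] y by (auto intro: continuous_on_subset)
      qed (use y sE in auto)
      also have "\<dots> \<le> B * E * (X (Suc j) - X j)" using y B(1) E0 by (intro mult_left_mono) auto
      finally show ?thesis by (simp add: d_def mult_ac)
    qed
    have main: "\<bar>e y\<bar> \<le> R * \<eta> (Suc j) + d * E" if y: "y \<in> ?I" for y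
    proof -
      have "e y = (e (X (Suc j)) + S (Suc j)) - (integral {y..X (Suc j)} (r (Suc j)) + S (Suc j)) - integral {y..X (Suc j)} (s (Suc j))"
        using rep[OF J, of y] y by simp
      moreover have "\<bar>integral {y..X (Suc j)} (r (Suc j)) + S (Suc j)\<bar> \<le> R"
        using R(2)[OF J, of y] y by (simp add: S_def)
      moreover have "\<bar>e (X (Suc j)) + S (Suc j)\<bar> \<le> R * (\<eta> (Suc j) - 1)" using IH by blast
      ultimately show ?thesis using int_s[OF y] by (simp add: algebra_simps)
    qed
    have \<eta>S: "R * \<eta> (Suc j) \<le> R * \<eta> j * (1 - d)"
    proof -
      have "\<eta> (Suc j) * 1 \<le> \<eta> (Suc j) * (exp (2 * d) * (1 - d))"
        by (intro mult_left_mono exp_ge_inverse_one_minus d) (simp add: \<eta>_def)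
      also have "\<dots> = \<eta> j * (1 - d)"
        by (simp add: \<eta>_def d_def exp_add[symmetric] algebra_simps)
      finally show ?thesis using R(1) mult_left_mono[of _ _ R] by (simp add: mult.assoc)
    qed
    \<comment> \<open>The maximum \<open>E\<close> also controls \<open>s\<close> on the present interval; since \<open>d \<le> 1/2\<close> it can be absorbed.\<close>
    have "E \<le> R * \<eta> (Suc j) + d * E"
    proof (cases "z \<in> ?I")
      case True
      then show ?thesis using main by (simp add: E_def)
    next
      case False
      then have "\<bar>e z\<bar> \<le> R * \<eta> (Suc j)" using z(1) IH by auto
      then show ?thesis using d E0 by (simp add: E_def add_increasing2)
    qed
    then have "E * (1 - d) \<le> R * \<eta> (Suc j)" by (simp add: algebra_simps)
    also have "\<dots> \<le> R * \<eta> j * (1 - d)" by (rule \<eta>S)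
    finally have E: "E \<le> R * \<eta> j" using d by simp
    have "\<bar>e (X j) + S j\<bar> \<le> R * (\<eta> j - 1)"
    proof -
      have "e (X j) + S j = (e (X (Suc j)) + S (Suc j)) - integral ?I (s (Suc j))"
        using rep[OF J, of "X j"] Xj by (simp add: S)
      moreover have "\<bar>integral ?I (s (Suc j))\<bar> \<le> d * (R * \<eta> j)"
        using int_s[of "X j"] Xj mult_left_mono[OF E d(1)] by simp
      ultimately have "\<bar>e (X j) + S j\<bar> \<le> R * (\<eta> (Suc j) - 1) + d * (R * \<eta> j)" using IH by linarith
      then show ?thesis using \<eta>S by (simp add: algebra_simps)
    qed
    moreover have "\<forall>x\<in>{X j..X M}. \<bar>e x\<bar> \<le> R * \<eta> j" using z(2) E unfolding E_def by (blast intro: order_trans)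
    ultimately show "X 0 \<le> X j \<and> X j \<le> X M \<and> (\<forall>x\<in>{X j..X M}. \<bar>e x\<bar> \<le> R * \<eta> j) \<and> \<bar>e (X j) + S j\<bar> \<le> R * (\<eta> j - 1)"
      using X0j Xj IH by auto
  qed simp
  then show ?thesis using x by (auto simp: \<eta>_def)
qed

section \<open>The graded mesh\<close>

lemma one_minus_powr_le:
  fixes x \<gamma> :: real
  assumes x: "0 \<le> x" "x \<le> 1" and \<gamma>: "0 < \<gamma>"
  shows "1 - (1 - x) powr \<gamma> \<le> max 1 \<gamma> * x"
proof (cases "x = 1")
  case False
  then have x1: "x < 1" using x by simp
  show ?thesis
  proof (cases "\<gamma> \<le> 1")
    case True
    have "(1 - x) powr 1 \<le> (1 - x) powr \<gamma>" using True x by (intro powr_mono') auto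
    then show ?thesis using x x1 True by (simp add: max_def)
  next
    case False
    have "(\<lambda>y. (1 - y) powr \<gamma> + \<gamma> * y) 0 \<le> (\<lambda>y. (1 - y) powr \<gamma> + \<gamma> * y) x"
    proof (rule DERIV_nonneg_imp_nondecreasing[OF x(1)])
      fix y assume y: "0 \<le> y" "y \<le> x"
      have "((\<lambda>y. (1 - y) powr \<gamma> + \<gamma> * y) has_real_derivative \<gamma> * (1 - (1 - y) powr (\<gamma> - 1))) (at y)"
        using y x1 by (auto intro!: derivative_eq_intros simp: powr_diff field_simps)
      moreover have "(1 - y) powr (\<gamma> - 1) \<le> 1" using y x1 False by (intro powr_le1) auto
      ultimately show "\<exists>d. ((\<lambda>y. (1 - y) powr \<gamma> + \<gamma> * y) has_real_derivative d) (at y) \<and> 0 \<le> d"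
        using \<gamma> by (intro exI[of _ "\<gamma> * (1 - (1 - y) powr (\<gamma> - 1))"]) auto
    qed
    then show ?thesis using False by (simp add: max_def)
  qed
qed (use \<gamma> in simp)

locale graded_mesh = nodes n \<xi> for n :: nat and \<xi> :: "nat \<Rightarrow> real" +
  fixes b \<mu> q :: real
  assumes b: "b > 0" and \<mu>: "0 < \<mu>" "\<mu> < 1" and q: "q \<ge> 1"
begin

abbreviation X :: "nat \<Rightarrow> nat \<Rightarrow> real" where "X M j \<equiv> mesh b q M j"
abbreviation cell :: "nat \<Rightarrow> nat \<Rightarrow> real set" where "cell M j \<equiv> {X M (j - 1)..X M j}"
abbreviation coll :: "nat \<Rightarrow> nat \<Rightarrow> nat \<Rightarrow> real" where "coll M j l \<equiv> coll_point b \<mu> q \<xi> M j l"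

lemma b_minus_X: "b - X M j = b * ((real M - real j) / real M) powr q"
  by (simp add: mesh_def algebra_simps)

text \<open>
  Distances from \<open>b\<close> are expressed by \<open>M + 1 - j\<close>, the number of the \<open>j\<close>-th interval when counting
  from the singular end point.
\<close>

lemma b_minus_X_right: "j \<in> {1..M} \<Longrightarrow> b - X M j = b * ((real (M + 1 - j) - 1) / real M) powr q"
  unfolding b_minus_X by (simp add: of_nat_diff)

lemma b_minus_X_left: "j \<in> {1..M} \<Longrightarrow> b - X M (j - 1) = b * (real (M + 1 - j) / real M) powr q"
proof -
  assume "j \<in> {1..M}"
  then have "real M - real (j - 1) = real (M + 1 - j)" by (simp add: of_nat_diff)
  then show ?thesis unfolding b_minus_X by (simp only:)
qed

lemma X_0: "M \<ge> 1 \<Longrightarrow> X M 0 = 0"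
  by (simp add: mesh_def)

lemma X_M: "X M M = b"
  by (simp add: mesh_def)

lemma X_less: "i < j \<Longrightarrow> j \<le> M \<Longrightarrow> X M i < X M j"
proof -
  assume ij: "i < j" "j \<le> M"
  have "((real M - real j) / real M) powr q < ((real M - real i) / real M) powr q"
    using ij q by (intro powr_less_mono2 divide_strict_right_mono) auto
  then show ?thesis using b by (simp add: mesh_def)
qed

lemma X_step: "j \<in> {1..M} \<Longrightarrow> X M (j - 1) < X M j"
  by (rule X_less) auto

lemma X_le: "i \<le> j \<Longrightarrow> j \<le> M \<Longrightarrow> X M i \<le> X M j"
  using X_less[of i j M] by (cases "i = j") auto

lemma X_in: "j \<le> M \<Longrightarrow> M \<ge> 1 \<Longrightarrow> X M j \<in> {0..b}"
  using X_le[of 0 j M] X_le[of j M M] X_0 X_M by simp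

lemma X_interval:
  assumes "j \<in> {1..M}" "x \<in> cell M j" shows "x \<in> {0..b}"
proof -
  have "X M (j - 1) \<in> {0..b}" by (rule X_in) (use assms(1) in auto)
  moreover have "X M j \<in> {0..b}" by (rule X_in) (use assms(1) in auto)
  ultimately show ?thesis using assms(2) by auto
qed

text \<open>
  In the variable \<open>(b - x) powr \<mu>\<close>, which decreases in \<open>x\<close>, the \<open>j\<close>-th mesh interval is
  \<open>[\<alpha> M j, \<beta> M j]\<close>. The local coordinate maps it onto the unit interval such that the collocation
  points go to the parameters \<open>\<xi>\<close>.
\<close>

definition \<beta> :: "nat \<Rightarrow> nat \<Rightarrow> real" where "\<beta> M j = (b - X M (j - 1)) powr \<mu>"
definition \<alpha> :: "nat \<Rightarrow> nat \<Rightarrow> real" where "\<alpha> M j = (b - X M j) powr \<mu>"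
definition local_coord :: "nat \<Rightarrow> nat \<Rightarrow> real \<Rightarrow> real" where
  "local_coord M j x = (\<beta> M j - (b - x) powr \<mu>) / (\<beta> M j - \<alpha> M j)"

abbreviation piece :: "nat \<Rightarrow> (nat \<Rightarrow> real) \<Rightarrow> nat \<Rightarrow> real \<Rightarrow> real" where
  "piece M y j x \<equiv> interpolant n \<xi> y (local_coord M j x)"

lemma \<alpha>_nonneg: "0 \<le> \<alpha> M j" by (simp add: \<alpha>_def)

lemma \<alpha>_less_\<beta>:
  assumes "j \<in> {1..M}" shows "\<alpha> M j < \<beta> M j"
proof -
  have "b - X M j < b - X M (j - 1)" using X_step[OF assms] by simp
  moreover have "0 \<le> b - X M j" using X_in[of j M] assms by simp
  ultimately show ?thesis unfolding \<alpha>_def \<beta>_def using \<mu> by (intro powr_less_mono2) auto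
qed

lemma local_coord_in:
  assumes j: "j \<in> {1..M}" and x: "x \<in> cell M j"
  shows "local_coord M j x \<in> {0..1}"
proof -
  have "X M j \<le> b" using X_in[of j M] j by simp
  then have "\<alpha> M j \<le> (b - x) powr \<mu>" "(b - x) powr \<mu> \<le> \<beta> M j"
    unfolding \<alpha>_def \<beta>_def using x \<mu> by (auto intro!: powr_mono2)
  then show ?thesis using \<alpha>_less_\<beta>[OF j] by (simp add: local_coord_def)
qed

lemma local_coord_inverse:
  assumes "j \<in> {1..M}"
  shows "(b - x) powr \<mu> = \<beta> M j - (\<beta> M j - \<alpha> M j) * local_coord M j x"
  using \<alpha>_less_\<beta>[OF assms] by (simp add: local_coord_def)

lemma local_coord_continuous: "continuous_on {..b} (local_coord M j)"
  unfolding local_coord_def[abs_def] divide_inverse using \<mu>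
  by (intro continuous_intros continuous_on_powr') auto

lemma coll_point_powr:
  assumes j: "j \<in> {1..M}" and l: "l \<in> {1..n}"
  shows "(b - coll M j l) powr \<mu> = \<beta> M j - (\<beta> M j - \<alpha> M j) * \<xi> l"
proof -
  have "b - coll M j l = (\<beta> M j - (\<beta> M j - \<alpha> M j) * \<xi> l) powr (1 / \<mu>)"
    unfolding coll_point_def tau_def rho_def \<alpha>_def \<beta>_def by (simp add: algebra_simps)
  moreover have "(\<beta> M j - \<alpha> M j) * \<xi> l \<le> (\<beta> M j - \<alpha> M j) * 1"
    using node_in[OF l] \<alpha>_less_\<beta>[OF j] by (intro mult_left_mono) auto
  then have "0 \<le> \<beta> M j - (\<beta> M j - \<alpha> M j) * \<xi> l" using \<alpha>_nonneg[of M j] by simp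
  ultimately show ?thesis using \<mu> by (simp add: powr_powr)
qed

lemma coll_point_in:
  assumes j: "j \<in> {1..M}" and l: "l \<in> {1..n}"
  shows "coll M j l \<in> cell M j"
proof -
  let ?w = "\<beta> M j - (\<beta> M j - \<alpha> M j) * \<xi> l"
  have c: "b - coll M j l = ?w powr (1 / \<mu>)"
    unfolding coll_point_def tau_def rho_def \<alpha>_def \<beta>_def by (simp add: algebra_simps)
  have "(\<beta> M j - \<alpha> M j) * \<xi> l \<le> (\<beta> M j - \<alpha> M j) * 1" "0 \<le> (\<beta> M j - \<alpha> M j) * \<xi> l"
    using node_in[OF l] \<alpha>_less_\<beta>[OF j] by (intro mult_left_mono mult_nonneg_nonneg; auto)+
  then have "\<alpha> M j \<le> ?w" "?w \<le> \<beta> M j" by auto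
  then have "\<alpha> M j powr (1 / \<mu>) \<le> ?w powr (1 / \<mu>)" "?w powr (1 / \<mu>) \<le> \<beta> M j powr (1 / \<mu>)"
    using \<mu> \<alpha>_nonneg[of M j] by (auto intro!: powr_mono2)
  moreover have "\<alpha> M j powr (1 / \<mu>) = b - X M j" "\<beta> M j powr (1 / \<mu>) = b - X M (j - 1)"
    using \<mu> X_in[of j M] X_in[of "j - 1" M] j by (auto simp: \<alpha>_def \<beta>_def powr_powr)
  ultimately show ?thesis using c by auto
qed

lemma coll_point_in_domain:
  "j \<in> {1..M} \<Longrightarrow> l \<in> {1..n} \<Longrightarrow> coll M j l \<in> {0..b}"
  using coll_point_in X_interval by blast

lemma local_coord_coll_point:
  assumes "j \<in> {1..M}" "l \<in> {1..n}"
  shows "local_coord M j (coll M j l) = \<xi> l"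
  unfolding local_coord_def coll_point_powr[OF assms] using \<alpha>_less_\<beta>[OF assms(1)] by simp

text \<open>
  The local coordinate is affine in \<open>(b - x) powr \<mu>\<close>, so the fractional Lagrange basis becomes the
  ordinary one.
\<close>

lemma psi_piece_eq:
  assumes j: "j \<in> {1..M}"
  shows "psi_piece b \<mu> q n \<xi> M Y j x = piece M (Y j) j x"
  unfolding psi_piece_def interpolant_def
proof (intro sum.cong refl arg_cong2[where f="(*)"])
  fix l assume l: "l \<in> {1..n}"
  show "frac_lagrange b \<mu> q n \<xi> M j l x = lagrange_basis n \<xi> l (local_coord M j x)"
    unfolding frac_lagrange_def lagrange_basis_def
  proof (intro prod.cong refl)
    fix i assume i: "i \<in> {1..n} - {l}"
    let ?d = "\<beta> M j - \<alpha> M j" and ?z = "local_coord M j x"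
    have d: "?d \<noteq> 0" using \<alpha>_less_\<beta>[OF j] by simp
    have "((b - x) powr \<mu> - (b - coll M j i) powr \<mu>) = (- ?d) * (?z - \<xi> i)"
      using coll_point_powr[OF j, of i] i local_coord_inverse[OF j, of x] by (simp add: algebra_simps)
    moreover have "(b - coll M j l) powr \<mu> - (b - coll M j i) powr \<mu> = (- ?d) * (\<xi> l - \<xi> i)"
      using coll_point_powr[OF j, of i] coll_point_powr[OF j l] i by (simp add: algebra_simps)
    ultimately show "((b - x) powr \<mu> - (b - coll M j i) powr \<mu>) /
        ((b - coll M j l) powr \<mu> - (b - coll M j i) powr \<mu>) = (?z - \<xi> i) / (\<xi> l - \<xi> i)"
      using d mult_divide_mult_cancel_left[of "- ?d"] by simp
  qed
qed

lemma psi_piece_coll_point: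
  assumes "j \<in> {1..M}" "l \<in> {1..n}"
  shows "psi_piece b \<mu> q n \<xi> M Y j (coll M j l) = Y j l"
  unfolding psi_piece_eq[OF assms(1)] local_coord_coll_point[OF assms] by (rule interpolant_node[OF assms(2)])

lemma X_step_le:
  assumes j: "j \<in> {1..M}"
  shows "X M j - X M (j - 1) \<le> b * q * ((real (M + 1 - j) / real M) powr q / real (M + 1 - j))"
proof -
  let ?i = "real (M + 1 - j)" and ?y = "real (M + 1 - j) / real M"
  have i: "?i \<ge> 1" using j by (simp add: of_nat_diff)
  have M: "real M > 0" using j by simp
  have "(i - 1) / m = i / m * (1 - 1 / i)" if "i \<ge> 1" for i m :: real
    using that by (simp add: right_diff_distrib diff_divide_distrib)
  from this[OF i] have eq: "(?i - 1) / real M = ?y * (1 - 1 / ?i)" .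
  then have "((?i - 1) / real M) powr q = ?y powr q * (1 - 1 / ?i) powr q"
    unfolding eq by (simp only: powr_mult)
  then have "X M j - X M (j - 1) = b * ?y powr q * (1 - (1 - 1 / ?i) powr q)"
    using b_minus_X_left[OF j] b_minus_X_right[OF j] by (simp add: algebra_simps)
  also have "\<dots> \<le> b * ?y powr q * (max 1 q * (1 / ?i))"
    using b i q by (intro mult_left_mono one_minus_powr_le) auto
  finally show ?thesis using q by (simp add: max_def mult_ac)
qed

lemma X_step_le_inverse:
  assumes j: "j \<in> {1..M}"
  shows "X M j - X M (j - 1) \<le> b * q / real M"
proof -
  let ?i = "real (M + 1 - j)" and ?y = "real (M + 1 - j) / real M"
  have i: "?i \<ge> 1" "?i \<le> real M" using j by (auto simp: of_nat_diff)
  have M: "real M > 0" using j by simp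
  have "?y powr q \<le> ?y powr 1" using i M q by (intro powr_mono') auto
  then have "?y powr q / ?i \<le> ?y / ?i" using i M by (intro divide_right_mono) auto
  also have "\<dots> = 1 / real M" using i by simp
  finally have "b * q * (?y powr q / ?i) \<le> b * q * (1 / real M)"
    using b q by (intro mult_left_mono) auto
  then show ?thesis using X_step_le[OF j] by simp
qed

end

section \<open>Stability and unique solvability of the collocation equations\<close>

locale collocation = graded_mesh n \<xi> b \<mu> q for n \<xi> b \<mu> q +
  fixes \<nu> :: real and a :: "real \<Rightarrow> real" and K :: "real \<Rightarrow> real \<Rightarrow> real"
  assumes \<nu>: "0 < \<nu>" and a: "continuous_on {0..b} a"
    and K: "continuous_on (D_R b) (\<lambda>(x, s). K x s)"
begin

text \<open>
  The homogeneous part of the right-hand side of the equation. Its bound at \<open>x\<close> involves only values of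
  the argument on \<open>[x, b]\<close>, as the backward Gronwall inequality requires.
\<close>

definition vide_op :: "(real \<Rightarrow> real) \<Rightarrow> real \<Rightarrow> real" where
  "vide_op e x = a x * e x + integral {x..b} (\<lambda>s. (s - x) powr (\<nu> - 1) * K x s * e s)"

lemma kernel_times_continuous:
  assumes "x \<in> {0..b}" "continuous_on {0..b} e"
  shows "continuous_on {x..b} (\<lambda>s. K x s * e s)"
proof -
  have "continuous_on {x..b} (\<lambda>s. (\<lambda>(x, s). K x s) (x, s))"
    by (rule continuous_on_compose2[OF K]) (use assms in \<open>auto intro!: continuous_intros simp: D_R_def\<close>)
  then show ?thesis
    by (intro continuous_on_mult continuous_on_subset[OF assms(2)]) (use assms in auto)
qed

lemma kernel_integrable:
  assumes "x \<in> {0..b}" "continuous_on {0..b} e"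
  shows "(\<lambda>s. (s - x) powr (\<nu> - 1) * K x s * e s) integrable_on {x..b}"
proof -
  have c: "continuous_on {x..b} (\<lambda>s. K x s * e s)" using assms by (rule kernel_times_continuous)
  obtain B where B: "\<And>s. s \<in> {x..b} \<Longrightarrow> \<bar>K x s * e s\<bar> \<le> B"
    using continuous_on_compact_bound[OF c] by auto
  have "(\<lambda>s. (s - x) powr (\<nu> - 1) * (K x s * e s)) integrable_on {x..b}"
    by (rule weak_integrable[OF \<nu>, of _ _ _ B]) (use assms c B in \<open>auto intro: continuous_on_subset\<close>)
  then show ?thesis by (simp add: mult.assoc)
qed

lemma vide_op_add:
  assumes "x \<in> {0..b}" "continuous_on {0..b} e" "continuous_on {0..b} f"
  shows "vide_op (\<lambda>s. e s + f s) x = vide_op e x + vide_op f x"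
  using integral_add[OF kernel_integrable[OF assms(1,2)] kernel_integrable[OF assms(1,3)]]
  by (simp add: vide_op_def algebra_simps)

lemma vide_op_scale: "vide_op (\<lambda>s. c * e s) x = c * vide_op e x"
proof -
  have "integral {x..b} (\<lambda>s. (s - x) powr (\<nu> - 1) * K x s * (c * e s))
      = integral {x..b} (\<lambda>s. c * ((s - x) powr (\<nu> - 1) * K x s * e s))"
    by (simp only: mult_ac)
  then show ?thesis by (simp add: vide_op_def algebra_simps)
qed

lemma vide_op_diff:
  assumes "x \<in> {0..b}" "continuous_on {0..b} e" "continuous_on {0..b} f"
  shows "vide_op (\<lambda>s. e s - f s) x = vide_op e x - vide_op f x"
  using vide_op_add[OF assms(1,2), of "\<lambda>s. - 1 * f s"] assms(3) vide_op_scale[of "- 1" f x]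
  by (simp add: continuous_on_minus)

lemma vide_op_bound_ex:
  "\<exists>A\<ge>0. \<forall>e E. \<forall>x\<in>{0..b}. continuous_on {0..b} e \<longrightarrow> (\<forall>y\<in>{x..b}. \<bar>e y\<bar> \<le> E) \<longrightarrow> \<bar>vide_op e x\<bar> \<le> A * E"
proof -
  obtain B1 where B1: "0 \<le> B1" "\<And>x. x \<in> {0..b} \<Longrightarrow> \<bar>a x\<bar> \<le> B1"
    using continuous_on_compact_bound[OF a] by auto
  obtain B2 where B2: "0 \<le> B2" "\<And>z. z \<in> D_R b \<Longrightarrow> \<bar>case z of (x, s) \<Rightarrow> K x s\<bar> \<le> B2"
    using continuous_on_compact_bound[OF K compact_D_R] by blast
  have "\<bar>vide_op e x\<bar> \<le> (B1 + B2 * (b powr \<nu> / \<nu>)) * E"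
    if x: "x \<in> {0..b}" and e: "continuous_on {0..b} e" and E: "\<forall>y\<in>{x..b}. \<bar>e y\<bar> \<le> E" for e E x
  proof -
    have E0: "0 \<le> E" using E x by (force intro: order_trans[OF abs_ge_zero])
    have xb: "x \<le> b" using x by simp
    have "\<bar>integral {x..b} (\<lambda>s. (s - x) powr (\<nu> - 1) * (K x s * e s))\<bar> \<le> (B2 * E) * ((b - x) powr \<nu> / \<nu>)"
    proof (rule weak_integral_bound[OF \<nu> xb])
      show "continuous_on {x<..<b} (\<lambda>s. K x s * e s)"
        using kernel_times_continuous[OF x e] by (rule continuous_on_subset) auto
      fix s assume s: "s \<in> {x<..<b}"
      then have "(x, s) \<in> D_R b" using x by (auto simp: D_R_def)
      then have "\<bar>K x s\<bar> \<le> B2" using B2(2)[of "(x, s)"] by simp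
      moreover have "\<bar>e s\<bar> \<le> E" using E s by auto
      ultimately show "\<bar>K x s * e s\<bar> \<le> B2 * E" unfolding abs_mult by (rule mult_mono') auto
    qed
    also have "\<dots> \<le> (B2 * E) * (b powr \<nu> / \<nu>)"
      using x \<nu> B2(1) E0 by (intro mult_left_mono divide_right_mono powr_mono2) auto
    finally have 1: "\<bar>integral {x..b} (\<lambda>s. (s - x) powr (\<nu> - 1) * K x s * e s)\<bar> \<le> (B2 * E) * (b powr \<nu> / \<nu>)"
      by (simp add: mult.assoc)
    have 2: "\<bar>a x * e x\<bar> \<le> B1 * E" unfolding abs_mult using B1(2)[OF x] E x by (intro mult_mono') auto
    show ?thesis using 1 2 unfolding vide_op_def by (simp add: algebra_simps)
  qed
  then show ?thesis using B1(1) B2(1) \<nu> by (intro exI[of _ "B1 + B2 * (b powr \<nu> / \<nu>)"]) auto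
qed

text \<open>
  Any constant that bounds \<open>vide_op\<close> would do; one is chosen to be able to name the mesh size from
  which on the scheme is stable.
\<close>

definition op_bound :: real where
  "op_bound = (SOME A. 0 \<le> A \<and> (\<forall>e E. \<forall>x\<in>{0..b}. continuous_on {0..b} e \<longrightarrow>
     (\<forall>y\<in>{x..b}. \<bar>e y\<bar> \<le> E) \<longrightarrow> \<bar>vide_op e x\<bar> \<le> A * E))"

lemma op_bound_nonneg: "0 \<le> op_bound"
  and vide_op_bound: "x \<in> {0..b} \<Longrightarrow> continuous_on {0..b} e \<Longrightarrow> (\<And>y. y \<in> {x..b} \<Longrightarrow> \<bar>e y\<bar> \<le> E) \<Longrightarrow>
    \<bar>vide_op e x\<bar> \<le> op_bound * E"
  using someI_ex[OF vide_op_bound_ex] unfolding op_bound_def by blast+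

definition growth :: real where "growth = op_bound * lebesgue_bound n \<xi>"

definition stability_const :: real where "stability_const = exp (2 * growth * b)"

text \<open>
  By the bound \<open>b * q / M\<close> for the step size, this is the smallness condition of the Gronwall
  inequality.
\<close>

definition sufficiently_fine :: "nat \<Rightarrow> bool" where "sufficiently_fine M \<longleftrightarrow> M \<ge> 1 \<and> growth * (b * q / real M) \<le> 1 / 2"

lemma growth_nonneg: "0 \<le> growth"
  unfolding growth_def by (intro mult_nonneg_nonneg op_bound_nonneg lebesgue_bound_nonneg)

lemma stability_const_pos: "0 < stability_const" by (simp add: stability_const_def)

lemma eventually_sufficiently_fine: "\<exists>M0\<ge>1. \<forall>M>M0. sufficiently_fine M"
proof (intro exI conjI allI impI)
  let ?M0 = "max 1 (nat \<lceil>2 * growth * b * q\<rceil>)"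
  show "1 \<le> ?M0" by simp
  fix M assume M: "?M0 < M"
  then have "2 * growth * b * q \<le> real M" "M \<ge> 1" by linarith+
  then show "sufficiently_fine M" unfolding sufficiently_fine_def by (simp add: field_simps)
qed

lemma piece_continuous:
  assumes "j \<in> {1..M}"
  shows "continuous_on (cell M j) (piece M y j)"
proof -
  have "X M j \<le> b" using X_in[of j M] assms by simp
  then show ?thesis
    by (intro continuous_on_compose2[OF interpolant_continuous] continuous_on_subset[OF local_coord_continuous]) auto
qed

text \<open>
  The form of the error equation shared by the uniqueness proof (\<open>r = 0\<close>) and the error estimate, in
  which \<open>r\<close> is the interpolation error of \<open>\<psi>\<close> and \<open>\<Theta>\<close> are the errors at the collocation points.
\<close>

lemma stability:
  fixes e :: "real \<Rightarrow> real" and r :: "nat \<Rightarrow> real \<Rightarrow> real" and \<Theta> :: "nat \<Rightarrow> nat \<Rightarrow> real"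
  assumes M: "sufficiently_fine M" and eb: "e b = 0"
    and r: "\<And>j. j \<in> {1..M} \<Longrightarrow> continuous_on (cell M j) (r j)"
    and rep: "\<And>j x. j \<in> {1..M} \<Longrightarrow> x \<in> cell M j \<Longrightarrow>
       e x = e (X M j) - integral {x..X M j} (r j) - integral {x..X M j} (piece M (\<Theta> j) j)"
    and \<Theta>: "\<And>j l. j \<in> {1..M} \<Longrightarrow> l \<in> {1..n} \<Longrightarrow> \<Theta> j l = vide_op e (coll M j l)"
    and R: "0 \<le> R" "\<And>j x. j \<in> {1..M} \<Longrightarrow> x \<in> cell M j \<Longrightarrow>
       \<bar>integral {x..X M j} (r j) + (\<Sum>k\<in>{j<..M}. integral (cell M k) (r k))\<bar> \<le> R"
  shows "continuous_on {0..b} e"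
    and "x \<in> {0..b} \<Longrightarrow> \<bar>e x\<bar> \<le> R * stability_const"
    and "j \<in> {1..M} \<Longrightarrow> l \<in> {1..n} \<Longrightarrow> \<bar>\<Theta> j l\<bar> \<le> op_bound * (R * stability_const)"
proof -
  have M1: "M \<ge> 1" using M by (simp add: sufficiently_fine_def)
  let ?s = "\<lambda>j x. piece M (\<Theta> j) j x"
  have X: "X M (j - 1) \<le> X M j" if "j \<in> {1..M}" for j using X_step[OF that] by simp
  have ends: "X M 0 = 0" "X M M = b" using X_0[OF M1] X_M by auto
  have "continuous_on {X M 0..X M M} e"
  proof (rule piecewise_antiderivative_continuous[where X="X M" and s="\<lambda>j x. r j x + ?s j x"])
    fix j assume j: "j \<in> {1..M}"
    show "X M (j - 1) \<le> X M j" by (rule X[OF j])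
    show "continuous_on (cell M j) (\<lambda>x. r j x + ?s j x)"
      by (intro continuous_on_add r piece_continuous j)
    fix x assume x: "x \<in> cell M j"
    have "r j integrable_on {x..X M j}" "?s j integrable_on {x..X M j}"
      using x by (auto intro!: integrable_continuous_real continuous_on_subset[OF r[OF j]]
          continuous_on_subset[OF piece_continuous[OF j]])
    then show "e x = e (X M j) - integral {x..X M j} (\<lambda>x. r j x + ?s j x)"
      using rep[OF j x] by (simp add: integral_add)
  qed
  then show ce: "continuous_on {0..b} e" by (simp add: ends)
  have bnd: "\<bar>e x\<bar> \<le> R * stability_const" if x: "x \<in> {0..b}" for x
  proof -
    have "\<bar>e x\<bar> \<le> R * exp (2 * growth * (X M M - X M 0))"
    proof (rule backward_gronwall[where X="X M" and r=r and s="?s" and M=M and e=e and R=R and B=growth and x=x])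
      fix j x assume j: "j \<in> {1..M}" and x: "x \<in> cell M j"
      show "e x = e (X M j) - integral {x..X M j} (r j) - integral {x..X M j} (?s j)" by (rule rep[OF j x])
      show "\<bar>integral {x..X M j} (r j) + (\<Sum>k\<in>{j<..M}. integral (cell M k) (r k))\<bar> \<le> R"
        by (rule R(2)[OF j x])
      fix E assume E: "\<forall>y\<in>{X M (j - 1)..X M M}. \<bar>e y\<bar> \<le> E"
      have "\<bar>\<Theta> j l\<bar> \<le> op_bound * E" if l: "l \<in> {1..n}" for l
        unfolding \<Theta>[OF j l]
        by (rule vide_op_bound[OF coll_point_in_domain[OF j l] ce]) (use E coll_point_in[OF j l] ends in auto)
      then show "\<bar>?s j x\<bar> \<le> growth * E"
        using interpolant_bound[OF local_coord_in[OF j x], of "\<Theta> j" "op_bound * E"]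
        by (simp add: growth_def mult_ac)
    next
      fix j assume j: "j \<in> {1..M}"
      show "X M (j - 1) \<le> X M j" by (rule X[OF j])
      show "continuous_on (cell M j) (?s j)" by (rule piece_continuous[OF j])
      have "growth * (X M j - X M (j - 1)) \<le> growth * (b * q / real M)"
        by (intro mult_left_mono X_step_le_inverse j growth_nonneg)
      also have "\<dots> \<le> 1/2" using M unfolding sufficiently_fine_def by blast
      finally show "growth * (X M j - X M (j - 1)) \<le> 1/2" .
    qed (use ce ends eb R(1) growth_nonneg x in auto)
    then show ?thesis by (simp add: ends stability_const_def)
  qed
  show "x \<in> {0..b} \<Longrightarrow> \<bar>e x\<bar> \<le> R * stability_const" by (rule bnd)
  assume j: "j \<in> {1..M}" and l: "l \<in> {1..n}"
  show "\<bar>\<Theta> j l\<bar> \<le> op_bound * (R * stability_const)"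
    unfolding \<Theta>[OF j l]
    by (rule vide_op_bound[OF coll_point_in_domain[OF j l] ce], rule bnd)
      (use coll_point_in_domain[OF j l] in auto)
qed

lemma stability_homogeneous:
  assumes M: "sufficiently_fine M" and eb: "e b = 0"
    and rep: "\<And>j x. j \<in> {1..M} \<Longrightarrow> x \<in> cell M j \<Longrightarrow>
       e x = e (X M j) - integral {x..X M j} (piece M (\<Theta> j) j)"
    and \<Theta>: "\<And>j l. j \<in> {1..M} \<Longrightarrow> l \<in> {1..n} \<Longrightarrow> \<Theta> j l = vide_op e (coll M j l)"
    and jl: "j \<in> {1..M}" "l \<in> {1..n}"
  shows "\<Theta> j l = 0"
proof -
  have "\<bar>\<Theta> j l\<bar> \<le> op_bound * (0 * stability_const)"
    by (rule stability(3)[where e=e and r="\<lambda>_ _. 0", OF M eb]) (use rep \<Theta> jl in \<open>simp_all del: atLeastAtMost_iff\<close>)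
  then show ?thesis by simp
qed

text \<open>
  The integral of \<open>\<psi>h\<close> over part of an interval is that of the piece on this interval: at the left
  end point, where the neighbouring piece may be in force, the two differ on a null set.
\<close>

lemma collocation_approxD:
  assumes C: "collocation_approx b \<nu> \<mu> q n \<xi> a g K \<phi>b M Y \<psi>h \<phi>h" and M: "M \<ge> 1"
  shows "\<phi>h b = \<phi>b"
    and "j \<in> {1..M} \<Longrightarrow> x \<in> {X M (j - 1)<..X M j} \<Longrightarrow> \<psi>h x = piece M (Y j) j x"
    and "\<psi>h 0 = piece M (Y 1) 1 0"
    and "j \<in> {1..M} \<Longrightarrow> x \<in> cell M j \<Longrightarrow>
      \<phi>h x = \<phi>h (X M j) - integral {x..X M j} (piece M (Y j) j)"
    and "j \<in> {1..M} \<Longrightarrow> l \<in> {1..n} \<Longrightarrow>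
      Y j l = vide_op \<phi>h (coll M j l) + g (coll M j l)"
    and "continuous_on {0..b} \<phi>h"
proof -
  show "\<phi>h b = \<phi>b" using C unfolding collocation_approx_def by blast
  have p: "\<psi>h x = piece M (Y j) j x"
    if j: "j \<in> {1..M}" and x: "x \<in> {X M (j - 1)<..X M j}" for j x
    using C j x unfolding collocation_approx_def psi_piece_eq[OF j, symmetric] by blast
  show "j \<in> {1..M} \<Longrightarrow> x \<in> {X M (j - 1)<..X M j} \<Longrightarrow> \<psi>h x = piece M (Y j) j x"
    by (rule p)
  have "1 \<in> {1..M}" using M by simp
  from psi_piece_eq[OF this] show "\<psi>h 0 = piece M (Y 1) 1 0"
    using C unfolding collocation_approx_def by metis
  have i: "\<phi>h x = \<phi>h (X M j) - integral {x..X M j} (piece M (Y j) j)"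
    if j: "j \<in> {1..M}" and x: "x \<in> cell M j" for j x
  proof -
    have "\<phi>h x = \<phi>h (X M j) - integral {x..X M j} \<psi>h"
      using C j x unfolding collocation_approx_def by blast
    moreover have "integral {x..X M j} \<psi>h = integral {x..X M j} (piece M (Y j) j)"
      by (rule integral_spike[of "{x}"]) (use p[OF j] x in auto)
    ultimately show ?thesis by simp
  qed
  show "j \<in> {1..M} \<Longrightarrow> x \<in> cell M j \<Longrightarrow>
      \<phi>h x = \<phi>h (X M j) - integral {x..X M j} (piece M (Y j) j)"
    by (rule i)
  show "j \<in> {1..M} \<Longrightarrow> l \<in> {1..n} \<Longrightarrow>
      Y j l = vide_op \<phi>h (coll M j l) + g (coll M j l)"
    using C unfolding collocation_approx_def vide_op_def Let_def by fastforce
  have "continuous_on {X M 0..X M M} \<phi>h"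
    by (rule piecewise_antiderivative_continuous[where X="X M", OF _ _ i])
      (use X_step piece_continuous in \<open>auto intro: less_imp_le simp del: atLeastAtMost_iff\<close>)
  then show "continuous_on {0..b} \<phi>h" using X_0[OF M] X_M by simp
qed

definition piece_index :: "nat \<Rightarrow> real \<Rightarrow> nat" where
  "piece_index M x = (LEAST j. 1 \<le> j \<and> x \<le> X M j)"

lemma piece_index_eq:
  assumes j: "j \<in> {1..M}" and x: "x \<in> {X M (j - 1)<..X M j}"
  shows "piece_index M x = j"
  unfolding piece_index_def
proof (rule Least_equality)
  show "1 \<le> j \<and> x \<le> X M j" using j x by auto
  fix k assume k: "1 \<le> k \<and> x \<le> X M k"
  show "j \<le> k"
  proof (rule ccontr)
    assume "\<not> j \<le> k"
    then have "X M k \<le> X M (j - 1)" using j k by (intro X_le) auto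
    then show False using k x by auto
  qed
qed

lemma piece_index_0: "M \<ge> 1 \<Longrightarrow> piece_index M 0 = 1"
  unfolding piece_index_def
  by (rule Least_equality) (use X_in[of 1 M] in auto)

text \<open>
  The function \<open>\<phi>h\<close> that belongs to prescribed coefficients and the value 0 at \<open>b\<close>; it is linear in
  the coefficients.
\<close>

definition antiderivative :: "nat \<Rightarrow> (nat \<Rightarrow> nat \<Rightarrow> real) \<Rightarrow> real \<Rightarrow> real" where
  "antiderivative M Y x = (let j = piece_index M x in
     - integral {x..X M j} (piece M (Y j) j)
     - (\<Sum>k\<in>{j<..M}. integral (cell M k) (piece M (Y k) k)))"

text \<open>
  At the left end point of an interval \<open>piece_index\<close> selects the preceding interval, if there is one;
  the formula holds nevertheless, as the integral over the whole interval merely moves into the sum.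
\<close>

lemma antiderivative_on_piece:
  assumes j: "j \<in> {1..M}" and x: "x \<in> cell M j"
  shows "antiderivative M Y x =
     - integral {x..X M j} (piece M (Y j) j)
     - (\<Sum>k\<in>{j<..M}. integral (cell M k) (piece M (Y k) k))"
proof (cases "x = X M (j - 1)")
  case False
  then have "piece_index M x = j" using x by (intro piece_index_eq[OF j]) auto
  then show ?thesis by (simp add: antiderivative_def)
next
  case True
  show ?thesis
  proof (cases "j = 1")
    case j1: True
    then have "piece_index M x = j" using True j X_0[of M] piece_index_0[of M] by simp
    then show ?thesis by (simp add: antiderivative_def)
  next
    case False
    have j': "j - 1 \<in> {1..M}" using j False by auto
    have "piece_index M x = j - 1" using True X_step[OF j'] by (intro piece_index_eq[OF j']) auto
    moreover have "{j - 1<..M} = insert j {j<..M}" using j by auto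
    ultimately show ?thesis using True by (simp add: antiderivative_def)
  qed
qed

lemma antiderivative_step:
  assumes j: "j \<in> {1..M}" and x: "x \<in> cell M j"
  shows "antiderivative M Y x = antiderivative M Y (X M j)
      - integral {x..X M j} (piece M (Y j) j)"
proof -
  have "X M j \<in> cell M j" using X_step[OF j] by simp
  from antiderivative_on_piece[OF j x] antiderivative_on_piece[OF j this] show ?thesis by simp
qed

lemma antiderivative_b: "M \<ge> 1 \<Longrightarrow> antiderivative M Y b = 0"
  using antiderivative_on_piece[of M M b Y] X_step[of M M] X_M[of M] by simp

lemma antiderivative_continuous:
  assumes M: "M \<ge> 1" shows "continuous_on {0..b} (antiderivative M Y)"
proof -
  have "continuous_on {X M 0..X M M} (antiderivative M Y)"
  proof (rule piecewise_antiderivative_continuous[where X="X M" and s="\<lambda>j s. piece M (Y j) j s"])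
    fix j assume j: "j \<in> {1..M}"
    show "X M (j - 1) \<le> X M j" using X_step[OF j] by simp
    show "continuous_on (cell M j) (piece M (Y j) j)"
      by (rule piece_continuous[OF j])
  qed (rule antiderivative_step)
  then show ?thesis using X_0[OF M] X_M by simp
qed

lemma piece_integrable:
  assumes j: "j \<in> {1..M}" and x: "x \<in> cell M j"
  shows "(piece M y j) integrable_on {x..X M j}"
  using x by (intro integrable_continuous_real continuous_on_subset[OF piece_continuous[OF j]]) auto

lemma mesh_interval_exists:
  assumes "M \<ge> 1" "x \<in> {0..b}"
  obtains j where "j \<in> {1..M}" "x \<in> cell M j"
proof -
  have "m \<le> M \<Longrightarrow> 1 \<le> m \<Longrightarrow> x \<in> {X M 0..X M m} \<Longrightarrow> \<exists>j\<in>{1..m}. x \<in> cell M j" for m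
  proof (induction m)
    case (Suc m)
    show ?case
    proof (cases "m \<ge> 1 \<and> x \<le> X M m")
      case True
      then show ?thesis using Suc by fastforce
    next
      case False
      then have "x \<in> {X M (Suc m - 1)..X M (Suc m)}" using Suc.prems by (cases "m = 0") auto
      then show ?thesis using Suc.prems by (intro bexI[of _ "Suc m"]) auto
    qed
  qed simp
  from this[of M] show thesis using assms X_0[of M] X_M[of M] that by auto
qed

lemma antiderivative_add:
  assumes M: "M \<ge> 1" and x: "x \<in> {0..b}"
  shows "antiderivative M (\<lambda>j l. Y j l + Y' j l) x = antiderivative M Y x + antiderivative M Y' x"
proof -
  obtain j where j: "j \<in> {1..M}" "x \<in> cell M j" using mesh_interval_exists[OF M x] by blast
  have 1: "integral {x..X M j} (piece M (\<lambda>l. Y j l + Y' j l) j)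
    = integral {x..X M j} (piece M (Y j) j)
    + integral {x..X M j} (piece M (Y' j) j)"
    unfolding interpolant_add by (intro integral_add piece_integrable j)
  have 2: "(\<Sum>k\<in>{j<..M}. integral (cell M k) (piece M (\<lambda>l. Y k l + Y' k l) k))
    = (\<Sum>k\<in>{j<..M}. integral (cell M k) (piece M (Y k) k)
       + integral (cell M k) (piece M (Y' k) k))"
  proof (intro sum.cong refl)
    fix k assume "k \<in> {j<..M}"
    then have k: "k \<in> {1..M}" by auto
    then have k': "X M (k - 1) \<in> cell M k" using X_step[OF k] by simp
    show "integral (cell M k) (piece M (\<lambda>l. Y k l + Y' k l) k)
     = integral (cell M k) (piece M (Y k) k)
       + integral (cell M k) (piece M (Y' k) k)"
      unfolding interpolant_add by (intro integral_add piece_integrable k k')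
  qed
  show ?thesis unfolding antiderivative_on_piece[OF j] 1 2 by (simp add: sum.distrib)
qed

lemma interpolant_scale: "interpolant n \<xi> (\<lambda>l. c * y l) z = c * interpolant n \<xi> y z"
  by (simp add: interpolant_def sum_distrib_left mult.assoc)

lemma antiderivative_scale:
  assumes M: "M \<ge> 1" and x: "x \<in> {0..b}"
  shows "antiderivative M (\<lambda>j l. c * Y j l) x = c * antiderivative M Y x"
proof -
  obtain j where j: "j \<in> {1..M}" "x \<in> cell M j" using mesh_interval_exists[OF M x] by blast
  show ?thesis unfolding antiderivative_on_piece[OF j] interpolant_scale
    by (simp add: sum_distrib_left right_diff_distrib)
qed

lemma vide_op_cong: "(\<And>s. s \<in> {x..b} \<Longrightarrow> e s = f s) \<Longrightarrow> x \<le> b \<Longrightarrow> vide_op e x = vide_op f x"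
  unfolding vide_op_def by (auto intro!: integral_cong)

text \<open>
  The collocation equations form a square linear system for the coefficients, whose homogeneous version
  has only the trivial solution by stability.
\<close>

lemma collocation_exists:
  assumes M: "sufficiently_fine M"
  shows "\<exists>Y \<psi>h \<phi>h. collocation_approx b \<nu> \<mu> q n \<xi> a g K \<phi>b M Y \<psi>h \<phi>h"
proof -
  have M1: "M \<ge> 1" using M by (simp add: sufficiently_fine_def)
  let ?I = "{1..M} \<times> {1..n}"
  let ?x = "\<lambda>j l. coll M j l"
  define T where "T y i = (case i of (j, l) \<Rightarrow> y (j, l) - vide_op (antiderivative M (\<lambda>j l. y (j, l))) (?x j l))" for y i
  define rhs where "rhs i = (case i of (j, l) \<Rightarrow> vide_op (\<lambda>_. \<phi>b) (?x j l) + g (?x j l))" for i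
  note ac = antiderivative_continuous[OF M1]
  have "\<exists>y. \<forall>i\<in>?I. T y i = rhs i"
  proof (rule linear_injective_imp_surjective_on)
    fix y y' :: "nat \<times> nat \<Rightarrow> real" and i assume i: "i \<in> ?I"
    obtain j l where jl: "i = (j, l)" "j \<in> {1..M}" "l \<in> {1..n}" using i by auto
    note x = coll_point_in_domain[OF jl(2,3)]
    have "vide_op (antiderivative M (\<lambda>j l. y (j, l) + y' (j, l))) (?x j l)
        = vide_op (\<lambda>s. antiderivative M (\<lambda>j l. y (j, l)) s + antiderivative M (\<lambda>j l. y' (j, l)) s) (?x j l)"
      by (rule vide_op_cong) (use x in \<open>auto intro!: antiderivative_add[OF M1]\<close>)
    then show "T (\<lambda>i. y i + y' i) i = T y i + T y' i"
      unfolding T_def jl(1) by (simp add: vide_op_add[OF x ac ac])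
  next
    fix r and y :: "nat \<times> nat \<Rightarrow> real" and i assume i: "i \<in> ?I"
    obtain j l where jl: "i = (j, l)" "j \<in> {1..M}" "l \<in> {1..n}" using i by auto
    note x = coll_point_in_domain[OF jl(2,3)]
    have "vide_op (antiderivative M (\<lambda>j l. r * y (j, l))) (?x j l)
        = vide_op (\<lambda>s. r * antiderivative M (\<lambda>j l. y (j, l)) s) (?x j l)"
      by (rule vide_op_cong) (use x in \<open>auto intro!: antiderivative_scale[OF M1]\<close>)
    then show "T (\<lambda>i. r * y i) i = r * T y i"
      unfolding T_def jl(1) by (simp add: vide_op_scale right_diff_distrib)
  next
    fix y :: "nat \<times> nat \<Rightarrow> real" assume 0: "\<forall>i\<in>?I. T y i = 0"
    have "y (j, l) = 0" if jl: "j \<in> {1..M}" "l \<in> {1..n}" for j l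
    proof (rule stability_homogeneous[OF M antiderivative_b[OF M1] antiderivative_step _ jl, of "\<lambda>j l. y (j, l)"])
      fix j l assume "j \<in> {1..M}" "l \<in> {1..n}"
      then have "T y (j, l) = 0" using 0 by blast
      then show "y (j, l) = vide_op (antiderivative M (\<lambda>j l. y (j, l))) (?x j l)" by (simp add: T_def)
    qed
    then show "\<forall>i\<in>?I. y i = 0" by auto
  qed simp
  then obtain y where y: "\<forall>i\<in>?I. T y i = rhs i" by blast
  define Y where "Y j l = y (j, l)" for j l
  define \<psi>h where "\<psi>h x = psi_piece b \<mu> q n \<xi> M Y (piece_index M x) x" for x
  define \<phi>h where "\<phi>h x = \<phi>b + antiderivative M Y x" for x
  have "collocation_approx b \<nu> \<mu> q n \<xi> a g K \<phi>b M Y \<psi>h \<phi>h"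
    unfolding collocation_approx_def
  proof (intro conjI ballI)
    fix j x assume j: "j \<in> {1..M}" and x: "x \<in> {X M (j - 1)<..X M j}"
    show "\<psi>h x = psi_piece b \<mu> q n \<xi> M Y j x" by (simp add: \<psi>h_def piece_index_eq[OF j x])
  next
    show "\<psi>h 0 = psi_piece b \<mu> q n \<xi> M Y 1 0" by (simp add: \<psi>h_def piece_index_0[OF M1])
    show "\<phi>h b = \<phi>b" by (simp add: \<phi>h_def antiderivative_b[OF M1])
  next
    fix j x assume j: "j \<in> {1..M}" and x: "x \<in> cell M j"
    have "integral {x..X M j} \<psi>h = integral {x..X M j} (piece M (Y j) j)"
    proof (rule integral_spike[of "{x}"])
      fix s assume s: "s \<in> {x..X M j} - {x}"
      then have "s \<in> {X M (j - 1)<..X M j}" using x by auto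
      from piece_index_eq[OF j this] show "piece M (Y j) j s = \<psi>h s"
        by (simp add: \<psi>h_def psi_piece_eq[OF j])
    qed simp
    then show "\<phi>h x = \<phi>h (X M j) - integral {x..X M j} \<psi>h"
      using antiderivative_step[OF j x, of Y] by (simp add: \<phi>h_def)
  next
    fix j l assume jl: "j \<in> {1..M}" "l \<in> {1..n}"
    have "Y j l = vide_op (antiderivative M Y) (?x j l) + (vide_op (\<lambda>_. \<phi>b) (?x j l) + g (?x j l))"
      using y[rule_format, of "(j, l)"] jl by (simp add: T_def rhs_def Y_def[abs_def])
    moreover have "vide_op \<phi>h (?x j l) = vide_op (\<lambda>_. \<phi>b) (?x j l) + vide_op (antiderivative M Y) (?x j l)"
      unfolding \<phi>h_def[abs_def] by (intro vide_op_add coll_point_in_domain jl ac continuous_on_const)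
    ultimately have "Y j l = vide_op \<phi>h (?x j l) + g (?x j l)" by simp
    then show "let x = ?x j l in Y j l = a x * \<phi>h x + g x + integral {x..b} (\<lambda>s. (s - x) powr (\<nu> - 1) * K x s * \<phi>h s)"
      by (simp add: vide_op_def Let_def)
  qed
  then show ?thesis by blast
qed

lemma collocation_well_posed_if_sufficiently_fine:
  assumes M: "sufficiently_fine M"
  shows "collocation_well_posed b \<nu> \<mu> q n \<xi> a g K \<phi>b M"
  unfolding collocation_well_posed_def
proof (intro conjI allI impI ballI, rule collocation_exists[OF M], elim conjE)
  have M1: "M \<ge> 1" using M by (simp add: sufficiently_fine_def)
  fix Y \<psi>h \<phi>h Y' \<psi>h' \<phi>h' j l
  assume C: "collocation_approx b \<nu> \<mu> q n \<xi> a g K \<phi>b M Y \<psi>h \<phi>h"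
    and C': "collocation_approx b \<nu> \<mu> q n \<xi> a g K \<phi>b M Y' \<psi>h' \<phi>h'"
    and jl: "j \<in> {1..M}" "l \<in> {1..n}"
  note D = collocation_approxD[OF C M1] and D' = collocation_approxD[OF C' M1]
  have "(\<lambda>j l. Y j l - Y' j l) j l = 0"
  proof (rule stability_homogeneous[OF M, where e="\<lambda>x. \<phi>h x - \<phi>h' x"])
    show "\<phi>h b - \<phi>h' b = 0" using D(1) D'(1) by simp
    fix j assume j: "j \<in> {1..M}"
    {
      fix x assume x: "x \<in> cell M j"
      have "integral {x..X M j} (piece M (\<lambda>l. Y j l - Y' j l) j)
        = integral {x..X M j} (piece M (Y j) j)
        - integral {x..X M j} (piece M (Y' j) j)"
        unfolding interpolant_diff by (intro integral_diff piece_integrable j x)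
      then show "\<phi>h x - \<phi>h' x = \<phi>h (X M j) - \<phi>h' (X M j)
          - integral {x..X M j} (piece M (\<lambda>l. Y j l - Y' j l) j)"
        using D(4)[OF j x] D'(4)[OF j x] by simp
    next
      fix l assume l: "l \<in> {1..n}"
      show "Y j l - Y' j l = vide_op (\<lambda>x. \<phi>h x - \<phi>h' x) (coll M j l)"
        using D(5)[OF j l] D'(5)[OF j l] vide_op_diff[OF coll_point_in_domain[OF j l] D(6) D'(6)] by simp
    }
  qed (use jl in auto)
  then show "Y j l = Y' j l" by simp
qed

definition interp_error :: "(real \<Rightarrow> real) \<Rightarrow> nat \<Rightarrow> nat \<Rightarrow> real \<Rightarrow> real" where
  "interp_error f M j x = f x - piece M (\<lambda>l. f (coll M j l)) j x"

text \<open>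
  For \<open>x\<close> in the \<open>j\<close>-th interval this is the integral of the interpolation error from \<open>x\<close> to \<open>b\<close>.
\<close>

abbreviation accumulated_error :: "(real \<Rightarrow> real) \<Rightarrow> nat \<Rightarrow> nat \<Rightarrow> real \<Rightarrow> real" where
  "accumulated_error f M j x \<equiv> integral {x..X M j} (interp_error f M j)
     + (\<Sum>k\<in>{j<..M}. integral (cell M k) (interp_error f M k))"

text \<open>
  On each interval \<open>\<psi> - \<psi>h\<close> is the interpolation error of \<open>\<psi>\<close> plus the interpolant of the errors at
  the collocation points, and the latter are \<open>vide_op (\<phi> - \<phi>h)\<close> because \<open>g\<close> cancels.
\<close>

lemma collocation_error:
  assumes M: "sufficiently_fine M" and sol: "vide_solution b \<nu> a g K \<phi>b \<phi> \<psi>" and \<psi>c: "continuous_on {0..b} \<psi>"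
    and C: "collocation_approx b \<nu> \<mu> q n \<xi> a g K \<phi>b M Y \<psi>h \<phi>h"
    and R: "0 \<le> R" "\<And>j x. j \<in> {1..M} \<Longrightarrow> x \<in> cell M j \<Longrightarrow>
       \<bar>accumulated_error \<psi> M j x\<bar> \<le> R"
  shows "continuous_on {0..b} (\<lambda>x. \<phi> x - \<phi>h x)"
    and "x \<in> {0..b} \<Longrightarrow> \<bar>\<phi> x - \<phi>h x\<bar> \<le> R * stability_const"
    and "j \<in> {1..M} \<Longrightarrow> l \<in> {1..n} \<Longrightarrow> \<bar>\<psi> (coll M j l) - Y j l\<bar> \<le> op_bound * (R * stability_const)"
    and "j \<in> {1..M} \<Longrightarrow> x \<in> cell M j \<Longrightarrow>
      \<bar>\<psi> x - piece M (Y j) j x\<bar> \<le> \<bar>interp_error \<psi> M j x\<bar> + growth * (R * stability_const)"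
proof -
  have M1: "M \<ge> 1" using M by (simp add: sufficiently_fine_def)
  note D = collocation_approxD[OF C M1]
  have \<phi>d: "(\<phi> has_real_derivative \<psi> x) (at x within {0..b})" if "x \<in> {0..b}" for x
    using sol that unfolding vide_solution_def by blast
  have \<phi>c: "continuous_on {0..b} \<phi>" using \<phi>d by (meson DERIV_continuous_on)
  let ?\<Theta> = "\<lambda>j l. \<psi> (coll M j l) - Y j l"
  have sub: "cell M j \<subseteq> {0..b}" if "j \<in> {1..M}" for j using X_interval[OF that] by blast
  have rc: "continuous_on (cell M j) (interp_error \<psi> M j)" if j: "j \<in> {1..M}" for j
    unfolding interp_error_def[abs_def]
    by (intro continuous_on_diff continuous_on_subset[OF \<psi>c sub[OF j]] piece_continuous j)
  have split: "\<psi> x - piece M (Y j) j x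
      = interp_error \<psi> M j x + piece M (?\<Theta> j) j x" for j x
    by (simp add: interp_error_def interpolant_diff)
  have rep: "\<phi> x - \<phi>h x = \<phi> (X M j) - \<phi>h (X M j) - integral {x..X M j} (interp_error \<psi> M j)
      - integral {x..X M j} (piece M (?\<Theta> j) j)"
    if j: "j \<in> {1..M}" and x: "x \<in> cell M j" for j x
  proof -
    have xs: "{x..X M j} \<subseteq> {0..b}" using sub[OF j] x by auto
    have "(\<psi> has_integral (\<phi> (X M j) - \<phi> x)) {x..X M j}"
    proof (rule fundamental_theorem_of_calculus)
      fix s assume s: "s \<in> {x..X M j}"
      then have "s \<in> {0..b}" using xs by blast
      from DERIV_subset[OF \<phi>d[OF this] xs] show "(\<phi> has_vector_derivative \<psi> s) (at s within {x..X M j})"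
        by (simp add: has_real_derivative_iff_has_vector_derivative)
    qed (use x in auto)
    then have 1: "integral {x..X M j} \<psi> = \<phi> (X M j) - \<phi> x" "\<psi> integrable_on {x..X M j}" by (auto simp: integral_unique)
    have "interp_error \<psi> M j integrable_on {x..X M j}"
      using x by (intro integrable_continuous_real continuous_on_subset[OF rc[OF j]]) auto
    from integral_add[OF this piece_integrable[OF j x]]
    have "integral {x..X M j} (interp_error \<psi> M j) + integral {x..X M j} (piece M (?\<Theta> j) j)
        = integral {x..X M j} (\<lambda>x. \<psi> x - piece M (Y j) j x)"
      unfolding split by simp
    also have "\<dots> = \<phi> (X M j) - \<phi> x - integral {x..X M j} (piece M (Y j) j)"
      using integral_diff[OF 1(2) piece_integrable[OF j x, of "Y j"]] 1(1) by simp
    finally show ?thesis using D(4)[OF j x] by simp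
  qed
  have \<Theta>: "?\<Theta> j l = vide_op (\<lambda>x. \<phi> x - \<phi>h x) (coll M j l)" if j: "j \<in> {1..M}" and l: "l \<in> {1..n}" for j l
  proof -
    note x = coll_point_in_domain[OF j l]
    have "\<psi> (coll M j l) = vide_op \<phi> (coll M j l) + g (coll M j l)"
      using sol x unfolding vide_solution_def vide_op_def by simp
    then show ?thesis using D(5)[OF j l] vide_op_diff[OF x \<phi>c D(6)] by simp
  qed
  have eb: "\<phi> b - \<phi>h b = 0" using sol D(1) unfolding vide_solution_def by simp
  note st = stability[where e="\<lambda>x. \<phi> x - \<phi>h x" and r="interp_error \<psi> M" and \<Theta>="?\<Theta>", OF M eb rc rep \<Theta> R]
  show "continuous_on {0..b} (\<lambda>x. \<phi> x - \<phi>h x)" by (rule st(1))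
  show "x \<in> {0..b} \<Longrightarrow> \<bar>\<phi> x - \<phi>h x\<bar> \<le> R * stability_const" by (rule st(2))
  have \<Theta>b: "j \<in> {1..M} \<Longrightarrow> l \<in> {1..n} \<Longrightarrow> \<bar>?\<Theta> j l\<bar> \<le> op_bound * (R * stability_const)" for j l by (rule st(3))
  then show "j \<in> {1..M} \<Longrightarrow> l \<in> {1..n} \<Longrightarrow> \<bar>?\<Theta> j l\<bar> \<le> op_bound * (R * stability_const)" .
  assume j: "j \<in> {1..M}" and x: "x \<in> cell M j"
  have "\<bar>piece M (?\<Theta> j) j x\<bar> \<le> op_bound * (R * stability_const) * lebesgue_bound n \<xi>"
    by (rule interpolant_bound[OF local_coord_in[OF j x] \<Theta>b[OF j]])
  then show "\<bar>\<psi> x - piece M (Y j) j x\<bar> \<le> \<bar>interp_error \<psi> M j x\<bar> + growth * (R * stability_const)"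
    unfolding split growth_def by (simp add: mult_ac)
qed

end

section \<open>Sums over the graded mesh\<close>

text \<open>
  The size of all local quantities on the \<open>i\<close>-th interval from \<open>b\<close>: its length has \<open>r = q\<close>, \<open>k = 1\<close>,
  and each order of interpolation raises \<open>k\<close> by one.
\<close>

definition mesh_weight :: "real \<Rightarrow> nat \<Rightarrow> nat \<Rightarrow> nat \<Rightarrow> real" where
  "mesh_weight r k M i = (real i / real M) powr r / real i ^ k"

lemma mesh_weight_nonneg: "0 \<le> mesh_weight r k M i"
  by (simp add: mesh_weight_def)

lemma mesh_weight_mult: "mesh_weight r k M i * mesh_weight r' k' M i = mesh_weight (r + r') (k + k') M i"
  by (simp add: mesh_weight_def powr_add power_add)

lemma mesh_weight_eq:
  assumes "i \<in> {1..M}"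
  shows "mesh_weight r k M i = real M powr (- r) * real i powr (r - real k)"
  using assms by (simp add: mesh_weight_def powr_divide powr_diff powr_realpow powr_minus field_simps)

lemma mesh_weight_le:
  assumes i: "i \<in> {1..M}" 
  shows "mesh_weight r k M i \<le> real M powr (- min r (real k))"
proof (cases "r \<ge> real k")
  case True
  have "real i powr (r - real k) \<le> real M powr (r - real k)" using i True by (intro powr_mono2) auto
  then have "mesh_weight r k M i \<le> real M powr (- r) * real M powr (r - real k)"
    unfolding mesh_weight_eq[OF i] by (rule mult_left_mono) simp
  moreover have "min r (real k) = real k" using True by simp
  ultimately show ?thesis by (simp add: powr_add[symmetric])
next
  case False
  have "real i powr (r - real k) \<le> real i powr 0" using i False by (intro powr_mono) auto
  then have "mesh_weight r k M i \<le> real M powr (- r) * 1"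
    unfolding mesh_weight_eq[OF i] using i by (intro mult_left_mono) auto
  then show ?thesis using False by (simp add: min_def)
qed

lemma powr_le_one_minus:
  fixes x d :: real
  assumes x: "0 \<le> x" "x \<le> 1" and d: "0 < d" "d \<le> 1"
  shows "(1 - x) powr d \<le> 1 - d * x"
proof (cases "x = 1")
  case False
  then have x1: "x < 1" using x by simp
  have "(\<lambda>y. 1 - d * y - (1 - y) powr d) 0 \<le> (\<lambda>y. 1 - d * y - (1 - y) powr d) x"
  proof (rule DERIV_nonneg_imp_nondecreasing[OF x(1)])
    fix y assume y: "0 \<le> y" "y \<le> x"
    have "((\<lambda>y. 1 - d * y - (1 - y) powr d) has_real_derivative d * ((1 - y) powr (d - 1) - 1)) (at y)"
      using y x1 by (auto intro!: derivative_eq_intros simp: powr_diff field_simps)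
    moreover have "(1 - y) powr (d - 1) \<ge> (1 - y) powr 0" using y x1 d by (intro powr_mono') auto
    then have "d * ((1 - y) powr (d - 1) - 1) \<ge> 0" using y x1 d by (intro mult_nonneg_nonneg) auto
    ultimately show "\<exists>D. ((\<lambda>y. 1 - d * y - (1 - y) powr d) has_real_derivative D) (at y) \<and> 0 \<le> D" by blast
  qed
  then show ?thesis by simp
qed (use d in simp)

text \<open>
  For \<open>d \<le> 1\<close> compare with the telescoping differences of \<open>i powr d\<close>; for \<open>d > 1\<close> the last summand is the
  largest.
\<close>

lemma sum_powr_le_positive:
  fixes d :: real assumes d: "0 < d"
  shows "\<exists>C\<ge>0. \<forall>M. (\<Sum>i=1..M. real i powr (d - 1)) \<le> C * real M powr d"
proof (cases "d \<le> 1")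
  case True
  have "(\<Sum>i=1..M. real i powr (d - 1)) \<le> (1 / d) * real M powr d" for M
  proof (induction M)
    case (Suc M)
    let ?i = "real (Suc M)"
    have "real M = ?i * (1 - 1 / ?i)" by (simp add: field_simps)
    then have "real M powr d = ?i powr d * (1 - 1 / ?i) powr d" by (metis powr_mult)
    also have "\<dots> \<le> ?i powr d * (1 - d * (1 / ?i))"
      using d True by (intro mult_left_mono powr_le_one_minus) auto
    also have "\<dots> = ?i powr d - d * ?i powr (d - 1)" by (simp add: powr_diff algebra_simps)
    finally have "?i powr (d - 1) \<le> (1 / d) * (?i powr d - real M powr d)"
      using d by (simp add: field_simps)
    then show ?case using Suc.IH by (simp add: algebra_simps)
  qed simp
  then show ?thesis using d by (intro exI[of _ "1 / d"]) auto
next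
  case False
  have "(\<Sum>i=1..M. real i powr (d - 1)) \<le> 1 * real M powr d" for M
  proof (cases "M = 0")
    case M: False
    have "(\<Sum>i=1..M. real i powr (d - 1)) \<le> (\<Sum>i=1..M. real M powr (d - 1))"
      using False by (intro sum_mono powr_mono2) auto
    then show ?thesis using M by (simp add: powr_diff)
  qed simp
  then show ?thesis by (intro exI[of _ 1]) auto
qed

lemma sum_inverse_le_ln: "M \<ge> 1 \<Longrightarrow> (\<Sum>i=1..M. 1 / real i) \<le> 1 + ln (real M)"
proof (induction M rule: dec_induct)
  case (step M)
  have "ln (real M / real (Suc M)) \<le> real M / real (Suc M) - 1"
    using step.hyps by (intro ln_le_minus_one) simp
  also have "\<dots> = - (1 / real (Suc M))" by (simp add: field_simps)
  finally have "1 / real (Suc M) \<le> ln (real (Suc M)) - ln (real M)"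
    using step.hyps by (simp add: ln_div)
  then show ?case using step.IH by simp
qed simp

lemma varpi_ge:
  assumes "M \<ge> 2" shows "real M powr (- min r s) \<le> (1 / ln 2) * varpi r s M" and "0 < varpi r s M"
proof -
  have l: "ln 2 \<le> ln (real M)" using assms by simp
  have l1: "(0::real) < ln 2" "ln (2::real) \<le> 1" using ln_2_less_1 by auto
  have p: "0 < real M powr (- min r s)" using assms by simp
  show "0 < varpi r s M" using p l l1 unfolding varpi_def by (auto intro: mult_pos_pos)
  have "real M powr (- min r s) * ln 2 \<le> varpi r s M"
  proof (cases "r = s")
    case True
    then show ?thesis unfolding varpi_def using l p by simp
  next
    case False
    then show ?thesis unfolding varpi_def using mult_left_mono[OF l1(2), of "real M powr (- min r s)"] by simp
  qed
  then show "real M powr (- min r s) \<le> (1 / ln 2) * varpi r s M" using l1 by (simp add: field_simps)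
qed

text \<open>
  The sum is \<open>M powr (- r)\<close> times the sum of \<open>i powr (r - N - 1)\<close>, which grows like
  \<open>M powr (r - N)\<close>, like \<open>ln M\<close>, or stays bounded, according to the sign of \<open>r - N\<close>.
\<close>

lemma sum_mesh_weight_le:
  assumes "0 < r"
  shows "\<exists>C\<ge>0. \<forall>M\<ge>2. (\<Sum>i=1..M. mesh_weight r (Suc N) M i) \<le> C * varpi r (real N) M"
proof -
  define d where "d = r - real N"
  have eq: "(\<Sum>i=1..M. mesh_weight r (Suc N) M i) = real M powr (- r) * (\<Sum>i=1..M. real i powr (d - 1))" for M
    unfolding sum_distrib_left by (intro sum.cong refl) (simp add: mesh_weight_eq d_def algebra_simps)
  consider "d > 0" | "d = 0" | "d < 0" by linarith
  then show ?thesis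
  proof cases
    case 1
    obtain C where C: "C \<ge> 0" "\<forall>M. (\<Sum>i=1..M. real i powr (d - 1)) \<le> C * real M powr d"
      using sum_powr_le_positive[OF 1] by blast
    have "real M powr (- r) * (\<Sum>i=1..M. real i powr (d - 1)) \<le> C * varpi r (real N) M" if "M \<ge> 2" for M
    proof -
      have "real M powr (- r) * (\<Sum>i=1..M. real i powr (d - 1)) \<le> real M powr (- r) * (C * real M powr d)"
        using C(2) by (intro mult_left_mono) auto
      also have "\<dots> = C * real M powr (- real N)" by (simp add: d_def powr_add[symmetric])
      also have "\<dots> = C * varpi r (real N) M" using 1 by (simp add: varpi_def d_def min_def)
      finally show ?thesis .
    qed
    then show ?thesis using C(1) eq by auto
  next
    case 2
    have "real M powr (- r) * (\<Sum>i=1..M. real i powr (d - 1)) \<le> (1 / ln 2 + 1) * varpi r (real N) M" if M: "M \<ge> 2" for M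
    proof -
      have l: "(0::real) < ln 2" "ln 2 \<le> ln (real M)" using M by auto
      have "(\<Sum>i=1..M. real i powr (d - 1)) = (\<Sum>i=1..M. 1 / real i)"
        using 2 by (intro sum.cong refl) (simp add: powr_minus divide_inverse)
      also have "\<dots> \<le> 1 + ln (real M)" using M by (intro sum_inverse_le_ln) auto
      also have "\<dots> \<le> (1 / ln 2 + 1) * ln (real M)" using l by (simp add: field_simps)
      finally have "real M powr (- r) * (\<Sum>i=1..M. real i powr (d - 1))
          \<le> real M powr (- r) * ((1 / ln 2 + 1) * ln (real M))" by (rule mult_left_mono) simp
      then show ?thesis using 2 by (simp add: varpi_def d_def mult_ac)
    qed
    then show ?thesis using eq by (intro exI[of _ "1 / ln 2 + 1"]) auto
  next
    case 3
    have s: "summable (\<lambda>i. real i powr (d - 1))" using 3 by (simp add: summable_real_powr_iff)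
    define C where "C = (\<Sum>i. real i powr (d - 1))"
    have C: "(\<Sum>i=1..M. real i powr (d - 1)) \<le> C" for M
      unfolding C_def by (rule sum_le_suminf[OF s]) auto
    have "C \<ge> 0" unfolding C_def by (rule suminf_nonneg[OF s]) simp
    moreover have "real M powr (- r) * (\<Sum>i=1..M. real i powr (d - 1)) \<le> C * varpi r (real N) M" for M
    proof -
      have "real M powr (- r) * (\<Sum>i=1..M. real i powr (d - 1)) \<le> real M powr (- r) * C"
        using C by (intro mult_left_mono) auto
      then show ?thesis using 3 by (simp add: varpi_def d_def min_def mult.commute)
    qed
    ultimately show ?thesis using eq by auto
  qed
qed

section \<open>Local interpolation errors\<close>

context collocation
begin

lemma \<beta>_eq:
  assumes j: "j \<in> {1..M}"
  shows "\<beta> M j = b powr \<mu> * (real (M + 1 - j) / real M) powr (q * \<mu>)"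
  unfolding \<beta>_def b_minus_X_left[OF j] by (simp only: powr_mult powr_powr)

lemma \<beta>_pos: "j \<in> {1..M} \<Longrightarrow> 0 < \<beta> M j"
  using \<alpha>_less_\<beta>[of j M] \<alpha>_nonneg[of M j] by simp

lemma \<beta>_le: "j \<in> {1..M} \<Longrightarrow> \<beta> M j \<le> b powr \<mu>"
proof -
  assume j: "j \<in> {1..M}"
  have "X M (j - 1) \<in> {0..b}" by (rule X_in) (use j in auto)
  then show ?thesis unfolding \<beta>_def using \<mu> by (intro powr_mono2) auto
qed

lemma \<beta>_minus_\<alpha>_le:
  assumes j: "j \<in> {1..M}"
  shows "\<beta> M j - \<alpha> M j \<le> max 1 (q * \<mu>) * \<beta> M j / real (M + 1 - j)"
proof -
  define i where "i = real (M + 1 - j)"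
  have i: "i \<ge> 1" using j by (simp add: i_def of_nat_diff)
  have "(i - 1) / real M = i / real M * (1 - 1 / i)"
    using i by (simp add: right_diff_distrib diff_divide_distrib)
  then have "\<alpha> M j = \<beta> M j * (1 - 1 / i) powr (q * \<mu>)"
    unfolding \<alpha>_def \<beta>_def b_minus_X_left[OF j] b_minus_X_right[OF j] i_def[symmetric]
    by (simp only: powr_mult powr_powr mult.assoc)
  then have "\<beta> M j - \<alpha> M j = \<beta> M j * (1 - (1 - 1 / i) powr (q * \<mu>))" by (simp add: algebra_simps)
  also have "\<dots> \<le> \<beta> M j * (max 1 (q * \<mu>) * (1 / i))"
    using i q \<mu> \<beta>_pos[OF j] by (intro mult_left_mono one_minus_powr_le) auto
  finally show ?thesis by (simp add: i_def mult_ac)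
qed

text \<open>
  Rescaled to the local coordinate \<open>z\<close>, the point \<open>w = \<beta> - \<delta> z\<close> is at least \<open>\<beta> (1 - z)\<close>, with equality
  on the interval that contains the singular point \<open>w = 0\<close>. So the bound \<open>C * w powr (e - m)\<close> turns into
  \<open>\<delta>\<^sup>m \<beta> powr (e - m)\<close> times \<open>(1 - z) powr (e - m)\<close>, and \<open>interpolation_error\<close> serves all intervals
  alike. As \<open>\<delta> = O(\<beta> / i)\<close>, the factor is \<open>O(\<beta> powr e / i\<^sup>m)\<close>.
\<close>

lemma local_interpolation_error:
  fixes D :: "nat \<Rightarrow> real \<Rightarrow> real" and e C :: real
  assumes m: "0 < m" "m \<le> Suc n" and e: "0 < e" "e \<le> real m" and C: "0 \<le> C"
    and \<psi>: "continuous_on {0..b} \<psi>" and D0: "D 0 = (\<lambda>w. \<psi> (b - w powr (1 / \<mu>)))"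
    and D: "\<And>i w. i < m \<Longrightarrow> w \<in> {0<..<b powr \<mu>} \<Longrightarrow> (D i has_real_derivative D (Suc i) w) (at w)"
    and Dm: "\<And>w. w \<in> {0<..<b powr \<mu>} \<Longrightarrow> \<bar>D m w\<bar> \<le> C * w powr (e - real m)"
    and j: "j \<in> {1..M}" and x: "x \<in> cell M j"
  defines "\<kappa> \<equiv> C * max 1 (q * \<mu>) ^ m * (b powr \<mu>) powr e"
  defines "\<delta> \<equiv> \<beta> M j - \<alpha> M j"
  shows "\<bar>interp_error \<psi> M j x - (if m = Suc n then (- \<delta>) ^ n * D n (\<beta> M j - \<delta> / 2) / fact n else 0)
       * node_poly n \<xi> (local_coord M j x)\<bar>
     \<le> (1 + lebesgue_bound n \<xi>) * (\<kappa> / e) * mesh_weight (q * \<mu> * e) m M (M + 1 - j)"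
proof -
  define F where "F k z = (- \<delta>) ^ k * D k (\<beta> M j - \<delta> * z)" for k z
  let ?i = "M + 1 - j"
  have i: "real ?i \<ge> 1" using j by (simp add: of_nat_diff)
  have \<beta>0: "0 < \<beta> M j" by (rule \<beta>_pos[OF j])
  have \<delta>0: "0 < \<delta>" using \<alpha>_less_\<beta>[OF j] by (simp add: \<delta>_def)
  have \<delta>\<beta>: "\<delta> \<le> \<beta> M j" using \<alpha>_nonneg[of M j] by (simp add: \<delta>_def)
  have w_ge: "\<beta> M j * (1 - z) \<le> \<beta> M j - \<delta> * z" if "z \<in> {0..1}" for z
    using mult_right_mono[OF \<delta>\<beta>, of z] that by (simp add: algebra_simps)
  have w_in: "\<beta> M j - \<delta> * z \<in> {0<..<b powr \<mu>}" if z: "z \<in> {0<..<1}" for z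
  proof -
    have "0 < \<beta> M j * (1 - z)" using \<beta>0 z by simp
    moreover have "0 < \<delta> * z" using \<delta>0 z by simp
    ultimately show ?thesis using w_ge[of z] z \<beta>_le[OF j] by auto
  qed
  have w_in': "\<beta> M j - \<delta> * z \<in> {0..b powr \<mu>}" if z: "z \<in> {0..1}" for z
  proof -
    have "0 \<le> \<beta> M j * (1 - z)" using \<beta>0 z by simp
    moreover have "0 \<le> \<delta> * z" using \<delta>0 z by simp
    ultimately show ?thesis using w_ge[OF z] \<beta>_le[OF j] by auto
  qed
  have Fc: "continuous_on {0..1} (F 0)"
  proof -
    have "continuous_on {0..1} (\<lambda>z. (\<beta> M j - \<delta> * z) powr (1 / \<mu>))"
      by (rule continuous_on_powr') (use w_in' \<mu> in \<open>auto intro!: continuous_intros\<close>)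
    then have c: "continuous_on {0..1} (\<lambda>z. b - (\<beta> M j - \<delta> * z) powr (1 / \<mu>))"
      by (rule continuous_on_diff[OF continuous_on_const])
    have "continuous_on {0..1} (\<lambda>z. \<psi> (b - (\<beta> M j - \<delta> * z) powr (1 / \<mu>)))"
    proof (rule continuous_on_compose2[OF \<psi> c])
    show "(\<lambda>z. b - (\<beta> M j - \<delta> * z) powr (1 / \<mu>)) ` {0..1} \<subseteq> {0..b}"
    proof clarify
      fix z :: real assume "z \<in> {0..1}"
      from w_in'[OF this] have "(\<beta> M j - \<delta> * z) powr (1 / \<mu>) \<le> (b powr \<mu>) powr (1 / \<mu>)"
        using \<mu> by (intro powr_mono2) auto
      then show "b - (\<beta> M j - \<delta> * z) powr (1 / \<mu>) \<in> {0..b}" using \<mu> b by (simp add: powr_powr)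
    qed
    qed
    then show ?thesis unfolding F_def[abs_def] D0 by simp
  qed
  have Fd: "(F k has_real_derivative F (Suc k) z) (at z)" if k: "k < m" and z: "z \<in> {0<..<1}" for k z
  proof -
    have "((\<lambda>z. \<beta> M j - \<delta> * z) has_real_derivative - \<delta>) (at z)" by (auto intro!: derivative_eq_intros)
    from DERIV_cmult[OF DERIV_chain2[OF D[OF k w_in[OF z]] this], of "(- \<delta>) ^ k"]
    show ?thesis unfolding F_def[abs_def] by (simp add: mult_ac)
  qed
  have FB: "\<bar>F m z\<bar> \<le> (C * \<delta> ^ m * \<beta> M j powr (e - real m)) * (1 - z) powr (e - real m)" if z: "z \<in> {0<..<1}" for z
  proof -
    have "\<bar>F m z\<bar> = \<delta> ^ m * \<bar>D m (\<beta> M j - \<delta> * z)\<bar>" using \<delta>0 by (simp add: F_def abs_mult power_abs)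
    also have "\<dots> \<le> \<delta> ^ m * (C * (\<beta> M j - \<delta> * z) powr (e - real m))"
      using \<delta>0 by (intro mult_left_mono Dm w_in z) auto
    also have "(\<beta> M j - \<delta> * z) powr (e - real m) \<le> (\<beta> M j * (1 - z)) powr (e - real m)"
      using w_ge[of z] z \<beta>0 e by (intro powr_mono2') auto
    then have "\<delta> ^ m * (C * (\<beta> M j - \<delta> * z) powr (e - real m)) \<le> \<delta> ^ m * (C * (\<beta> M j * (1 - z)) powr (e - real m))"
      using \<delta>0 C by (intro mult_left_mono) auto
    finally show ?thesis by (simp add: powr_mult mult_ac)
  qed
  have F\<psi>: "F 0 (local_coord M j y) = \<psi> y" if y: "y \<in> cell M j" for y
  proof -
    have "y \<le> b" using X_interval[OF j y] by simp
    have "\<beta> M j - \<delta> * local_coord M j y = (b - y) powr \<mu>"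
      unfolding \<delta>_def local_coord_inverse[OF j, of y] ..
    then show ?thesis using \<open>y \<le> b\<close> \<mu> by (simp add: F_def D0 powr_powr)
  qed
  have "F 0 (\<xi> l) = \<psi> (coll M j l)" if "l \<in> {1..n}" for l
    using F\<psi>[OF coll_point_in[OF j that]] local_coord_coll_point[OF j that] by simp
  then have "interpolant n \<xi> (\<lambda>l. F 0 (\<xi> l)) = interpolant n \<xi> (\<lambda>l. \<psi> (coll M j l))"
    unfolding interpolant_def by (intro ext sum.cong) auto
  then have ie: "interp_error \<psi> M j x = F 0 (local_coord M j x) - piece M (\<lambda>l. F 0 (\<xi> l)) j x"
    unfolding interp_error_def F\<psi>[OF x] by simp
  have "C * \<delta> ^ m * \<beta> M j powr (e - real m) \<le> C * (max 1 (q * \<mu>) * \<beta> M j / real ?i) ^ m * \<beta> M j powr (e - real m)"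
    using \<delta>0 C \<beta>_minus_\<alpha>_le[OF j] by (intro mult_right_mono mult_left_mono power_mono) (auto simp: \<delta>_def)
  also have "\<dots> = C * max 1 (q * \<mu>) ^ m * (\<beta> M j powr real m * \<beta> M j powr (e - real m)) / real ?i ^ m"
    using \<beta>0 by (simp add: power_mult_distrib power_divide powr_realpow)
  also have "\<beta> M j powr real m * \<beta> M j powr (e - real m) = \<beta> M j powr e" by (simp add: powr_add[symmetric])
  also have "\<beta> M j powr e = (b powr \<mu>) powr e * (real ?i / real M) powr (q * \<mu> * e)"
    unfolding \<beta>_eq[OF j] powr_mult powr_powr by (simp only: mult.assoc)
  finally have B: "C * \<delta> ^ m * \<beta> M j powr (e - real m) \<le> \<kappa> * mesh_weight (q * \<mu> * e) m M ?i"
    by (simp add: \<kappa>_def mesh_weight_def mult_ac)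
  have "\<bar>interp_error \<psi> M j x - (if m = Suc n then F n (1/2) / fact n else 0) * node_poly n \<xi> (local_coord M j x)\<bar>
      \<le> (1 + lebesgue_bound n \<xi>) * ((C * \<delta> ^ m * \<beta> M j powr (e - real m)) / e)"
    unfolding ie by (rule interpolation_error[OF m e(1) Fc Fd FB local_coord_in[OF j x]])
  also have "\<dots> \<le> (1 + lebesgue_bound n \<xi>) * ((\<kappa> * mesh_weight (q * \<mu> * e) m M ?i) / e)"
    using B e lebesgue_bound_nonneg by (intro mult_left_mono divide_right_mono) auto
  also have "\<dots> = (1 + lebesgue_bound n \<xi>) * (\<kappa> / e) * mesh_weight (q * \<mu> * e) m M ?i" by simp
  finally show ?thesis by (simp only: F_def mult_1_right times_divide_eq_right)
qed

lemma local_coord_ends: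
  assumes "j \<in> {1..M}"
  shows "local_coord M j (X M (j - 1)) = 0" "local_coord M j (X M j) = 1"
proof -
  have "(b - X M (j - 1)) powr \<mu> = \<beta> M j" "(b - X M j) powr \<mu> = \<alpha> M j"
    by (simp_all only: \<alpha>_def \<beta>_def)
  then show "local_coord M j (X M (j - 1)) = 0" "local_coord M j (X M j) = 1"
    using \<alpha>_less_\<beta>[OF assms] by (simp_all add: local_coord_def)
qed

lemma local_coord_interior:
  assumes j: "j \<in> {1..M}" and x: "x \<in> {X M (j - 1)<..<X M j}"
  shows "local_coord M j x \<in> {0<..<1}"
proof -
  have "X M j \<in> {0..b}" by (rule X_in) (use j in auto)
  then have "\<alpha> M j < (b - x) powr \<mu>" "(b - x) powr \<mu> < \<beta> M j"
    unfolding \<alpha>_def \<beta>_def using x \<mu> by (auto intro!: powr_less_mono2)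
  then show ?thesis by (simp add: local_coord_def)
qed

lemma node_poly_continuous: "continuous_on S (node_poly n \<xi>)"
  unfolding node_poly_def[abs_def] by (intro continuous_intros)

text \<open>
  With an antiderivative \<open>Q\<close> of the node polynomial that vanishes at 0 and 1, the integrand is up to a
  constant the derivative of \<open>Q (local_coord M j x)\<close>. The last interval is excluded because
  \<open>(b - x) powr (\<mu> - 1)\<close> is singular there.
\<close>

lemma node_poly_orthogonal:
  assumes j: "j \<in> {1..M}" and jM: "j < M" and orth: "integral {0..1} (node_poly n \<xi>) = 0"
  shows "((\<lambda>x. node_poly n \<xi> (local_coord M j x) * (b - x) powr (\<mu> - 1)) has_integral 0) (cell M j)"
proof -
  define Q where "Q z = integral {0..z} (node_poly n \<xi>)" for z
  define \<delta> where "\<delta> = \<beta> M j - \<alpha> M j"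
  have \<delta>: "\<delta> > 0" using \<alpha>_less_\<beta>[OF j] by (simp add: \<delta>_def)
  have Xb: "X M j < b" using X_less[of j M M] jM X_M by simp
  have le: "X M (j - 1) \<le> X M j" using X_step[OF j] by simp
  have Qc: "continuous_on {0..1} Q"
    unfolding Q_def[abs_def]
    by (intro indefinite_integral_continuous_1 integrable_continuous_real node_poly_continuous)
  have Qd: "(Q has_real_derivative node_poly n \<xi> z) (at z)" if "z \<in> {0<..<1}" for z
  proof -
    have "(Q has_real_derivative node_poly n \<xi> z) (at z within {0..1})"
      unfolding Q_def[abs_def]
      by (rule integral_has_real_derivative[OF node_poly_continuous]) (use that in auto)
    then show ?thesis using at_within_interior[of z "{0..1}"] that by simp
  qed
  have "((\<lambda>x. node_poly n \<xi> (local_coord M j x) * (b - x) powr (\<mu> - 1)) has_integral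
     (\<delta> / \<mu> * Q (local_coord M j (X M j)) - \<delta> / \<mu> * Q (local_coord M j (X M (j - 1))))) (cell M j)"
  proof (rule fundamental_theorem_of_calculus_interior[OF le])
    have "continuous_on (cell M j) (\<lambda>x. Q (local_coord M j x))"
      by (rule continuous_on_compose2[OF Qc continuous_on_subset[OF local_coord_continuous]])
        (use local_coord_in[OF j] Xb in auto)
    then show "continuous_on (cell M j) (\<lambda>x. \<delta> / \<mu> * Q (local_coord M j x))"
      by (intro continuous_intros)
    fix x assume x: "x \<in> {X M (j - 1)<..<X M j}"
    have "(local_coord M j has_real_derivative \<mu> * (b - x) powr (\<mu> - 1) / \<delta>) (at x)"
      unfolding local_coord_def[abs_def] \<delta>_def[symmetric]
      using x Xb \<delta> by (auto intro!: derivative_eq_intros has_real_derivative_powr)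
    from DERIV_cmult[OF DERIV_chain2[OF Qd[OF local_coord_interior[OF j x]] this], of "\<delta> / \<mu>"]
    have "((\<lambda>x. \<delta> / \<mu> * Q (local_coord M j x)) has_real_derivative
        node_poly n \<xi> (local_coord M j x) * (b - x) powr (\<mu> - 1)) (at x)"
      by (rule DERIV_cong) (use \<delta> \<mu> in simp)
    then show "((\<lambda>x. \<delta> / \<mu> * Q (local_coord M j x)) has_vector_derivative
        node_poly n \<xi> (local_coord M j x) * (b - x) powr (\<mu> - 1)) (at x)"
      by (simp add: has_real_derivative_iff_has_vector_derivative)
  qed
  moreover have "Q 0 = 0" "Q 1 = 0" using orth by (simp_all add: Q_def)
  ultimately show ?thesis unfolding local_coord_ends[OF j] by simp
qed

text \<open>
  The orthogonality of the node polynomial refers to the variable \<open>w\<close>. In the variable \<open>x\<close> it holds with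
  the weight \<open>(b - x) powr (\<mu> - 1)\<close>, whose relative variation over the \<open>i\<close>-th interval is at most this
  constant divided by \<open>i\<close>.
\<close>

definition weight_variation :: real where
  "weight_variation = 2 powr (q * (1 - \<mu>)) * max 1 (q * (1 - \<mu>))"

lemma weight_variation_nonneg: "0 \<le> weight_variation"
  by (simp add: weight_variation_def)

lemma weight_nearly_constant:
  assumes j: "j \<in> {1..M}" and jM: "j < M" and x: "x \<in> cell M j"
  shows "\<bar>1 - ((b - x) / (b - X M (j - 1))) powr (\<mu> - 1)\<bar> \<le> weight_variation / real (M + 1 - j)"
proof -
  define i where "i = real (M + 1 - j)"
  define t where "t = b - X M (j - 1)"
  define z where "z = (b - x) / t"
  let ?\<gamma> = "q * (1 - \<mu>)"
  have i: "i \<ge> 2" using jM by (simp add: i_def of_nat_diff)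
  have "real M > 0" using j by simp
  then have t0: "t > 0" using b i unfolding t_def b_minus_X_left[OF j] i_def[symmetric] by simp
  have "(i - 1) / real M = i / real M * (1 - 1 / i)"
    using i by (simp add: right_diff_distrib diff_divide_distrib)
  then have "b - X M j = t * (1 - 1 / i) powr q"
    unfolding t_def b_minus_X_left[OF j] b_minus_X_right[OF j] i_def[symmetric]
    by (simp only: powr_mult mult.assoc)
  then have "t * (1 - 1 / i) powr q \<le> b - x" "b - x \<le> t" using x by (auto simp: t_def)
  then have z: "(1 - 1 / i) powr q \<le> z" "z \<le> 1" using t0 by (auto simp: z_def field_simps)
  have "1 / i \<le> 1 / 2" using i by (intro divide_left_mono) auto
  then have i1: "1 - 1 / i \<ge> 1 / 2" "0 < 1 - 1 / i" by linarith+
  have "0 < (1 - 1 / i) powr q" using i1(2) unfolding powr_gt_zero by linarith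
  then have z0: "0 < z" using z(1) by linarith
  have low: "(1 - 1 / i) powr ?\<gamma> \<le> z powr (1 - \<mu>)"
  proof -
    have "((1 - 1 / i) powr q) powr (1 - \<mu>) \<le> z powr (1 - \<mu>)" using z \<mu> by (intro powr_mono2) auto
    then show ?thesis by (simp add: powr_powr)
  qed
  have v: "z powr (\<mu> - 1) = 1 / z powr (1 - \<mu>)" using z0 by (simp add: powr_minus[symmetric] field_simps flip: powr_add)
  have zz: "0 < z powr (1 - \<mu>)" "z powr (1 - \<mu>) \<le> 1" using z0 z \<mu> by (auto intro!: powr_le1)
  have d: "1 - z powr (1 - \<mu>) \<le> max 1 ?\<gamma> * (1 / i)"
  proof -
    have "1 - (1 - 1 / i) powr ?\<gamma> \<le> max 1 ?\<gamma> * (1 / i)"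
      using i q \<mu> by (intro one_minus_powr_le) auto
    then show ?thesis using low by linarith
  qed
  have up: "1 / z powr (1 - \<mu>) \<le> 2 powr ?\<gamma>"
  proof -
    have "(1 / 2) powr ?\<gamma> \<le> (1 - 1 / i) powr ?\<gamma>" using i1 q \<mu> by (intro powr_mono2) auto
    then have "(1 / 2) powr ?\<gamma> \<le> z powr (1 - \<mu>)" using low by simp
    then have "1 / z powr (1 - \<mu>) \<le> 1 / (1 / 2) powr ?\<gamma>" using zz by (intro divide_left_mono) auto
    then show ?thesis by (simp add: powr_divide)
  qed
  have "\<bar>1 - z powr (\<mu> - 1)\<bar> = 1 / z powr (1 - \<mu>) - 1" unfolding v using zz by (simp add: field_simps)
  also have "\<dots> = 1 / z powr (1 - \<mu>) * (1 - z powr (1 - \<mu>))" using zz by (simp add: field_simps)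
  also have "\<dots> \<le> 2 powr ?\<gamma> * (max 1 ?\<gamma> * (1 / i))"
    using up d zz by (intro mult_mono) auto
  finally show ?thesis by (simp add: z_def t_def i_def weight_variation_def)
qed

text \<open>
  Subtracting the vanishing weighted integral leaves the node polynomial times the variation of the
  weight.
\<close>

lemma integral_node_poly_small:
  assumes j: "j \<in> {1..M}" and jM: "j < M" and orth: "integral {0..1} (node_poly n \<xi>) = 0"
  shows "\<bar>integral (cell M j) (\<lambda>x. node_poly n \<xi> (local_coord M j x))\<bar>
     \<le> weight_variation / real (M + 1 - j) * (X M j - X M (j - 1))"
proof -
  let ?I = "cell M j"
  let ?P = "\<lambda>x. node_poly n \<xi> (local_coord M j x)"
  let ?t = "b - X M (j - 1)"
  let ?k = "\<lambda>x. ((b - x) / ?t) powr (\<mu> - 1)"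
  have Xb: "X M j < b" using X_less[of j M M] jM X_M by simp
  have le: "X M (j - 1) \<le> X M j" using X_step[OF j] by simp
  have t0: "?t > 0" using Xb le by simp
  have Pc: "continuous_on ?I ?P"
    by (rule continuous_on_compose2[OF node_poly_continuous continuous_on_subset[OF local_coord_continuous]])
      (use Xb in auto)
  have kc: "continuous_on ?I ?k"
    using Xb t0 by (intro continuous_intros) auto
  have "((\<lambda>x. ?P x * ?k x) has_integral 0) ?I"
  proof -
    have "((\<lambda>x. (?P x * (b - x) powr (\<mu> - 1)) / ?t powr (\<mu> - 1)) has_integral 0 / ?t powr (\<mu> - 1)) ?I"
      by (rule has_integral_divide[OF node_poly_orthogonal[OF assms]])
    then show ?thesis by (simp add: powr_divide)
  qed
  then have 0: "integral ?I (\<lambda>x. ?P x * ?k x) = 0" "(\<lambda>x. ?P x * ?k x) integrable_on ?I" by (auto simp: integral_unique)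
  have "integral ?I ?P = integral ?I ?P - integral ?I (\<lambda>x. ?P x * ?k x)" using 0 by simp
  also have "\<dots> = integral ?I (\<lambda>x. ?P x - ?P x * ?k x)"
    by (rule integral_diff[symmetric]) (use Pc 0 in \<open>auto intro: integrable_continuous_real\<close>)
  also have "norm \<dots> \<le> weight_variation / real (M + 1 - j) * (X M j - X M (j - 1))"
  proof (rule integral_bound[OF le])
    show "continuous_on ?I (\<lambda>x. ?P x - ?P x * ?k x)"
      by (rule continuous_on_diff[OF Pc continuous_on_mult[OF Pc kc]])
    fix x assume x: "x \<in> ?I"
    have "norm (?P x - ?P x * ?k x) = \<bar>?P x\<bar> * \<bar>1 - ?k x\<bar>" by (simp add: abs_mult[symmetric] algebra_simps)
    also have "\<dots> \<le> 1 * (weight_variation / real (M + 1 - j))"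
      by (intro mult_mono node_poly_bound local_coord_in j x weight_nearly_constant jM) auto
    finally show "norm (?P x - ?P x * ?k x) \<le> weight_variation / real (M + 1 - j)" by simp
  qed
  finally show ?thesis by simp
qed

lemma X_step_mesh_weight: "j \<in> {1..M} \<Longrightarrow> X M j - X M (j - 1) \<le> b * q * mesh_weight q 1 M (M + 1 - j)"
  using X_step_le[of j M] by (simp add: mesh_weight_def)

lemma interp_error_continuous:
  assumes \<psi>: "continuous_on {0..b} \<psi>" and j: "j \<in> {1..M}"
  shows "continuous_on (cell M j) (interp_error \<psi> M j)"
  unfolding interp_error_def[abs_def]
  by (intro continuous_on_diff continuous_on_subset[OF \<psi>] piece_continuous j) (use X_interval[OF j] in blast)

lemma interp_error_bound:
  assumes e: "0 < e" "e \<le> real n" and \<psi>: "continuous_on {0..b} \<psi>" and D0: "D 0 = (\<lambda>w. \<psi> (b - w powr (1 / \<mu>)))"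
    and D: "\<And>i w. i < n \<Longrightarrow> w \<in> {0<..<b powr \<mu>} \<Longrightarrow> (D i has_real_derivative D (Suc i) w) (at w)"
    and Dn: "\<exists>C\<ge>0. \<forall>w\<in>{0<..<b powr \<mu>}. \<bar>D n w\<bar> \<le> C * w powr (e - real n)"
  shows "\<exists>A\<ge>0. \<forall>M. \<forall>j\<in>{1..M}. \<forall>x\<in>cell M j.
    \<bar>interp_error \<psi> M j x\<bar> \<le> A * mesh_weight (q * \<mu> * e) n M (M + 1 - j)"
proof -
  obtain C where C: "C \<ge> 0" "\<And>w. w \<in> {0<..<b powr \<mu>} \<Longrightarrow> \<bar>D n w\<bar> \<le> C * w powr (e - real n)" using Dn by blast
  have n0: "0 < n" "n \<le> Suc n" using n by auto
  let ?A = "(1 + lebesgue_bound n \<xi>) * (C * max 1 (q * \<mu>) ^ n * (b powr \<mu>) powr e / e)"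
  have "?A \<ge> 0" using lebesgue_bound_nonneg C e by (intro mult_nonneg_nonneg divide_nonneg_nonneg) auto
  moreover have "\<bar>interp_error \<psi> M j x\<bar> \<le> ?A * mesh_weight (q * \<mu> * e) n M (M + 1 - j)"
    if "j \<in> {1..M}" "x \<in> cell M j" for M j x
    using local_interpolation_error[OF n0 e C(1) \<psi> D0 D C(2) that] by simp
  ultimately show ?thesis by blast
qed

text \<open>
  On the interval at \<open>b\<close>, where \<open>i = 1\<close>, powers of \<open>i\<close> do not matter and the pointwise bound suffices. On
  the others, the error is a multiple of the node polynomial, whose integral is smaller than its size
  suggests by a factor \<open>1 / i\<close>, plus a remainder of one order more.
\<close>

lemma interp_error_integral_bound:
  assumes e: "0 < e" "e \<le> real n" and \<psi>: "continuous_on {0..b} \<psi>" and D0: "D 0 = (\<lambda>w. \<psi> (b - w powr (1 / \<mu>)))"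
    and D: "\<And>i w. i < Suc n \<Longrightarrow> w \<in> {0<..<b powr \<mu>} \<Longrightarrow> (D i has_real_derivative D (Suc i) w) (at w)"
    and Dn: "\<exists>C\<ge>0. \<forall>w\<in>{0<..<b powr \<mu>}. \<bar>D n w\<bar> \<le> C * w powr (e - real n)"
    and DSn: "\<exists>C\<ge>0. \<forall>w\<in>{0<..<b powr \<mu>}. \<bar>D (Suc n) w\<bar> \<le> C * w powr (e - real (Suc n))"
    and orth: "integral {0..1} (node_poly n \<xi>) = 0"
  shows "\<exists>A\<ge>0. \<forall>M. \<forall>j\<in>{1..M}.
    \<bar>integral (cell M j) (interp_error \<psi> M j)\<bar> \<le> A * mesh_weight (q * (\<mu> * e + 1)) (Suc (Suc n)) M (M + 1 - j)"
proof -
  let ?s = "q * \<mu> * e" and ?r = "q * (\<mu> * e + 1)"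
  have r: "?s + q = ?r" by (simp add: algebra_simps)
  obtain A where A: "A \<ge> 0" "\<And>M j x. j \<in> {1..M} \<Longrightarrow> x \<in> cell M j \<Longrightarrow>
    \<bar>interp_error \<psi> M j x\<bar> \<le> A * mesh_weight ?s n M (M + 1 - j)"
    using interp_error_bound[OF e \<psi> D0 D Dn] by fastforce
  obtain C where C: "C \<ge> 0" "\<And>w. w \<in> {0<..<b powr \<mu>} \<Longrightarrow> \<bar>D n w\<bar> \<le> C * w powr (e - real n)" using Dn by blast
  obtain C' where C': "C' \<ge> 0" "\<And>w. w \<in> {0<..<b powr \<mu>} \<Longrightarrow> \<bar>D (Suc n) w\<bar> \<le> C' * w powr (e - real (Suc n))" using DSn by blast
  define A1 where "A1 = (1 + lebesgue_bound n \<xi>) * (C' * max 1 (q * \<mu>) ^ Suc n * (b powr \<mu>) powr e / e)"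
  define A2 where "A2 = C * max 1 (q * \<mu>) ^ n * (b powr \<mu>) powr e * (1 / 2) powr (e - real n)"
  define A3 where "A3 = b * q * (A1 + A2 * weight_variation)"
  have A1: "A1 \<ge> 0" unfolding A1_def using lebesgue_bound_nonneg C' e by (intro mult_nonneg_nonneg divide_nonneg_nonneg) auto
  have A2: "A2 \<ge> 0" unfolding A2_def using C by (intro mult_nonneg_nonneg) auto
  have A3: "A3 \<ge> 0" unfolding A3_def using A1 A2 b q weight_variation_nonneg by auto
  have bq: "0 \<le> b * q" using b q by simp
  have "\<bar>integral (cell M j) (interp_error \<psi> M j)\<bar> \<le> (A * (b * q) + A3) * mesh_weight ?r (Suc (Suc n)) M (M + 1 - j)"
    if j: "j \<in> {1..M}" for M j
  proof -
    let ?i = "M + 1 - j" and ?I = "cell M j"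
    let ?z = "local_coord M j"
    have le: "X M (j - 1) \<le> X M j" using X_step[OF j] by simp
    note ic = interp_error_continuous[OF \<psi> j]
    note w0 = mesh_weight_nonneg
    show ?thesis
    proof (cases "j = M")
      case True
      then have i1: "?i = 1" by simp
      have "norm (integral ?I (interp_error \<psi> M j)) \<le> A * mesh_weight ?s n M ?i * (X M j - X M (j - 1))"
        by (rule integral_bound[OF le ic]) (use A(2)[OF j] in simp)
      also have "\<dots> \<le> A * mesh_weight ?s n M ?i * (b * q * mesh_weight q 1 M ?i)"
        by (intro mult_left_mono X_step_mesh_weight j mult_nonneg_nonneg A w0)
      also have "\<dots> = A * (b * q) * (mesh_weight ?s n M ?i * mesh_weight q 1 M ?i)" by simp
      also have "\<dots> = A * (b * q) * mesh_weight ?r (Suc n) M ?i" unfolding mesh_weight_mult r by simp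
      also have "mesh_weight ?r (Suc n) M ?i = mesh_weight ?r (Suc (Suc n)) M ?i" unfolding mesh_weight_def i1 by simp
      also have "A * (b * q) * mesh_weight ?r (Suc (Suc n)) M ?i \<le> (A * (b * q) + A3) * mesh_weight ?r (Suc (Suc n)) M ?i"
        using A3 by (intro mult_right_mono w0) auto
      finally show ?thesis by simp
    next
      case False
      then have jM: "j < M" using j by simp
      let ?\<delta> = "\<beta> M j - \<alpha> M j"
      define c where "c = (- ?\<delta>) ^ n * D n (\<beta> M j - ?\<delta> / 2) / fact n"
      have \<delta>0: "?\<delta> > 0" using \<alpha>_less_\<beta>[OF j] by simp
      have \<beta>0: "\<beta> M j > 0" by (rule \<beta>_pos[OF j])
      have err: "\<bar>interp_error \<psi> M j x - c * node_poly n \<xi> (?z x)\<bar> \<le> A1 * mesh_weight ?s (Suc n) M ?i" if "x \<in> ?I" for x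
      proof -
        have "e \<le> real (Suc n)" using e by simp
        from local_interpolation_error[OF _ _ e(1) this C'(1) \<psi> D0 D C'(2) j that]
        show ?thesis by (simp add: c_def A1_def)
      qed
      have c: "\<bar>c\<bar> \<le> A2 * mesh_weight ?s n M ?i"
      proof -
        have "?\<delta> \<le> \<beta> M j" using \<alpha>_nonneg[of M j] by simp
        then have w: "\<beta> M j * (1 / 2) \<le> \<beta> M j - ?\<delta> / 2" by simp
        have "0 < \<beta> M j - ?\<delta> / 2" using w \<beta>0 by linarith
        moreover have "y - d / 2 < W" if "0 < d" "y \<le> W" for y d W :: real using that by simp
        from this[OF \<delta>0 \<beta>_le[OF j]] have "\<beta> M j - ?\<delta> / 2 < b powr \<mu>" .
        ultimately have "\<beta> M j - ?\<delta> / 2 \<in> {0<..<b powr \<mu>}"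
          unfolding greaterThanLessThan_iff by (rule conjI)
        then have "\<bar>D n (\<beta> M j - ?\<delta> / 2)\<bar> \<le> C * (\<beta> M j - ?\<delta> / 2) powr (e - real n)" by (rule C(2))
        also have "\<dots> \<le> C * (\<beta> M j * (1 / 2)) powr (e - real n)"
          using w \<beta>0 e C(1) by (intro mult_left_mono powr_mono2') auto
        finally have D: "\<bar>D n (\<beta> M j - ?\<delta> / 2)\<bar> \<le> C * (\<beta> M j * (1 / 2)) powr (e - real n)" .
        have "\<bar>c\<bar> = ?\<delta> ^ n * \<bar>D n (\<beta> M j - ?\<delta> / 2)\<bar> / fact n"
          unfolding c_def using \<delta>0 by (simp add: abs_mult power_abs)
        also have "\<dots> \<le> ?\<delta> ^ n * \<bar>D n (\<beta> M j - ?\<delta> / 2)\<bar> / 1"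
          using \<delta>0 by (intro divide_left_mono) auto
        also have "\<dots> \<le> (max 1 (q * \<mu>) * \<beta> M j / real ?i) ^ n * (C * (\<beta> M j * (1 / 2)) powr (e - real n))"
          using D \<beta>_minus_\<alpha>_le[OF j] \<delta>0 by (simp only: div_by_1) (intro mult_mono power_mono; simp)
        also have "\<dots> = C * max 1 (q * \<mu>) ^ n * (1 / 2) powr (e - real n) * (\<beta> M j powr real n * \<beta> M j powr (e - real n)) / real ?i ^ n"
          unfolding powr_mult power_mult_distrib power_divide using \<beta>0 by (simp add: powr_realpow mult_ac)
        also have "\<beta> M j powr real n * \<beta> M j powr (e - real n) = \<beta> M j powr e" by (simp add: powr_add[symmetric])
        also have "\<beta> M j powr e = (b powr \<mu>) powr e * (real ?i / real M) powr ?s"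
          unfolding \<beta>_eq[OF j] powr_mult powr_powr by (simp only: mult.assoc)
        finally show ?thesis by (simp add: A2_def mesh_weight_def mult_ac)
      qed
      have Pc: "continuous_on ?I (\<lambda>x. node_poly n \<xi> (?z x))"
        by (rule continuous_on_compose2[OF node_poly_continuous continuous_on_subset[OF local_coord_continuous]])
          (use X_interval[OF j] in auto)
      let ?\<rho> = "\<lambda>x. interp_error \<psi> M j x - c * node_poly n \<xi> (?z x)"
      have \<rho>c: "continuous_on ?I ?\<rho>" using ic Pc by (intro continuous_intros)
      have "integral ?I (interp_error \<psi> M j) = integral ?I (\<lambda>x. ?\<rho> x + c * node_poly n \<xi> (?z x))" by simp
      also have "\<dots> = integral ?I ?\<rho> + c * integral ?I (\<lambda>x. node_poly n \<xi> (?z x))"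
        using integral_add[of ?\<rho> ?I "\<lambda>x. c * node_poly n \<xi> (?z x)"] \<rho>c Pc
        by (simp add: integrable_continuous_real continuous_on_mult_left)
      finally have "\<bar>integral ?I (interp_error \<psi> M j)\<bar> \<le> \<bar>integral ?I ?\<rho>\<bar> + \<bar>c\<bar> * \<bar>integral ?I (\<lambda>x. node_poly n \<xi> (?z x))\<bar>"
        unfolding abs_mult[symmetric] by (simp only: abs_triangle_ineq)
      moreover have "\<bar>integral ?I ?\<rho>\<bar> \<le> A1 * mesh_weight ?s (Suc n) M ?i * (X M j - X M (j - 1))"
        using integral_bound[OF le \<rho>c, of "A1 * mesh_weight ?s (Suc n) M ?i"] err by simp
      moreover have "\<bar>c\<bar> * \<bar>integral ?I (\<lambda>x. node_poly n \<xi> (?z x))\<bar>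
          \<le> (A2 * mesh_weight ?s n M ?i) * (weight_variation / real ?i * (X M j - X M (j - 1)))"
        using c integral_node_poly_small[OF j jM orth] A2 w0 by (intro mult_mono) auto
      ultimately have "\<bar>integral ?I (interp_error \<psi> M j)\<bar> \<le> A1 * mesh_weight ?s (Suc n) M ?i * (X M j - X M (j - 1))
          + (A2 * mesh_weight ?s n M ?i) * (weight_variation / real ?i * (X M j - X M (j - 1)))"
        by linarith
      also have "A1 * mesh_weight ?s (Suc n) M ?i * (X M j - X M (j - 1))
          + (A2 * mesh_weight ?s n M ?i) * (weight_variation / real ?i * (X M j - X M (j - 1)))
          = (A1 + A2 * weight_variation) * mesh_weight ?s (Suc n) M ?i * (X M j - X M (j - 1))"
      proof -
        have "B * (m / i) * d + (B' * m) * (v / i * d) = (B + B' * v) * (m / i) * d" for B B' m i d v :: real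
          by (simp add: distrib_right add_divide_distrib)
        moreover have "mesh_weight ?s (Suc n) M ?i = mesh_weight ?s n M ?i / real ?i"
          by (simp add: mesh_weight_def)
        ultimately show ?thesis by (simp only:)
      qed
      also have "\<dots> \<le> (A1 + A2 * weight_variation) * mesh_weight ?s (Suc n) M ?i * (b * q * mesh_weight q 1 M ?i)"
        using A1 A2 weight_variation_nonneg by (intro mult_left_mono X_step_mesh_weight j mult_nonneg_nonneg w0 add_nonneg_nonneg)
      also have "\<dots> = A3 * (mesh_weight ?s (Suc n) M ?i * mesh_weight q 1 M ?i)" by (simp add: A3_def)
      also have "\<dots> = A3 * mesh_weight ?r (Suc (Suc n)) M ?i" unfolding mesh_weight_mult r by simp
      also have "\<dots> \<le> (A * (b * q) + A3) * mesh_weight ?r (Suc (Suc n)) M ?i"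
        using A(1) bq by (intro mult_right_mono w0) auto
      finally show ?thesis by simp
    qed
  qed
  then show ?thesis using A(1) bq A3 by (intro exI[of _ "A * (b * q) + A3"]) auto
qed

text \<open>
  The interval that contains \<open>x\<close> may be cut, so that no cancellation can be used on it; being a single
  interval, it may be estimated with one power of \<open>i\<close> less.
\<close>

lemma accumulated_error_bound:
  fixes \<psi> :: "real \<Rightarrow> real" and r A :: real
  assumes r: "0 < r" and A: "0 \<le> A"
    and part: "\<And>M j x. j \<in> {1..M} \<Longrightarrow> x \<in> cell M j \<Longrightarrow>
      \<bar>integral {x..X M j} (interp_error \<psi> M j)\<bar> \<le> A * mesh_weight r N M (M + 1 - j)"
    and whole: "\<And>M j. j \<in> {1..M} \<Longrightarrow>
      \<bar>integral (cell M j) (interp_error \<psi> M j)\<bar> \<le> A * mesh_weight r (Suc N) M (M + 1 - j)"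
  shows "\<exists>C\<ge>0. \<forall>M\<ge>2. \<forall>j\<in>{1..M}. \<forall>x\<in>cell M j.
    \<bar>accumulated_error \<psi> M j x\<bar>
      \<le> C * varpi r (real N) M"
proof -
  obtain C where C: "C \<ge> 0" "\<And>M. M \<ge> 2 \<Longrightarrow> (\<Sum>i=1..M. mesh_weight r (Suc N) M i) \<le> C * varpi r (real N) M"
    using sum_mesh_weight_le[OF r] by blast
  have "\<bar>accumulated_error \<psi> M j x\<bar>
      \<le> A * (1 / ln 2 + C) * varpi r (real N) M"
    if M: "M \<ge> 2" and j: "j \<in> {1..M}" and x: "x \<in> cell M j" for M j x
  proof -
    have "M + 1 - j \<in> {1..M}" using j by auto
    then have "mesh_weight r N M (M + 1 - j) \<le> (1 / ln 2) * varpi r (real N) M"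
      using mesh_weight_le varpi_ge(1)[OF M] order_trans by blast
    then have 1: "\<bar>integral {x..X M j} (interp_error \<psi> M j)\<bar> \<le> A * ((1 / ln 2) * varpi r (real N) M)"
      using part[OF j x] A mult_left_mono order_trans by blast
    have "\<bar>\<Sum>k\<in>{j<..M}. integral (cell M k) (interp_error \<psi> M k)\<bar>
        \<le> (\<Sum>k\<in>{j<..M}. A * mesh_weight r (Suc N) M (M + 1 - k))"
      using j by (intro order_trans[OF sum_abs] sum_mono whole) auto
    also have "\<dots> \<le> (\<Sum>k\<in>{1..M}. A * mesh_weight r (Suc N) M (M + 1 - k))"
      using j A mesh_weight_nonneg by (intro sum_mono2) auto
    also have "\<dots> = A * (\<Sum>k=1..M. mesh_weight r (Suc N) M (M + 1 - k))" by (simp add: sum_distrib_left)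
    also have "(\<Sum>k=1..M. mesh_weight r (Suc N) M (M + 1 - k)) = (\<Sum>k=1..M. mesh_weight r (Suc N) M k)"
      using sum.atLeastAtMost_rev[of "mesh_weight r (Suc N) M" 1 M] by (simp add: add.commute)
    also have "A * \<dots> \<le> A * (C * varpi r (real N) M)" by (intro mult_left_mono C(2) M A)
    finally show ?thesis using 1 by (simp add: algebra_simps)
  qed
  moreover have "0 \<le> A * (1 / ln 2 + C)" using A C(1) by (intro mult_nonneg_nonneg) auto
  ultimately show ?thesis by blast
qed

lemma partial_integral_bound:
  assumes \<psi>: "continuous_on {0..b} \<psi>" and A: "0 \<le> A"
    and bnd: "\<And>M j x. j \<in> {1..M} \<Longrightarrow> x \<in> cell M j \<Longrightarrow>
    \<bar>interp_error \<psi> M j x\<bar> \<le> A * mesh_weight (q * \<mu> * e) n M (M + 1 - j)"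
    and j: "j \<in> {1..M}" and x: "x \<in> cell M j"
  shows "\<bar>integral {x..X M j} (interp_error \<psi> M j)\<bar> \<le> A * (b * q) * mesh_weight (q * (\<mu> * e + 1)) (Suc n) M (M + 1 - j)"
proof -
  let ?s = "q * \<mu> * e" and ?r = "q * (\<mu> * e + 1)" and ?i = "M + 1 - j"
  have r: "?s + q = ?r" by (simp add: algebra_simps)
  have "norm (integral {x..X M j} (interp_error \<psi> M j)) \<le> A * mesh_weight ?s n M ?i * (X M j - x)"
    by (rule integral_bound) (use x bnd[OF j] in \<open>auto intro!: continuous_on_subset[OF interp_error_continuous[OF \<psi> j]]\<close>)
  also have "\<dots> \<le> A * mesh_weight ?s n M ?i * (b * q * mesh_weight q 1 M ?i)"
    using X_step_mesh_weight[OF j] x by (intro mult_left_mono mult_nonneg_nonneg A mesh_weight_nonneg) auto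
  also have "\<dots> = A * (b * q) * (mesh_weight ?s n M ?i * mesh_weight q 1 M ?i)" by simp
  also have "\<dots> = A * (b * q) * mesh_weight ?r (Suc n) M ?i" unfolding mesh_weight_mult r by simp
  finally show ?thesis by simp
qed

end

text \<open>
  The error of \<open>\<phi>\<close> is of no lower order than that of \<open>\<psi>\<close>: the factor \<open>M powr s\<close> that is lost on the right
  outweighs the logarithm.
\<close>

lemma varpi_shift_le:
  assumes M: "M \<ge> 2" and s: "s \<ge> 1"
  shows "varpi (r + s) t M \<le> real M powr (- min r t)"
proof (cases "r + s = t")
  case True
  have "ln (real M) \<le> real M" using ln_le_minus_one[of "real M"] M by simp
  then have "varpi (r + s) t M \<le> real M powr (- t) * real M powr 1"
    unfolding varpi_def using True M by (simp add: mult_left_mono)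
  also have "\<dots> = real M powr (1 - t)" unfolding powr_add[symmetric] by simp
  also have "\<dots> \<le> real M powr (- min r t)" using M s True by (intro powr_mono) auto
  finally show ?thesis .
next
  case False
  then show ?thesis unfolding varpi_def using M s by (auto intro!: powr_mono)
qed

lemma varpi_Suc_le:
  assumes M: "M \<ge> 2"
  shows "varpi r (s + 1) M \<le> (1 / ln 2) * varpi r s M"
proof -
  have "varpi r (s + 1) M \<le> real M powr (- min r s)"
  proof (cases "r = s + 1")
    case True
    have "ln (real M) \<le> real M" using ln_le_minus_one[of "real M"] M by simp
    then have "varpi r (s + 1) M \<le> real M powr (- (s + 1)) * real M powr 1"
      unfolding varpi_def using True M by (simp add: mult_left_mono)
    also have "\<dots> = real M powr (- min r s)" unfolding powr_add[symmetric] using True by simp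
    finally show ?thesis .
  next
    case False
    then show ?thesis unfolding varpi_def using M by (auto intro!: powr_mono)
  qed
  then show ?thesis using varpi_ge(1)[OF M, of r s] by linarith
qed

lemma Linf_norm_le:
  assumes "f \<in> borel_measurable (lebesgue_on {0..b})" "\<And>x. x \<in> {0..b} \<Longrightarrow> \<bar>f x\<bar> \<le> c"
  shows "Linf_norm b f \<le> ereal c"
  unfolding Linf_norm_def
proof (rule esssup_I)
  show "(\<lambda>x. ereal \<bar>f x\<bar>) \<in> borel_measurable (lebesgue_on {0..b})" using assms(1) by measurable
  show "AE x in lebesgue_on {0..b}. ereal \<bar>f x\<bar> \<le> ereal c"
    by (rule AE_I2) (use assms(2) in \<open>simp add: space_restrict_space\<close>)
qed

section \<open>Convergence rates\<close>

context collocation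
begin

text \<open>
  The half-open intervals are those on which \<open>\<psi>h\<close> is given by its piece.
\<close>

lemma half_open_interval_exists:
  assumes M: "M \<ge> 1" and x: "x \<in> {0<..b}"
  obtains j where "j \<in> {1..M}" "x \<in> {X M (j - 1)<..X M j}"
proof -
  obtain j where j: "j \<in> {1..M}" "x \<in> cell M j"
    using mesh_interval_exists[OF M, of x] x by auto
  show thesis
  proof (cases "x = X M (j - 1)")
    case False
    then show thesis using j by (intro that[of j]) auto
  next
    case True
    then have "j \<noteq> 1" using x X_0[OF M] by auto
    then have j': "j - 1 \<in> {1..M}" using j by auto
    then show thesis using True X_step[OF j'] by (intro that[of "j - 1"]) auto
  qed
qed

lemma collocation_approx_measurable:
  assumes C: "collocation_approx b \<nu> \<mu> q n \<xi> a g K \<phi>b M Y \<psi>h \<phi>h" and M: "M \<ge> 1"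
  shows "\<psi>h \<in> borel_measurable (lebesgue_on {0..b})"
proof -
  note D = collocation_approxD[OF C M]
  define p where "p k x = piece M (Y k) k x" for k x
  have ind: "indicator S \<in> borel_measurable (lebesgue_on {0..b})" if "S \<in> sets borel" for S :: "real set"
    using that by (intro measurable_restrict_space1 measurable_completion) auto
  have pm: "p k \<in> borel_measurable (lebesgue_on {0..b})" for k
    unfolding p_def[abs_def]
    by (intro continuous_imp_measurable_on_sets_lebesgue
        continuous_on_compose2[OF interpolant_continuous continuous_on_subset[OF local_coord_continuous]]) auto
  have "(\<lambda>x. (\<Sum>k\<in>{1..M}. indicator {X M (k - 1)<..X M k} x * p k x) + indicator {0} x * p 1 0)
      \<in> borel_measurable (lebesgue_on {0..b})"
    by (intro borel_measurable_add borel_measurable_sum borel_measurable_times ind pm borel_measurable_const) auto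
  moreover have "\<psi>h x = (\<Sum>k\<in>{1..M}. indicator {X M (k - 1)<..X M k} x * p k x) + indicator {0} x * p 1 0"
    if x: "x \<in> {0..b}" for x
  proof (cases "x = 0")
    case True
    have "indicator {X M (k - 1)<..X M k} x = (0::real)" if "k \<in> {1..M}" for k
    proof -
      have "X M (k - 1) \<in> {0..b}" by (rule X_in) (use that M in auto)
      then show ?thesis using True by (auto simp: indicator_def)
    qed
    then show ?thesis using True D(3) by (simp add: p_def)
  next
    case False
    then have x': "x \<in> {0<..b}" using x by auto
    obtain j where j: "j \<in> {1..M}" "x \<in> {X M (j - 1)<..X M j}" using half_open_interval_exists[OF M x'] by blast
    have "(\<Sum>k\<in>{1..M}. indicator {X M (k - 1)<..X M k} x * p k x) = (\<Sum>k\<in>{1..M}. if k = j then p j x else 0)"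
    proof (intro sum.cong refl)
      fix k assume k: "k \<in> {1..M}"
      show "indicator {X M (k - 1)<..X M k} x * p k x = (if k = j then p j x else 0)"
      proof (cases "k = j")
        case True
        then show ?thesis using j by (simp only: indicator_simps simp_thms if_True mult_1_left)
      next
        case False
        then have "x \<notin> {X M (k - 1)<..X M k}"
          using piece_index_eq[OF j] piece_index_eq[OF k] by blast
        then have "indicator {X M (k - 1)<..X M k} x = (0::real)" by (rule indicator_simps(2))
        then show ?thesis using False by (simp only: if_False mult_zero_left)
      qed
    qed
    also have "\<dots> = p j x" using j(1) by simp
    finally show ?thesis using False D(2)[OF j] by (simp add: p_def)
  qed
  ultimately show ?thesis
    by (subst measurable_cong) (auto simp: space_restrict_space)
qed

lemma psi_h_on_piece:
  assumes C: "collocation_approx b \<nu> \<mu> q n \<xi> a g K \<phi>b M Y \<psi>h \<phi>h" and M: "M \<ge> 1" and x: "x \<in> {0..b}"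
  obtains j where "j \<in> {1..M}" "x \<in> cell M j" "\<psi>h x = piece M (Y j) j x"
proof (cases "x = 0")
  case True
  have "1 \<in> {1..M}" using M by simp
  from X_step[OF this] have "0 \<in> cell M 1" using X_0[OF M] by simp
  then show thesis using True M collocation_approxD(3)[OF C M] by (intro that[of 1]) auto
next
  case False
  then have x': "x \<in> {0<..b}" using x by auto
  obtain j where j: "j \<in> {1..M}" "x \<in> {X M (j - 1)<..X M j}" using half_open_interval_exists[OF M x'] by blast
  then show thesis using collocation_approxD(2)[OF C M j] by (intro that[of j]) auto
qed

end

text \<open>
  Both alternatives for \<open>e\<close> satisfy these assumptions, so that the estimates are proved for all of them
  at once.
\<close>

locale vide_collocation =
  D: vide_data b \<nu> \<mu> e N a g K \<phi>b \<phi> \<psi> + C: collocation n \<xi> b \<mu> q \<nu> a K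
  for b \<nu> \<mu> e N a g K \<phi>b \<phi> \<psi> n \<xi> q +
  assumes e_pos: "0 < e" and e_le: "e \<le> real n" and N: "n \<le> N"
begin

abbreviation "r \<equiv> q * (\<mu> * e + 1)"

lemma r_pos: "0 < r"
  using C.q D.\<mu> e_pos by (intro mult_pos_pos add_pos_pos) auto

text \<open>
  From order \<open>n \<ge> e\<close> on, the bounded part of the weight is dominated by the singular one.
\<close>

lemma derivatives_singular:
  obtains D where "D 0 = (\<lambda>w. \<psi> (b - w powr (1 / \<mu>)))"
    and "\<And>i w. i < N \<Longrightarrow> w \<in> {0<..<b powr \<mu>} \<Longrightarrow> (D i has_real_derivative D (Suc i) w) (at w)"
    and "\<And>i. n \<le> i \<Longrightarrow> i \<le> N \<Longrightarrow> \<exists>C\<ge>0. \<forall>w\<in>{0<..<b powr \<mu>}. \<bar>D i w\<bar> \<le> C * w powr (e - real i)"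
proof (rule D.\<psi>_derivatives)
  fix D assume D: "D 0 = (\<lambda>w. \<psi> (b - w powr (1 / \<mu>)))"
    "\<And>i w. i < N \<Longrightarrow> w \<in> {0<..<b powr \<mu>} \<Longrightarrow> (D i has_real_derivative D (Suc i) w) (at w)"
    "\<And>i. i \<le> N \<Longrightarrow> \<exists>C\<ge>0. \<forall>w\<in>{0<..<b powr \<mu>}. \<bar>D i w\<bar> \<le> C * (1 + w powr (e - real i))"
  have "\<exists>C\<ge>0. \<forall>w\<in>{0<..<b powr \<mu>}. \<bar>D i w\<bar> \<le> C * w powr (e - real i)" if i: "n \<le> i" "i \<le> N" for i
  proof -
    obtain C where C: "C \<ge> 0" "\<forall>w\<in>{0<..<b powr \<mu>}. \<bar>D i w\<bar> \<le> C * (1 + w powr (e - real i))"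
      using D(3)[OF i(2)] by blast
    let ?B = "(b powr \<mu>) powr (real i - e) + 1"
    have "\<bar>D i w\<bar> \<le> (C * ?B) * w powr (e - real i)" if w: "w \<in> {0<..<b powr \<mu>}" for w
    proof -
      have "w powr 0 \<le> (b powr \<mu>) powr (0 - (e - real i)) * w powr (e - real i)"
        using w e_le i by (intro powr_le_powr_bounded) auto
      then have "1 + w powr (e - real i) \<le> ?B * w powr (e - real i)" using w by (simp add: distrib_right)
      then have "C * (1 + w powr (e - real i)) \<le> C * (?B * w powr (e - real i))" using C(1) by (rule mult_left_mono)
      then show ?thesis using C(2) w by (fastforce simp: mult.assoc)
    qed
    moreover have "0 \<le> C * ?B" using C(1) by (intro mult_nonneg_nonneg) auto
    ultimately show ?thesis by blast
  qed
  with D(1,2) show thesis by (rule that)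
qed

lemma interp_error_estimate:
  obtains A where "A \<ge> 0" and "\<And>M j x. j \<in> {1..M} \<Longrightarrow> x \<in> C.cell M j \<Longrightarrow>
    \<bar>C.interp_error \<psi> M j x\<bar> \<le> A * mesh_weight (q * \<mu> * e) n M (M + 1 - j)"
proof -
  obtain D where D: "D 0 = (\<lambda>w. \<psi> (b - w powr (1 / \<mu>)))"
    "\<And>i w. i < N \<Longrightarrow> w \<in> {0<..<b powr \<mu>} \<Longrightarrow> (D i has_real_derivative D (Suc i) w) (at w)"
    "\<And>i. n \<le> i \<Longrightarrow> i \<le> N \<Longrightarrow> \<exists>C\<ge>0. \<forall>w\<in>{0<..<b powr \<mu>}. \<bar>D i w\<bar> \<le> C * w powr (e - real i)"
    by (rule derivatives_singular) blast
  have "\<exists>A\<ge>0. \<forall>M. \<forall>j\<in>{1..M}. \<forall>x\<in>C.cell M j.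
    \<bar>C.interp_error \<psi> M j x\<bar> \<le> A * mesh_weight (q * \<mu> * e) n M (M + 1 - j)"
    by (rule C.interp_error_bound[OF e_pos e_le D.\<psi>_continuous D(1) D(2) D(3)]) (use N in auto)
  then show thesis using that by blast
qed

text \<open>
  The only property of the interpolation error that enters the estimates at the collocation points and
  those of \<open>\<phi>\<close>; it holds with \<open>t = n\<close> in general, and with \<open>t = n + 1\<close> under the quadrature condition.
\<close>

definition accumulated_le :: "real \<Rightarrow> real \<Rightarrow> bool" where
  "accumulated_le B t \<longleftrightarrow> (\<forall>M\<ge>2. \<forall>j\<in>{1..M}. \<forall>x\<in>C.cell M j.
     \<bar>C.accumulated_error \<psi> M j x\<bar> \<le> B * varpi r t M)"

lemma accumulated_le_order_n: "\<exists>B\<ge>0. accumulated_le B (real n)"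
proof -
  obtain A where A: "A \<ge> 0" "\<And>M j x. j \<in> {1..M} \<Longrightarrow> x \<in> C.cell M j \<Longrightarrow>
    \<bar>C.interp_error \<psi> M j x\<bar> \<le> A * mesh_weight (q * \<mu> * e) n M (M + 1 - j)"
    by (rule interp_error_estimate) blast
  have bq: "0 \<le> A * (b * q)" using A(1) D.b C.q by (intro mult_nonneg_nonneg) auto
  have part: "\<bar>integral {x..C.X M j} (C.interp_error \<psi> M j)\<bar> \<le> A * (b * q) * mesh_weight r (Suc n) M (M + 1 - j)"
    if "j \<in> {1..M}" "x \<in> C.cell M j" for M j x
    by (rule C.partial_integral_bound[OF D.\<psi>_continuous A that])
  show ?thesis
    unfolding accumulated_le_def
  proof (rule C.accumulated_error_bound[OF r_pos bq])
    fix M j :: nat and x assume j: "j \<in> {1..M}"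
    {
      assume x: "x \<in> C.cell M j"
      have "mesh_weight r (Suc n) M (M + 1 - j) \<le> mesh_weight r n M (M + 1 - j)"
      proof -
        have "real (M + 1 - j) \<ge> 1" using j by (simp add: of_nat_diff)
        then have "real (M + 1 - j) ^ n \<le> real (M + 1 - j) ^ Suc n" "0 < real (M + 1 - j)"
          by (auto intro: power_increasing simp del: power_Suc)
        then show ?thesis unfolding mesh_weight_def by (intro divide_left_mono mult_pos_pos zero_less_power) auto
      qed
      then show "\<bar>integral {x..C.X M j} (C.interp_error \<psi> M j)\<bar> \<le> A * (b * q) * mesh_weight r n M (M + 1 - j)"
        using part[OF j x] mult_left_mono[OF _ bq] order_trans by blast
    next
      have "C.X M (j - 1) \<in> C.cell M j" using C.X_step[OF j] by simp
      from part[OF j this] show "\<bar>integral (C.cell M j) (C.interp_error \<psi> M j)\<bar>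
          \<le> A * (b * q) * mesh_weight r (Suc n) M (M + 1 - j)" .
    }
  qed
qed

lemma accumulated_le_order_Suc_n:
  assumes N': "Suc n \<le> N" and orth: "integral {0..1} (node_poly n \<xi>) = 0"
  shows "\<exists>B\<ge>0. accumulated_le B (real n + 1)"
proof -
  obtain A where A: "A \<ge> 0" "\<And>M j x. j \<in> {1..M} \<Longrightarrow> x \<in> C.cell M j \<Longrightarrow>
    \<bar>C.interp_error \<psi> M j x\<bar> \<le> A * mesh_weight (q * \<mu> * e) n M (M + 1 - j)"
    by (rule interp_error_estimate) blast
  have bq: "0 \<le> A * (b * q)" using A(1) D.b C.q by (intro mult_nonneg_nonneg) auto
  obtain D where D: "D 0 = (\<lambda>w. \<psi> (b - w powr (1 / \<mu>)))"
    "\<And>i w. i < N \<Longrightarrow> w \<in> {0<..<b powr \<mu>} \<Longrightarrow> (D i has_real_derivative D (Suc i) w) (at w)"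
    "\<And>i. n \<le> i \<Longrightarrow> i \<le> N \<Longrightarrow> \<exists>C\<ge>0. \<forall>w\<in>{0<..<b powr \<mu>}. \<bar>D i w\<bar> \<le> C * w powr (e - real i)"
    by (rule derivatives_singular) blast
  have "\<exists>A\<ge>0. \<forall>M. \<forall>j\<in>{1..M}.
    \<bar>integral (C.cell M j) (C.interp_error \<psi> M j)\<bar> \<le> A * mesh_weight r (Suc (Suc n)) M (M + 1 - j)"
    by (rule C.interp_error_integral_bound[OF e_pos e_le D.\<psi>_continuous D(1) D(2) D(3) D(3) orth]) (use N' in auto)
  then obtain A' where A': "A' \<ge> 0" "\<And>M j. j \<in> {1..M} \<Longrightarrow>
    \<bar>integral (C.cell M j) (C.interp_error \<psi> M j)\<bar> \<le> A' * mesh_weight r (Suc (Suc n)) M (M + 1 - j)"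
    by blast
  define B where "B = A * (b * q) + A'"
  have B: "0 \<le> B" "A * (b * q) \<le> B" "A' \<le> B" using bq A'(1) by (auto simp: B_def)
  have "\<exists>C\<ge>0. \<forall>M\<ge>2. \<forall>j\<in>{1..M}. \<forall>x\<in>C.cell M j. \<bar>C.accumulated_error \<psi> M j x\<bar> \<le> C * varpi r (real (Suc n)) M"
  proof (rule C.accumulated_error_bound[OF r_pos B(1)])
    fix M j :: nat assume j: "j \<in> {1..M}"
    show "\<bar>integral (C.cell M j) (C.interp_error \<psi> M j)\<bar> \<le> B * mesh_weight r (Suc (Suc n)) M (M + 1 - j)"
      using A'(2)[OF j] mult_right_mono[OF B(3) mesh_weight_nonneg] order_trans by blast
    fix x assume x: "x \<in> C.cell M j"
    show "\<bar>integral {x..C.X M j} (C.interp_error \<psi> M j)\<bar> \<le> B * mesh_weight r (Suc n) M (M + 1 - j)"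
      using C.partial_integral_bound[OF D.\<psi>_continuous A j x] mult_right_mono[OF B(2) mesh_weight_nonneg] order_trans by blast
  qed
  then show ?thesis by (simp add: accumulated_le_def add.commute)
qed

lemma error_bounds:
  assumes M: "M \<ge> 2" "C.sufficiently_fine M"
    and col: "collocation_approx b \<nu> \<mu> q n \<xi> a g K \<phi>b M Y \<psi>h \<phi>h"
    and B: "0 \<le> B" "accumulated_le B t"
  defines "R \<equiv> B * C.stability_const * varpi r t M"
  shows "Linf_norm b (\<lambda>x. \<phi> x - \<phi>h x) \<le> ereal R"
    and "j \<in> {1..M} \<Longrightarrow> l \<in> {1..n} \<Longrightarrow> \<bar>\<psi> (C.coll M j l) - Y j l\<bar> \<le> C.op_bound * R"
    and "j \<in> {1..M} \<Longrightarrow> x \<in> C.cell M j \<Longrightarrow>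
      \<bar>\<psi> x - C.piece M (Y j) j x\<bar> \<le> \<bar>C.interp_error \<psi> M j x\<bar> + C.growth * R"
proof -
  have R0: "0 \<le> B * varpi r t M" using B(1) varpi_ge(2)[OF M(1), of r t] by simp
  have acc: "\<bar>C.accumulated_error \<psi> M j x\<bar> \<le> B * varpi r t M" if "j \<in> {1..M}" "x \<in> C.cell M j" for j x
    using B(2) M(1) that unfolding accumulated_le_def by blast
  have R: "R = B * varpi r t M * C.stability_const" by (simp add: R_def)
  have "continuous_on {0..b} (\<lambda>x. \<phi> x - \<phi>h x)"
    by (rule C.collocation_error(1)[OF M(2) D.sol D.\<psi>_continuous col R0 acc])
  moreover have "\<bar>\<phi> x - \<phi>h x\<bar> \<le> R" if "x \<in> {0..b}" for x
    unfolding R by (rule C.collocation_error(2)[OF M(2) D.sol D.\<psi>_continuous col R0 acc that])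
  ultimately show "Linf_norm b (\<lambda>x. \<phi> x - \<phi>h x) \<le> ereal R"
    by (intro Linf_norm_le continuous_imp_measurable_on_sets_lebesgue) auto
  show "j \<in> {1..M} \<Longrightarrow> l \<in> {1..n} \<Longrightarrow> \<bar>\<psi> (C.coll M j l) - Y j l\<bar> \<le> C.op_bound * R"
    unfolding R by (rule C.collocation_error(3)[OF M(2) D.sol D.\<psi>_continuous col R0 acc])
  show "j \<in> {1..M} \<Longrightarrow> x \<in> C.cell M j \<Longrightarrow>
      \<bar>\<psi> x - C.piece M (Y j) j x\<bar> \<le> \<bar>C.interp_error \<psi> M j x\<bar> + C.growth * R"
    unfolding R by (rule C.collocation_error(4)[OF M(2) D.sol D.\<psi>_continuous col R0 acc])
qed

text \<open>
  The pointwise interpolation error dominates that of \<open>\<psi>h\<close>, whereas \<open>\<phi>h\<close> profits from integration.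
\<close>

lemma convergence:
  "\<exists>M0\<ge>1. \<exists>C::real. \<forall>M>M0.
     collocation_well_posed b \<nu> \<mu> q n \<xi> a g K \<phi>b M \<and>
     (\<forall>Y \<psi>h \<phi>h. collocation_approx b \<nu> \<mu> q n \<xi> a g K \<phi>b M Y \<psi>h \<phi>h \<longrightarrow>
        Linf_norm b (\<lambda>x. \<psi> x - \<psi>h x) \<le> ereal (C * real M powr (- min (q * \<mu> * e) (real n))) \<and>
        Linf_norm b (\<lambda>x. \<phi> x - \<phi>h x) \<le> ereal (C * varpi r (real n) M))"
proof -
  obtain A where A: "A \<ge> 0" "\<And>M j x. j \<in> {1..M} \<Longrightarrow> x \<in> C.cell M j \<Longrightarrow>
    \<bar>C.interp_error \<psi> M j x\<bar> \<le> A * mesh_weight (q * \<mu> * e) n M (M + 1 - j)"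
    by (rule interp_error_estimate) blast
  obtain B where B: "0 \<le> B" "accumulated_le B (real n)" using accumulated_le_order_n by blast
  obtain M0 where M0: "M0 \<ge> 1" "\<And>M. M > M0 \<Longrightarrow> C.sufficiently_fine M"
    using C.eventually_sufficiently_fine by blast
  define S where "S = B * C.stability_const"
  define c where "c = A + C.growth * S + S"
  have S: "0 \<le> S" "0 \<le> C.growth * S"
    using B(1) C.stability_const_pos C.growth_nonneg by (simp_all add: S_def)
  show ?thesis
  proof (rule exI[of _ M0], intro conjI M0(1) exI[of _ c] allI impI)
    fix M assume M: "M > M0"
    then have M2: "M \<ge> 2" and M1: "M \<ge> 1" using M0(1) by auto
    note fine = M0(2)[OF M]
    show "collocation_well_posed b \<nu> \<mu> q n \<xi> a g K \<phi>b M"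
      by (rule C.collocation_well_posed_if_sufficiently_fine[OF fine])
    fix Y \<psi>h \<phi>h assume col: "collocation_approx b \<nu> \<mu> q n \<xi> a g K \<phi>b M Y \<psi>h \<phi>h"
    let ?v = "varpi r (real n) M" and ?w = "real M powr (- min (q * \<mu> * e) (real n))"
    note err = error_bounds[OF M2 fine col B, folded S_def]
    have "S * ?v \<le> c * ?v"
      using A(1) S varpi_ge(2)[OF M2, of r "real n"] unfolding c_def by (intro mult_right_mono) auto
    then show "Linf_norm b (\<lambda>x. \<phi> x - \<phi>h x) \<le> ereal (c * ?v)"
      using err(1) by (meson ereal_less_eq(3) order_trans)
    have vw: "?v \<le> ?w"
      using varpi_shift_le[OF M2 C.q, of "q * \<mu> * e" "real n"] by (simp add: algebra_simps)
    show "Linf_norm b (\<lambda>x. \<psi> x - \<psi>h x) \<le> ereal (c * ?w)"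
    proof (rule Linf_norm_le)
      show "(\<lambda>x. \<psi> x - \<psi>h x) \<in> borel_measurable (lebesgue_on {0..b})"
        by (intro borel_measurable_diff C.collocation_approx_measurable[OF col M1]
            continuous_imp_measurable_on_sets_lebesgue D.\<psi>_continuous) auto
      fix x assume x: "x \<in> {0..b}"
      obtain j where j: "j \<in> {1..M}" "x \<in> C.cell M j" and h: "\<psi>h x = C.piece M (Y j) j x"
        by (rule C.psi_h_on_piece[OF col M1 x]) blast
      have "M + 1 - j \<in> {1..M}" using j(1) by auto
      from mesh_weight_le[OF this] have "A * mesh_weight (q * \<mu> * e) n M (M + 1 - j) \<le> A * ?w"
        by (rule mult_left_mono[OF _ A(1)])
      moreover have "C.growth * (S * ?v) \<le> C.growth * S * ?w"
        using mult_left_mono[OF vw S(2)] by (simp add: mult.assoc)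
      ultimately have "\<bar>\<psi> x - \<psi>h x\<bar> \<le> A * ?w + C.growth * S * ?w"
        using err(3)[OF j] A(2)[OF j] unfolding h by linarith
      also have "\<dots> = (A + C.growth * S) * ?w" by (simp only: distrib_right)
      also have "\<dots> \<le> c * ?w" using S unfolding c_def by (intro mult_right_mono) simp_all
      finally show "\<bar>\<psi> x - \<psi>h x\<bar> \<le> c * ?w" .
    qed
  qed
qed

text \<open>
  At the collocation points there is no interpolation error, and at \<open>x = 0\<close>, far from the singularity, it
  is \<open>O(1 / M\<^sup>n)\<close>.
\<close>

lemma superconvergence:
  assumes N': "Suc n \<le> N" and orth: "integral {0..1} (node_poly n \<xi>) = 0"
  shows "\<exists>M0\<ge>1. \<exists>C::real. \<forall>M>M0.
     collocation_well_posed b \<nu> \<mu> q n \<xi> a g K \<phi>b M \<and>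
     (\<forall>Y \<psi>h \<phi>h. collocation_approx b \<nu> \<mu> q n \<xi> a g K \<phi>b M Y \<psi>h \<phi>h \<longrightarrow>
        Linf_norm b (\<lambda>x. \<phi> x - \<phi>h x) \<le> ereal (C * varpi r (real n + 1) M) \<and>
        Max {\<bar>\<psi> x - psi_piece b \<mu> q n \<xi> M Y j x\<bar> | j x. j \<in> {1..M} \<and> x \<in> C.coll M j ` {1..n}}
          \<le> C * varpi r (real n + 1) M \<and>
        \<bar>\<psi> 0 - \<psi>h 0\<bar> \<le> C * varpi r (real n) M)"
proof -
  obtain A where A: "A \<ge> 0" "\<And>M j x. j \<in> {1..M} \<Longrightarrow> x \<in> C.cell M j \<Longrightarrow>
    \<bar>C.interp_error \<psi> M j x\<bar> \<le> A * mesh_weight (q * \<mu> * e) n M (M + 1 - j)"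
    by (rule interp_error_estimate) blast
  obtain B where B: "0 \<le> B" "accumulated_le B (real n + 1)"
    using accumulated_le_order_Suc_n[OF N' orth] by blast
  obtain M0 where M0: "M0 \<ge> 1" "\<And>M. M > M0 \<Longrightarrow> C.sufficiently_fine M"
    using C.eventually_sufficiently_fine by blast
  define S where "S = B * C.stability_const"
  define c where "c = S + C.op_bound * S + (A + C.growth * S) / ln 2"
  have S: "0 \<le> S" "0 \<le> C.growth * S" "0 \<le> C.op_bound * S"
    using B(1) C.stability_const_pos C.growth_nonneg C.op_bound_nonneg by (simp_all add: S_def)
  have "0 \<le> (A + C.growth * S) / ln 2" using A(1) S by (intro divide_nonneg_pos add_nonneg_nonneg) auto
  then have c: "S \<le> c" "C.op_bound * S \<le> c" "(A + C.growth * S) / ln 2 \<le> c"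
    using S unfolding c_def by linarith+
  show ?thesis
  proof (rule exI[of _ M0], intro conjI M0(1) exI[of _ c] allI impI)
    fix M assume M: "M > M0"
    then have M2: "M \<ge> 2" and M1: "M \<ge> 1" using M0(1) by auto
    note fine = M0(2)[OF M]
    show "collocation_well_posed b \<nu> \<mu> q n \<xi> a g K \<phi>b M"
      by (rule C.collocation_well_posed_if_sufficiently_fine[OF fine])
    fix Y \<psi>h \<phi>h assume col: "collocation_approx b \<nu> \<mu> q n \<xi> a g K \<phi>b M Y \<psi>h \<phi>h"
    let ?v = "varpi r (real n + 1) M" and ?w = "varpi r (real n) M"
    have v0: "0 < ?v" and w0: "0 < ?w" by (rule varpi_ge(2)[OF M2])+
    note err = error_bounds[OF M2 fine col B, folded S_def]
    have "S * ?v \<le> c * ?v" using c(1) v0 by (intro mult_right_mono) auto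
    then show "Linf_norm b (\<lambda>x. \<phi> x - \<phi>h x) \<le> ereal (c * ?v)"
      using err(1) by (meson ereal_less_eq(3) order_trans)
    let ?d = "\<lambda>(j, l). \<bar>\<psi> (C.coll M j l) - psi_piece b \<mu> q n \<xi> M Y j (C.coll M j l)\<bar>"
    have T: "{\<bar>\<psi> x - psi_piece b \<mu> q n \<xi> M Y j x\<bar> | j x. j \<in> {1..M} \<and> x \<in> C.coll M j ` {1..n}}
        = ?d ` ({1..M} \<times> {1..n})" by force
    show "Max {\<bar>\<psi> x - psi_piece b \<mu> q n \<xi> M Y j x\<bar> | j x. j \<in> {1..M} \<and> x \<in> C.coll M j ` {1..n}} \<le> c * ?v"
      unfolding T
    proof (rule Max.boundedI)
      show "?d ` ({1..M} \<times> {1..n}) \<noteq> {}" using M1 C.n by auto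
      fix y assume "y \<in> ?d ` ({1..M} \<times> {1..n})"
      then obtain j l where jl: "j \<in> {1..M}" "l \<in> {1..n}" "y = ?d (j, l)" by auto
      have "y \<le> C.op_bound * S * ?v"
        using err(2)[OF jl(1,2)] C.psi_piece_coll_point[OF jl(1,2), of Y] unfolding jl(3)
        by (simp add: mult.assoc)
      also have "\<dots> \<le> c * ?v" using c(2) v0 by (intro mult_right_mono) auto
      finally show "y \<le> c * ?v" .
    qed simp
    have one: "1 \<in> {1..M}" using M1 by simp
    have x0: "0 \<in> C.cell M 1" using C.X_step[OF one] C.X_0[OF M1] by simp
    have "\<bar>\<psi> 0 - \<psi>h 0\<bar> \<le> \<bar>C.interp_error \<psi> M 1 0\<bar> + C.growth * (S * ?v)"
      using err(3)[OF one x0] C.collocation_approxD(3)[OF col M1] by simp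
    also have "\<bar>C.interp_error \<psi> M 1 0\<bar> \<le> A * mesh_weight (q * \<mu> * e) n M (M + 1 - 1)" by (rule A(2)[OF one x0])
    also have "mesh_weight (q * \<mu> * e) n M (M + 1 - 1) = mesh_weight r n M M"
      unfolding mesh_weight_def using M1 by simp
    also have "A * mesh_weight r n M M \<le> A * ((1 / ln 2) * ?w)"
      using mesh_weight_le[of M M r n] varpi_ge(1)[OF M2, of r "real n"] M1 A(1)
      by (intro mult_left_mono) auto
    also have "C.growth * (S * ?v) = C.growth * S * ?v" by simp
    also have "C.growth * S * ?v \<le> C.growth * S * ((1 / ln 2) * ?w)"
      by (rule mult_left_mono[OF varpi_Suc_le[OF M2] S(2)])
    finally have "\<bar>\<psi> 0 - \<psi>h 0\<bar> \<le> (A + C.growth * S) / ln 2 * ?w"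
      by (simp add: add_divide_distrib distrib_right)
    also have "\<dots> \<le> c * ?w" using c(3) w0 by (intro mult_right_mono) auto
    finally show "\<bar>\<psi> 0 - \<psi>h 0\<bar> \<le> c * ?w" .
  qed
qed

end

theorem corollary7p1:
  fixes b \<nu> \<mu> q \<phi>b :: real
    and n :: nat
    and \<xi> :: "nat \<Rightarrow> real"
    and a g \<phi> \<psi> :: "real \<Rightarrow> real"
    and K :: "real \<Rightarrow> real \<Rightarrow> real"
  assumes "b > 0" and "0 < \<nu>" and "\<nu> < 1" and "q \<ge> 1" and "n \<ge> 2"
    and "0 \<le> \<xi> 1" and "strict_mono_on {1..n} \<xi>" and "\<xi> n \<le> 1"
    and "0 < \<mu>" and "\<mu> < 1" and "\<nu> / \<mu> \<in> \<nat>"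
    and "vide_solution b \<nu> a g K \<phi>b \<phi> \<psi>"
  shows
    "(Ck_interval n b a \<and> Ck_interval n b g \<and> Ck_triangle n b K \<and> (\<forall>x\<in>{0..b}. K x x \<noteq> 0)
      \<longrightarrow> (\<exists>M0\<ge>1. \<exists>C::real. \<forall>M>M0.
            collocation_well_posed b \<nu> \<mu> q n \<xi> a g K \<phi>b M \<and>
            (\<forall>Y \<psi>h \<phi>h. collocation_approx b \<nu> \<mu> q n \<xi> a g K \<phi>b M Y \<psi>h \<phi>h \<longrightarrow>
              Linf_norm b (\<lambda>x. \<psi> x - \<psi>h x)
                \<le> ereal (C * (if 1 / \<mu> \<in> \<nat> \<or> 1 / \<mu> > real n
                               then real M powr (- min (q * \<mu> * real n) (real n))
                               else real M powr (- min q (real n)))) \<and>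
              Linf_norm b (\<lambda>x. \<phi> x - \<phi>h x)
                \<le> ereal (C * (if 1 / \<mu> \<in> \<nat> \<or> 1 / \<mu> > real n
                               then varpi (q * (\<mu> * real n + 1)) (real n) M
                               else varpi (2 * q) (real n) M)))))
     \<and>
     (Ck_interval (n + 1) b a \<and> Ck_interval (n + 1) b g \<and> Ck_triangle (n + 1) b K \<and>
      (\<forall>x\<in>{0..b}. K x x \<noteq> 0) \<and>
      integral {0..1} (\<lambda>\<zeta>. \<Prod>l=1..n. \<zeta> - \<xi> l) = 0
      \<longrightarrow> (\<exists>M0\<ge>1. \<exists>C::real. \<forall>M>M0.
            collocation_well_posed b \<nu> \<mu> q n \<xi> a g K \<phi>b M \<and>
            (\<forall>Y \<psi>h \<phi>h. collocation_approx b \<nu> \<mu> q n \<xi> a g K \<phi>b M Y \<psi>h \<phi>h \<longrightarrow>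
              Linf_norm b (\<lambda>x. \<phi> x - \<phi>h x)
                \<le> ereal (C * (if 1 / \<mu> \<in> \<nat> \<or> 1 / \<mu> > real n
                               then varpi (q * (\<mu> * real n + 1)) (real n + 1) M
                               else varpi (2 * q) (real n + 1) M)) \<and>
              Max {\<bar>\<psi> x - psi_piece b \<mu> q n \<xi> M Y j x\<bar> | j x.
                     j \<in> {1..M} \<and> x \<in> coll_point b \<mu> q \<xi> M j ` {1..n}}
                \<le> C * (if 1 / \<mu> \<in> \<nat> \<or> 1 / \<mu> > real n
                        then varpi (q * (\<mu> * real n + 1)) (real n + 1) M
                        else varpi (2 * q) (real n + 1) M) \<and>
              \<bar>\<psi> 0 - \<psi>h 0\<bar>
                \<le> C * (if 1 / \<mu> \<in> \<nat> \<or> 1 / \<mu> > real n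
                        then varpi (q * (\<mu> * real n + 1)) (real n) M
                        else varpi (2 * q) (real n) M))))"
proof -
  \<comment> \<open>The exponent for which the two alternatives of the statement coincide with the general rates.\<close>
  define e where "e = (if 1 / \<mu> \<in> \<nat> \<or> 1 / \<mu> > real n then real n else 1 / \<mu>)"
  have e: "0 < e" "e \<le> real n" "1 / \<mu> \<in> \<nat> \<or> e \<le> 1 / \<mu>"
    using assms(5,9) by (auto simp: e_def)
  have rate1: "(if 1 / \<mu> \<in> \<nat> \<or> 1 / \<mu> > real n then real M powr (- min (q * \<mu> * real n) (real n))
      else real M powr (- min q (real n))) = real M powr (- min (q * \<mu> * e) (real n))" for M
    using assms(9) by (simp add: e_def)
  have rate2: "(if 1 / \<mu> \<in> \<nat> \<or> 1 / \<mu> > real n then varpi (q * (\<mu> * real n + 1)) s M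
      else varpi (2 * q) s M) = varpi (q * (\<mu> * e + 1)) s M" for s M
    using assms(9) by (simp add: e_def mult.commute)
  have loc: "vide_collocation b \<nu> \<mu> e N a g K \<phi>b \<phi> \<psi> n \<xi> q"
    if "Ck_interval N b a" "Ck_interval N b g" "Ck_triangle N b K" "n \<le> N" for N
    using that assms e Ck_interval_continuous[OF that(1)] Ck_triangle_continuous[OF that(3)]
    by unfold_locales auto
  show ?thesis
    unfolding rate1 rate2
  proof ((intro conjI impI; elim conjE), goal_cases)
    case 1
    then show ?case by (intro vide_collocation.convergence[OF loc]) auto
  next
    case 2
    then have "integral {0..1} (node_poly n \<xi>) = 0" by (simp add: node_poly_def[abs_def])
    with 2 show ?case
      using vide_collocation.superconvergence[OF loc, of "n + 1"] by simp
  qed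
qed

end
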